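(* Let $p$ be a prime and let $K \in \mathcal{L}$ be a non-trivial pro-$p$ group. Then $K^{ab} = K/K'$ is infinite.
   Context: $K'$ denotes the (closed) commutator subgroup of $K$; a "pro-$p$ subgroup" means a closed subgroup. The class $\mathcal{L}$: define classes $\mathcal{G}_n$ of pro-$p$ groups inductively. $\mathcal{G}_0$ is the class of all finitely generated free pro-$p$ groups. A group $G_n$ belongs to $\mathcal{G}_n$ ($n\ge 1$) if there is a decomposition $G_n = G_{n-1} \coprod_C A$ as an amalgamated free product in the category of pro-$p$ groups, where $G_{n-1} \in \mathcal{G}_{n-1}$, $C$ is a self-centralised procyclic subgroup of $G_{n-1}$, and $A$ is a finitely generated free abelian pro-$p$ group such that $C$ is a direct summand of $A$. The class $\mathcal{L}$ consists of all finitely generated pro-$p$ subgroups of groups $G_n \in \mathcal{G}_n$, $n \ge 0$. *)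

theory Defs
  imports "HOL-Analysis.Analysis" "HOL-Algebra.Coset" "HOL-Algebra.Generated_Groups" "HOL-Library.Infinite_Typeclass"
begin

record 'a topgroup = "'a monoid" +
  gtop :: "'a topology"

locale topological_group = group G for G :: "'a topgroup" (structure) +
  assumes topspace_gtop: "topspace (gtop G) = carrier G"
    and continuous_mult:
      "continuous_map (prod_topology (gtop G) (gtop G)) (gtop G) (\<lambda>(x, y). x \<otimes> y)"
    and continuous_inv: "continuous_map (gtop G) (gtop G) (\<lambda>x. inv x)"

text \<open>
  A profinite group is a compact Hausdorff topological group whose open subgroups form a base of
  neighbourhoods of the identity. It is pro-\<open>p\<close> if all its open normal subgroups have
  \<open>p\<close>-power index. (The \<open>order\<close> of an infinite group is \<open>0\<close>, which is not a power of a prime.)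
\<close>

definition profinite_group :: "'a topgroup \<Rightarrow> bool" where
  "profinite_group G \<longleftrightarrow>
     topological_group G \<and> compact_space (gtop G) \<and> Hausdorff_space (gtop G) \<and>
     (\<forall>U. openin (gtop G) U \<and> \<one>\<^bsub>G\<^esub> \<in> U \<longrightarrow>
        (\<exists>N. subgroup N G \<and> openin (gtop G) N \<and> N \<subseteq> U))"

definition pro_p_group :: "nat \<Rightarrow> 'a topgroup \<Rightarrow> bool" where
  "pro_p_group p G \<longleftrightarrow>
     profinite_group G \<and>
     (\<forall>N. N \<lhd> G \<and> openin (gtop G) N \<longrightarrow> (\<exists>k. order (G Mod N) = p ^ k))"

definition cont_hom :: "'a topgroup \<Rightarrow> 'b topgroup \<Rightarrow> ('a \<Rightarrow> 'b) set" where
  "cont_hom G H = {h \<in> hom G H. continuous_map (gtop G) (gtop H) h}"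

definition topgroup_iso :: "'a topgroup \<Rightarrow> 'b topgroup \<Rightarrow> bool" where
  "topgroup_iso G H \<longleftrightarrow> (\<exists>h. h \<in> iso G H \<and> homeomorphic_map (gtop G) (gtop H) h)"

definition subtopgroup :: "'a topgroup \<Rightarrow> 'a set \<Rightarrow> 'a topgroup" where
  "subtopgroup G H = G\<lparr>carrier := H, gtop := subtopology (gtop G) H\<rparr>"

definition closed_subgroup :: "'a set \<Rightarrow> 'a topgroup \<Rightarrow> bool" where
  "closed_subgroup H G \<longleftrightarrow> subgroup H G \<and> closedin (gtop G) H"

definition top_generate :: "'a topgroup \<Rightarrow> 'a set \<Rightarrow> 'a set" where
  "top_generate G S = gtop G closure_of (generate G S)"

definition top_fin_gen :: "'a topgroup \<Rightarrow> bool" where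
  "top_fin_gen G \<longleftrightarrow> (\<exists>S. finite S \<and> S \<subseteq> carrier G \<and> top_generate G S = carrier G)"

definition procyclic_subgroup :: "'a set \<Rightarrow> 'a topgroup \<Rightarrow> bool" where
  "procyclic_subgroup C G \<longleftrightarrow> (\<exists>c\<in>carrier G. C = top_generate G {c})"

definition centralizer :: "'a topgroup \<Rightarrow> 'a set \<Rightarrow> 'a set" where
  "centralizer G C = {g \<in> carrier G. \<forall>c\<in>C. g \<otimes>\<^bsub>G\<^esub> c = c \<otimes>\<^bsub>G\<^esub> g}"

definition self_centralised :: "'a set \<Rightarrow> 'a topgroup \<Rightarrow> bool" where
  "self_centralised C G \<longleftrightarrow> centralizer G C = C"

text \<open>Direct summands of an abelian pro-\<open>p\<close> group, in the category of such groups.\<close>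

definition direct_summand :: "'a set \<Rightarrow> 'a topgroup \<Rightarrow> bool" where
  "direct_summand C A \<longleftrightarrow>
     closed_subgroup C A \<and>
     (\<exists>B. closed_subgroup B A \<and> C \<inter> B = {\<one>\<^bsub>A\<^esub>} \<and> C <#>\<^bsub>A\<^esub> B = carrier A)"

definition commutator_subgroup :: "'a topgroup \<Rightarrow> 'a set" where
  "commutator_subgroup G = gtop G closure_of (derived G (carrier G))"

text \<open>
  The universal properties below quantify over groups whose elements lie in one type \<open>'a\<close>, which
  plays the role of a universe. For infinite \<open>'a\<close> this includes copies of all finite
  \<open>p\<close>-groups, so that, every pro-\<open>p\<close> group being an inverse limit of finite ones, the properties
  then hold with respect to all pro-\<open>p\<close> groups. Finitely generated pro-\<open>p\<close> groups have at most
  the cardinality of the continuum, so \<open>'a = nat set\<close> already accommodates all of them.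
\<close>

definition free_object :: "('a topgroup \<Rightarrow> bool) \<Rightarrow> 'a topgroup \<Rightarrow> 'a set \<Rightarrow> bool" where
  "free_object \<C> F X \<longleftrightarrow>
     \<C> F \<and> X \<subseteq> carrier F \<and>
     (\<forall>H f. \<C> H \<and> f \<in> X \<rightarrow> carrier H \<longrightarrow>
        (\<exists>h\<in>cont_hom F H. (\<forall>x\<in>X. h x = f x) \<and>
           (\<forall>h'\<in>cont_hom F H. (\<forall>x\<in>X. h' x = f x) \<longrightarrow> (\<forall>x\<in>carrier F. h' x = h x))))"

definition fg_free_pro_p :: "nat \<Rightarrow> 'a topgroup \<Rightarrow> bool" where
  "fg_free_pro_p p F \<longleftrightarrow> (\<exists>X. finite X \<and> free_object (pro_p_group p) F X)"

definition fg_free_abelian_pro_p :: "nat \<Rightarrow> 'a topgroup \<Rightarrow> bool" where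
  "fg_free_abelian_pro_p p A \<longleftrightarrow>
     (\<exists>X. finite X \<and> free_object (\<lambda>H. pro_p_group p H \<and> comm_group H) A X)"

text \<open>
  \<open>G\<close>, with the structure maps \<open>\<phi>\<close> and \<open>\<psi>\<close>, is the free product of \<open>G\<^sub>1\<close> and \<open>G\<^sub>2\<close>
  amalgamating \<open>C\<close> along the embeddings \<open>f\<close> and \<open>g\<close>, i.e. their pushout in the category of
  pro-\<open>p\<close> groups.
\<close>

definition amalgamated_product ::
  "nat \<Rightarrow> 'a topgroup \<Rightarrow> ('a \<Rightarrow> 'a) \<Rightarrow> 'a topgroup \<Rightarrow> ('a \<Rightarrow> 'a) \<Rightarrow> 'a topgroup \<Rightarrow>
   'a topgroup \<Rightarrow> ('a \<Rightarrow> 'a) \<Rightarrow> ('a \<Rightarrow> 'a) \<Rightarrow> bool" where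
  "amalgamated_product p C f G\<^sub>1 g G\<^sub>2 G \<phi> \<psi> \<longleftrightarrow>
     pro_p_group p C \<and> pro_p_group p G\<^sub>1 \<and> pro_p_group p G\<^sub>2 \<and> pro_p_group p G \<and>
     f \<in> cont_hom C G\<^sub>1 \<and> inj_on f (carrier C) \<and>
     g \<in> cont_hom C G\<^sub>2 \<and> inj_on g (carrier C) \<and>
     \<phi> \<in> cont_hom G\<^sub>1 G \<and> \<psi> \<in> cont_hom G\<^sub>2 G \<and>
     (\<forall>c\<in>carrier C. \<phi> (f c) = \<psi> (g c)) \<and>
     (\<forall>(H :: 'a topgroup) \<alpha> \<beta>. pro_p_group p H \<and> \<alpha> \<in> cont_hom G\<^sub>1 H \<and> \<beta> \<in> cont_hom G\<^sub>2 H \<and>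
        (\<forall>c\<in>carrier C. \<alpha> (f c) = \<beta> (g c)) \<longrightarrow>
        (\<exists>h\<in>cont_hom G H.
           (\<forall>x\<in>carrier G\<^sub>1. h (\<phi> x) = \<alpha> x) \<and> (\<forall>y\<in>carrier G\<^sub>2. h (\<psi> y) = \<beta> y) \<and>
           (\<forall>h'\<in>cont_hom G H.
              (\<forall>x\<in>carrier G\<^sub>1. h' (\<phi> x) = \<alpha> x) \<and> (\<forall>y\<in>carrier G\<^sub>2. h' (\<psi> y) = \<beta> y) \<longrightarrow>
              (\<forall>z\<in>carrier G. h' z = h z))))"

text \<open>
  In an extension of a centraliser, the common subgroup \<open>C\<close> is a subset of \<open>G\<^sub>0\<close> and is embedded
  by \<open>\<iota>\<close> as a direct summand of \<open>A\<close>. The maps \<open>\<phi>\<close> and \<open>\<psi>\<close> are then automatically injective: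
  if \<open>A = \<iota>(C) \<times> B\<close>, both factors embed compatibly into \<open>G\<^sub>0 \<times> B\<close>.
\<close>

primrec class_G :: "nat \<Rightarrow> nat \<Rightarrow> 'a topgroup set" where
  "class_G p 0 = {F. fg_free_pro_p p F}"
| "class_G p (Suc n) =
     {G. \<exists>G\<^sub>0 C A \<iota> \<phi> \<psi>.
        G\<^sub>0 \<in> class_G p n \<and>
        procyclic_subgroup C G\<^sub>0 \<and> self_centralised C G\<^sub>0 \<and>
        fg_free_abelian_pro_p p A \<and> direct_summand (\<iota> ` C) A \<and>
        amalgamated_product p (subtopgroup G\<^sub>0 C) (\<lambda>c. c) G\<^sub>0 \<iota> A G \<phi> \<psi>}"

definition class_L :: "nat \<Rightarrow> 'a topgroup set" where
  "class_L p =
     {K. pro_p_group p K \<and> top_fin_gen K \<and>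
         (\<exists>n (G :: 'a topgroup) H.
            G \<in> class_G p n \<and> closed_subgroup H G \<and> topgroup_iso K (subtopgroup G H))}"

end

theory Submission
  imports Defs "HOL-Algebra.Group_Action"
begin

text \<open>
  By induction along the construction of a group \<open>G\<close> in \<open>\<G>\<^sub>n\<close>, every non-trivial subgroup \<open>H\<close> of \<open>G\<close>
  contains an element no positive power of which lies in the closure of the derived subgroup of \<open>H\<close>.

  Let \<open>G = G\<^sub>0 \<amalg>\<^sub>C A\<close> with \<open>A = C \<times> B\<close>. Killing \<open>B\<close> gives a retraction \<open>\<rho> : G \<rightarrow> G\<^sub>0\<close>, and if \<open>\<rho>\<close> is
  not trivial on \<open>H\<close> the claim follows from that for \<open>\<rho>(H)\<close>. Otherwise choose \<open>w \<noteq> 1\<close> in \<open>H\<close> and a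
  finite quotient \<open>P\<close> of \<open>G\<close> in which \<open>w\<close> survives. The augmentation ideal of \<open>\<bbbF>\<^sub>p[P]\<close> is nilpotent, so
  the map from \<open>B\<close> to \<open>\<bbbF>\<^sub>p[P]\<close> lifts to characteristic \<open>0\<close>: basis elements of \<open>A\<close> go to \<open>1 + X\<close>,
  where the variables \<open>X\<close> form a family for each conjugate of the image of \<open>B\<close>, commute within one
  family and satisfy no other relations, except that long monomials vanish. With \<open>G\<^sub>0\<close> permuting the
  families through \<open>P\<close>, this yields compatible homomorphisms from \<open>G\<close> to finite \<open>p\<close>-groups of
  matrices over \<open>\<int>/p\<^sup>m\<close>, for all \<open>m\<close>, which are unipotent on \<open>H\<close> and non-trivial at \<open>w\<close> modulo \<open>p\<close>.
  A matrix entry of lowest degree that is not identically zero on \<open>H\<close> is additive on \<open>H\<close>, and its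
  values for varying \<open>m\<close> detect infinite order. Free pro-\<open>p\<close> groups are treated in the same way, with
  \<open>G\<^sub>0\<close> trivial.
\<close>


section \<open>Nilpotency of the augmentation ideal modulo \<open>p\<close>\<close>

text \<open>Two demands pull apart. That \<open>w\<close> is non-trivial is visible in
  \<open>P\<close>, where everything is torsion; infinite order needs characteristic 0, where y - 1
  is not nilpotent in the group ring of \<open>P\<close> for y other than 1. The truncated monomial
  algebra mediates: it has a basis of words over every ring, and modulo p it still maps to the
  functions on \<open>P\<close>, because there products of \<open>c\<close> augmentation elements
  vanish.

  The universal properties only yield maps into pro-p groups over a fixed type, so a representation
  over the p-adic integers is replaced by its reductions modulo \<open>p ^ Suc m\<close>, whose
  values lie in finite p-groups. They are compatible because they agree on topological generators.

  To let \<open>G0\<close> permute the families with finite matrices, families are labelled by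
  commuting tuples in \<open>P\<close>, on which \<open>P\<close> acts by conjugation. An element of
  \<open>G0\<close> thus acts by conjugation and an element of the complement of \<open>C\<close> by
  one-sided translation; the relation \<open>rel\<close> covers both by translating on both sides.
  Only the conjugation part is recorded in the component \<open>q\<close> of a matrix, so this
  component dies on the kernel of the retraction.\<close>

lemma (in group) finite_subgroupI:
  assumes "finite H" "H \<subseteq> carrier G" "\<one> \<in> H"
    and mult: "\<And>x y. x \<in> H \<Longrightarrow> y \<in> H \<Longrightarrow> x \<otimes> y \<in> H"
  shows "subgroup H G"
proof (rule subgroupI)
  fix a assume a: "a \<in> H"
  have "inj_on (\<lambda>y. a \<otimes> y) H" by (intro inj_onI) (use a assms(2) in \<open>metis Units_eq Units_l_cancel subsetD\<close>)
  then have "(\<lambda>y. a \<otimes> y) ` H = H" using endo_inj_surj[OF assms(1)] mult[OF a] by blast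
  then obtain b where b: "b \<in> H" "a \<otimes> b = \<one>" using assms(3) by (metis (no_types, lifting) imageE)
  then have "inv a = b" using a assms(2) by (metis inv_equality inv_inv inv_closed subsetD)
  then show "inv a \<in> H" using b by simp
qed (use assms in auto)

text \<open>\<open>BijGroup X\<close> consists of bijections that are \<open>undefined\<close> off
  \<open>X\<close>, hence the restriction.\<close>

lemma group_actionI:
  assumes "group G" and closed: "\<And>g x. g \<in> carrier G \<Longrightarrow> x \<in> X \<Longrightarrow> f g x \<in> X"
    and one: "\<And>x. x \<in> X \<Longrightarrow> f \<one>\<^bsub>G\<^esub> x = x"
    and mult: "\<And>g h x. g \<in> carrier G \<Longrightarrow> h \<in> carrier G \<Longrightarrow> x \<in> X \<Longrightarrow> f (g \<otimes>\<^bsub>G\<^esub> h) x = f g (f h x)"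
  shows "group_action G X (\<lambda>g. restrict (f g) X)"
proof -
  interpret group G by fact
  have inv: "f (inv\<^bsub>G\<^esub> g) (f g x) = x" "f g (f (inv\<^bsub>G\<^esub> g) x) = x" if "g \<in> carrier G" "x \<in> X" for g x
    using that mult[of "inv\<^bsub>G\<^esub> g" g x] mult[of g "inv\<^bsub>G\<^esub> g" x] one by auto
  have bij: "restrict (f g) X \<in> carrier (BijGroup X)" if "g \<in> carrier G" for g
    using that inv closed by (auto simp: BijGroup_def Bij_def
      intro!: bij_betw_byWitness[where f' = "f (inv\<^bsub>G\<^esub> g)"])
  show ?thesis
    unfolding group_action_def group_hom_def group_hom_axioms_def
  proof (intro conjI homI group_BijGroup assms(1))
    fix g h assume gh: "g \<in> carrier G" "h \<in> carrier G"
    show "restrict (f (g \<otimes>\<^bsub>G\<^esub> h)) X = restrict (f g) X \<otimes>\<^bsub>BijGroup X\<^esub> restrict (f h) X"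
      using bij gh closed by (auto simp: BijGroup_def compose_def fun_eq_iff mult)
  qed (rule bij)
qed

text \<open>An orbit with more than one element has size a positive power of \<open>p\<close>. If
  \<open>x\<close> were the only fixed point, \<open>card X\<close> would be 1 modulo
  \<open>p\<close>.\<close>

lemma p_group_second_fixed_point:
  fixes p :: nat
  assumes act: "group_action G X \<phi>" and p: "prime p" and G: "order G = p ^ e"
    and X: "finite X" "p dvd card X" and x: "x \<in> X" "\<And>g. g \<in> carrier G \<Longrightarrow> \<phi> g x = x"
  shows "\<exists>y\<in>X. y \<noteq> x \<and> (\<forall>g\<in>carrier G. \<phi> g y = y)"
proof (rule ccontr)
  assume no: "\<not> ?thesis"
  interpret group_action G X \<phi> by fact
  interpret G: group G using group_hom by (simp add: group_hom_def)
  have orb_x: "orbit G \<phi> x = {x}" 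
  proof
    show "orbit G \<phi> x \<subseteq> {x}" using x(2) unfolding orbit_def by blast
  qed (use orbit_refl[OF x(1)] in blast)
  have part: "partition X (orbits G X \<phi>)" by (rule orbit_partition)
  have union: "\<Union>(orbits G X \<phi>) = X"
    using partition.partition_coverture[OF part] .
  have fin: "finite (orbits G X \<phi>)" using X(1) by (simp add: orbits_def)
  have sub: "O' \<subseteq> X" if "O' \<in> orbits G X \<phi>" for O' using union that by blast
  have dvd: "p dvd card O'" if O': "O' \<in> orbits G X \<phi> - {{x}}" for O'
  proof -
    obtain y where y: "y \<in> X" "O' = orbit G \<phi> y" using O' by (auto simp: orbits_def)
    have "y \<noteq> x" using O' y orb_x by auto
    then obtain g where g: "g \<in> carrier G" "\<phi> g y \<noteq> y" using no y by blast
    have "card O' dvd p ^ e"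
      using orbit_stabilizer_theorem[OF y(1)] G y(2) by (metis dvd_triv_left)
    then obtain i where i: "card O' = p ^ i" using p divides_primepow_nat by blast
    have "{y, \<phi> g y} \<subseteq> O'" using y g orbit_refl[OF y(1)] by (auto simp: orbit_def)
    moreover have "finite O'" using sub O' X(1) finite_subset by blast
    ultimately have "card {y, \<phi> g y} \<le> card O'" by (intro card_mono)
    then have "i \<noteq> 0" using i g(2) by (intro notI) auto
    then show ?thesis using i by simp
  qed
  have "card X = (\<Sum>O'\<in>orbits G X \<phi>. card O')"
    using partition.disjoint_sum[OF part X(1), of "\<lambda>_. 1 :: nat"] by simp
  also have "\<dots> = card {x} + (\<Sum>O'\<in>orbits G X \<phi> - {{x}}. card O')"
    using fin x(1) orb_x by (intro sum.remove) (auto simp: orbits_def)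
  finally have "card X = 1 + (\<Sum>O'\<in>orbits G X \<phi> - {{x}}. card O')" by simp
  moreover have "p dvd (\<Sum>O'\<in>orbits G X \<phi> - {{x}}. card O')" using dvd by (intro dvd_sum)
  ultimately have "p dvd 1" using X(2) by (metis dvd_add_left_iff)
  then show False using p by (simp add: prime_nat_iff)
qed

text \<open>\<open>G\<close> permutes the cosets of \<open>F\<close>, whose number is a positive
  power of \<open>p\<close>, and fixes \<open>F\<close> itself; any further fixed coset is
  represented by the element sought.\<close>

lemma p_group_fixed_coset:
  fixes p :: nat
  assumes p: "prime p" and G: "group G" "order G = p ^ e" and A: "group A" "order A = p ^ r"
    and F: "F \<lhd> A" "F \<noteq> carrier A"
    and hom: "\<And>g. g \<in> carrier G \<Longrightarrow> f g \<in> hom A A"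
    and one: "\<And>a. a \<in> carrier A \<Longrightarrow> f \<one>\<^bsub>G\<^esub> a = a"
    and mult: "\<And>g h a. g \<in> carrier G \<Longrightarrow> h \<in> carrier G \<Longrightarrow> a \<in> carrier A \<Longrightarrow> f (g \<otimes>\<^bsub>G\<^esub> h) a = f g (f h a)"
    and inv: "\<And>g a. g \<in> carrier G \<Longrightarrow> a \<in> F \<Longrightarrow> f g a \<in> F"
  shows "\<exists>a\<in>carrier A - F. \<forall>g\<in>carrier G. f g a \<otimes>\<^bsub>A\<^esub> inv\<^bsub>A\<^esub> a \<in> F"
proof -
  interpret G: group G by fact
  interpret A: group A by fact
  interpret F: normal F A by fact
  have finA: "finite (carrier A)" using A(2) p by (metis A.order_gt_0_iff_finite prime_gt_0_nat zero_less_power)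
  let ?X = "rcosets\<^bsub>A\<^esub> F"
  have image: "f g ` (F #>\<^bsub>A\<^esub> a) = F #>\<^bsub>A\<^esub> f g a" if g: "g \<in> carrier G" and a: "a \<in> carrier A" for g a
  proof -
    \<comment> \<open>\<open>inv\<close> gives only one inclusion; the other uses the action of the
      inverse of \<open>g\<close>.\<close>
    have "f g ` F = F"
    proof (intro subset_antisym subsetI)
      fix x assume "x \<in> F"
      then have "x = f g (f (inv\<^bsub>G\<^esub> g) x)" "f (inv\<^bsub>G\<^esub> g) x \<in> F"
        using mult[of g "inv\<^bsub>G\<^esub> g" x] g one F.subset by (auto intro: inv)
      then show "x \<in> f g ` F" by blast
    qed (use inv g in auto)
    moreover have "f g ` (F #>\<^bsub>A\<^esub> a) = (f g ` F) #>\<^bsub>A\<^esub> f g a"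
      using hom_mult[OF hom[OF g]] a F.subset by (auto simp: r_coset_def image_iff subset_eq)
    ultimately show ?thesis by simp
  qed
  have mem: "f g a \<in> carrier A" if "g \<in> carrier G" "a \<in> carrier A" for g a
    using hom_in_carrier[OF hom] that by fast
  have act: "group_action G ?X (\<lambda>g. restrict ((`) (f g)) ?X)"
  proof (rule group_actionI[OF G(1)])
    show "f g ` C \<in> ?X" if "g \<in> carrier G" "C \<in> ?X" for g C
      using that image mem A.rcosetsI[OF F.subset] by (auto simp: RCOSETS_def)
    show "f \<one>\<^bsub>G\<^esub> ` C = C" if "C \<in> ?X" for C
    proof -
      have "f \<one>\<^bsub>G\<^esub> ` C = (\<lambda>a. a) ` C"
        using one F.rcosets_carrier[OF A(1) that] by (intro image_cong) blast+
      then show ?thesis by simp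
    qed
    show "f (g \<otimes>\<^bsub>G\<^esub> h) ` C = f g ` f h ` C" if "g \<in> carrier G" "h \<in> carrier G" "C \<in> ?X" for g h C
      unfolding image_image using mult[OF that(1,2)] F.rcosets_carrier[OF A(1) that(3)]
      by (intro image_cong) blast+
  qed
  have lag: "card ?X * card F = p ^ r" using A.lagrange[OF F.subgroup_axioms] A(2) by simp
  then obtain i where i: "card ?X = p ^ i" using p divides_primepow_nat by (metis dvd_triv_left)
  have "i \<noteq> 0"
  proof
    assume "i = 0"
    then have "card F = card (carrier A)" using i lag A(2) by (simp add: order_def)
    then show False using F(2) F.subset finA by (metis card_subset_eq)
  qed
  then have "p dvd card ?X" using i by simp
  moreover have "finite ?X" using finA A.rcosets_subset_PowG[OF F.subgroup_axioms]
    by (metis finite_Pow_iff finite_subset)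
  moreover have "F \<in> ?X" using F.subgroup_in_rcosets[OF A(1)] .
  moreover have "restrict ((`) (f g)) ?X F = F" if "g \<in> carrier G" for g
    using image[OF that A.one_closed] hom_one[OF hom[OF that] A(1) A(1)] \<open>F \<in> ?X\<close>
      A.coset_mult_one[OF F.subset] by simp
  ultimately obtain C where C: "C \<in> ?X" "C \<noteq> F" "\<And>g. g \<in> carrier G \<Longrightarrow> f g ` C = C"
    using p_group_second_fixed_point[OF act p G(2)] by (metis (no_types, lifting) restrict_apply')
  then obtain a where a: "a \<in> carrier A" "C = F #>\<^bsub>A\<^esub> a" by (auto simp: RCOSETS_def)
  have "a \<notin> F" using a C(2) F.rcos_const[OF A(1)] by auto
  moreover have "f g a \<otimes>\<^bsub>A\<^esub> inv\<^bsub>A\<^esub> a \<in> F" if g: "g \<in> carrier G" for g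
  proof -
    have "f g a \<in> F #>\<^bsub>A\<^esub> a" using C(3)[OF g] a A.rcos_self[OF a(1) F.subgroup_axioms] by blast
    then show ?thesis using F.rcos_module_imp[OF A(1) a(1)] by simp
  qed
  ultimately show ?thesis using a by blast
qed

text \<open>The operator \<open>R - 1\<close>, where \<open>R\<close> is right translation by
  \<open>y\<close>: the action of the element \<open>y - 1\<close> of the augmentation ideal on
  functions.\<close>

definition diff_op :: "('p, 'm) monoid_scheme \<Rightarrow> 'p \<Rightarrow> ('p \<Rightarrow> int) \<Rightarrow> 'p \<Rightarrow> int" where
  "diff_op G y f = (\<lambda>x. f (x \<otimes>\<^bsub>G\<^esub> y) - f x)"

definition fun_group :: "'p set \<Rightarrow> int \<Rightarrow> ('p \<Rightarrow> int) monoid" where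
  "fun_group X n = \<lparr>carrier = X \<rightarrow>\<^sub>E {0..<n}, monoid.mult = (\<lambda>f g. \<lambda>x\<in>X. (f x + g x) mod n), one = (\<lambda>x\<in>X. 0)\<rparr>"

lemma comm_group_fun_group:
  assumes "n > 0"
  shows "comm_group (fun_group X n)"
proof (rule comm_groupI)
  fix f assume f: "f \<in> carrier (fun_group X n)"
  show "\<exists>g\<in>carrier (fun_group X n). g \<otimes>\<^bsub>fun_group X n\<^esub> f = \<one>\<^bsub>fun_group X n\<^esub>"
    using assms by (intro bexI[of _ "\<lambda>x\<in>X. (- f x) mod n"])
      (auto simp: fun_group_def fun_eq_iff mod_add_left_eq)
  show "\<one>\<^bsub>fun_group X n\<^esub> \<otimes>\<^bsub>fun_group X n\<^esub> f = f"
    using f by (auto simp: fun_group_def fun_eq_iff PiE_iff extensional_def)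
qed (use assms in \<open>auto simp: fun_group_def fun_eq_iff mod_add_left_eq mod_add_right_eq algebra_simps\<close>)

lemma order_fun_group: "finite X \<Longrightarrow> order (fun_group X n) = nat n ^ card X"
  by (simp add: order_def fun_group_def card_funcsetE)

lemma foldr_diff_add:
  "foldr (diff_op G) ys (\<lambda>x. f x + g x) = (\<lambda>x. foldr (diff_op G) ys f x + foldr (diff_op G) ys g x)"
  by (induction ys) (auto simp: diff_op_def)

lemma (in group) foldr_diff_dvd:
  assumes "set ys \<subseteq> carrier G" "\<And>x. x \<in> carrier G \<Longrightarrow> n dvd f x" "x \<in> carrier G"
  shows "n dvd foldr (diff_op G) ys f x"
  using assms(1,3)
proof (induction ys arbitrary: x)
  case (Cons y ys)
  then have "n dvd foldr (diff_op G) ys f (x \<otimes> y)" "n dvd foldr (diff_op G) ys f x" by simp_all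
  then show ?case by (simp add: diff_op_def[of G y])
qed (use assms in simp)

text \<open>By linearity only the residues of the values on the carrier matter, so the reduced and
  restricted functions of \<open>fun_group\<close> can be replaced by plain integer
  expressions.\<close>

lemma (in group) foldr_diff_cong:
  assumes "set ys \<subseteq> carrier G" "\<And>x. x \<in> carrier G \<Longrightarrow> n dvd f x - g x" "x \<in> carrier G"
    and "n dvd foldr (diff_op G) ys g x"
  shows "n dvd foldr (diff_op G) ys f x"
proof -
  have "f = (\<lambda>x. g x + (f x - g x))" by simp
  then have "foldr (diff_op G) ys f x = foldr (diff_op G) ys g x + foldr (diff_op G) ys (\<lambda>x. f x - g x) x"
    using foldr_diff_add[of G ys g "\<lambda>x. f x - g x"] by simp
  then show ?thesis using foldr_diff_dvd[OF assms(1), of n "\<lambda>x. f x - g x" x] assms by simp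
qed

text \<open>A translation passes a difference operator at the price of conjugating its argument.
  Hence properties stated for all argument lists are stable under translation.\<close>

lemma (in group) foldr_diff_translate:
  assumes "set ys \<subseteq> carrier G" "h \<in> carrier G" "x \<in> carrier G"
  shows "foldr (diff_op G) ys (\<lambda>x. f (x \<otimes> h)) x =
    foldr (diff_op G) (map (\<lambda>y. inv h \<otimes> y \<otimes> h) ys) f (x \<otimes> h)"
  using assms(1,3)
proof (induction ys arbitrary: x)
  case (Cons y ys)
  then have "x \<otimes> h \<otimes> (inv h \<otimes> y \<otimes> h) = x \<otimes> y \<otimes> h"
    using assms(2) by (simp add: m_assoc) (simp add: m_assoc[symmetric])
  then show ?case using Cons assms(2) by (simp add: diff_op_def)
qed simp

text \<open>\<open>F i\<close> consists of the functions that all products of \<open>i\<close>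
  differences send to multiples of \<open>p\<close>. If \<open>F i\<close> is not everything, the
  translations fix a non-zero class modulo \<open>F i\<close>, and its representatives lie in
  \<open>F (Suc i)\<close>. So the chain grows strictly until it exhausts the finite set of
  functions modulo \<open>p\<close>.\<close>

theorem diff_op_nilpotent:
  fixes p :: nat
  assumes p: "prime p" and G: "group G" "order G = p ^ e"
  shows "\<exists>c. \<forall>ys f x. set ys \<subseteq> carrier G \<and> c \<le> length ys \<and> x \<in> carrier G \<longrightarrow>
           int p dvd foldr (diff_op G) ys f x"
proof -
  interpret G: group G by fact
  let ?A = "fun_group (carrier G) (int p)"
  have p0: "int p > 0" using p by (simp add: prime_gt_0_nat)
  interpret A: comm_group ?A by (rule comm_group_fun_group[OF p0])
  have finG: "finite (carrier G)" using G(2) p by (metis G.order_gt_0_iff_finite prime_gt_0_nat zero_less_power)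
  have ordA: "order ?A = p ^ card (carrier G)" using order_fun_group[OF finG] by simp
  then have finA: "finite (carrier ?A)" using p by (metis A.order_gt_0_iff_finite prime_gt_0_nat zero_less_power)
  define F where "F i = {f \<in> carrier ?A. \<forall>ys x. set ys \<subseteq> carrier G \<and> length ys = i \<and> x \<in> carrier G \<longrightarrow>
    int p dvd foldr (diff_op G) ys f x}" for i
  define tr where "tr h f = (\<lambda>x\<in>carrier G. f (x \<otimes>\<^bsub>G\<^esub> h))" for h and f :: "_ \<Rightarrow> int"
  have FD: "int p dvd foldr (diff_op G) ys f x"
    if "f \<in> F i" "set ys \<subseteq> carrier G" "length ys = i" "x \<in> carrier G" for f i ys x
    using that by (simp add: F_def)
  have mult_A: "(f \<otimes>\<^bsub>?A\<^esub> g) x = (f x + g x) mod int p" if "x \<in> carrier G" for f g x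
    using that by (simp add: fun_group_def)
  have tr_A: "tr h f \<in> carrier ?A" if "h \<in> carrier G" "f \<in> carrier ?A" for h f
    using that by (auto simp: tr_def fun_group_def PiE_iff)
  have tr_hom: "tr h \<in> hom ?A ?A" if "h \<in> carrier G" for h
    using that tr_A by (intro homI) (auto simp: tr_def fun_group_def fun_eq_iff)
  have F_mult: "f \<otimes>\<^bsub>?A\<^esub> g \<in> F i" if "f \<in> F i" "g \<in> F i" for f g i
  proof -
    have "int p dvd foldr (diff_op G) ys (f \<otimes>\<^bsub>?A\<^esub> g) x"
      if ys: "set ys \<subseteq> carrier G" "length ys = i" "x \<in> carrier G" for ys x
    proof (rule G.foldr_diff_cong[OF ys(1) _ ys(3)])
      show "int p dvd (f \<otimes>\<^bsub>?A\<^esub> g) x - (f x + g x)" if "x \<in> carrier G" for x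
        unfolding mult_A[OF that] by (simp add: mod_eq_dvd_iff[symmetric])
      show "int p dvd foldr (diff_op G) ys (\<lambda>x. f x + g x) x"
        unfolding foldr_diff_add using FD \<open>f \<in> F i\<close> \<open>g \<in> F i\<close> ys by (intro dvd_add) blast+
    qed
    then show ?thesis using that A.m_closed[of f g] by (simp add: F_def)
  qed
  have F_one: "\<one>\<^bsub>?A\<^esub> \<in> F i" for i
  proof -
    have "int p dvd foldr (diff_op G) ys \<one>\<^bsub>?A\<^esub> x" if "set ys \<subseteq> carrier G" "x \<in> carrier G" for ys x
      by (rule G.foldr_diff_dvd[OF that(1) _ that(2)]) (simp add: fun_group_def)
    then show ?thesis using A.one_closed by (simp add: F_def)
  qed
  have F_sub: "F i \<subseteq> carrier ?A" for i by (auto simp: F_def)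
  have subgroup_F: "subgroup (F i) ?A" for i
    using finite_subset[OF F_sub finA] F_sub F_mult F_one by (intro A.finite_subgroupI)
  have normal_F: "F i \<lhd> ?A" for i using A.subgroup_imp_normal[OF subgroup_F] .
  have tr_F: "tr h f \<in> F i" if h: "h \<in> carrier G" and f: "f \<in> F i" for h f i
  proof -
    have "int p dvd foldr (diff_op G) ys (tr h f) x"
      if ys: "set ys \<subseteq> carrier G" "length ys = i" "x \<in> carrier G" for ys x
    proof (rule G.foldr_diff_cong[OF ys(1) _ ys(3)])
      show "int p dvd tr h f x - f (x \<otimes>\<^bsub>G\<^esub> h)" if "x \<in> carrier G" for x
        using that by (simp add: tr_def)
      show "int p dvd foldr (diff_op G) ys (\<lambda>x. f (x \<otimes>\<^bsub>G\<^esub> h)) x"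
        unfolding G.foldr_diff_translate[OF ys(1) h ys(3)] using ys h by (intro FD[OF f]) auto
    qed
    then show ?thesis using tr_A[OF h] f F_sub by (auto simp: F_def)
  qed
  have diff_F: "int p dvd foldr (diff_op G) ys (diff_op G h f) x"
    if h: "h \<in> carrier G" and f: "f \<in> carrier ?A" and "tr h f \<otimes>\<^bsub>?A\<^esub> inv\<^bsub>?A\<^esub> f \<in> F i"
      and ys: "set ys \<subseteq> carrier G" "length ys = i" "x \<in> carrier G" for h f i ys x
  proof (rule G.foldr_diff_cong[OF ys(1) _ ys(3)])
    let ?g = "tr h f \<otimes>\<^bsub>?A\<^esub> inv\<^bsub>?A\<^esub> f"
    have eq: "?g \<otimes>\<^bsub>?A\<^esub> f = tr h f" using tr_A[OF h f] f by (simp add: A.m_assoc)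
    show "int p dvd diff_op G h f x - ?g x" if x: "x \<in> carrier G" for x
    proof -
      have "f (x \<otimes>\<^bsub>G\<^esub> h) = (?g x + f x) mod int p"
        using fun_cong[OF eq, of x] x unfolding mult_A[OF x] by (simp add: tr_def)
      then have "diff_op G h f x - ?g x = (?g x + f x) mod int p - (?g x + f x)"
        by (simp add: diff_op_def)
      then show ?thesis by (metis mod_eq_dvd_iff mod_mod_trivial)
    qed
    show "int p dvd foldr (diff_op G) ys ?g x" using FD that by blast
  qed
  have mono: "F i \<subseteq> F (Suc i)" for i
  proof
    fix f assume f: "f \<in> F i"
    have "int p dvd foldr (diff_op G) ys f x"
      if ys: "set ys \<subseteq> carrier G" "length ys = Suc i" "x \<in> carrier G" for ys x
    proof -
      \<comment> \<open>\<open>foldr\<close> applies the last operator of the list first, so the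
        list is split at its end.\<close>
      obtain zs h where zs: "ys = zs @ [h]" using ys(2) by (metis length_Suc_conv_rev)
      have "tr h f \<otimes>\<^bsub>?A\<^esub> inv\<^bsub>?A\<^esub> f \<in> F i"
        using tr_F[of h f i] f ys zs subgroup_F by (auto intro!: F_mult subgroup.m_inv_closed)
      then show ?thesis using diff_F[of h f i zs x] f F_sub ys zs by auto
    qed
    then show "f \<in> F (Suc i)" using f by (auto simp: F_def)
  qed
  have strict: "F i \<noteq> F (Suc i)" if "F i \<noteq> carrier ?A" for i
  proof -
    obtain f where f: "f \<in> carrier ?A" "f \<notin> F i"
      "\<And>h. h \<in> carrier G \<Longrightarrow> tr h f \<otimes>\<^bsub>?A\<^esub> inv\<^bsub>?A\<^esub> f \<in> F i"
    proof -
      have "tr \<one>\<^bsub>G\<^esub> a = a" if "a \<in> carrier ?A" for a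
        using that by (auto simp: tr_def fun_group_def PiE_iff extensional_def)
      moreover have "tr (g \<otimes>\<^bsub>G\<^esub> h) a = tr g (tr h a)" if "g \<in> carrier G" "h \<in> carrier G" for g h a
        using that by (auto simp: tr_def fun_eq_iff G.m_assoc)
      ultimately have "\<exists>a\<in>carrier ?A - F i. \<forall>g\<in>carrier G. tr g a \<otimes>\<^bsub>?A\<^esub> inv\<^bsub>?A\<^esub> a \<in> F i"
        using tr_F tr_hom by (intro p_group_fixed_coset[OF p G A.group_axioms ordA normal_F \<open>F i \<noteq> carrier ?A\<close>])
      then show ?thesis using that by blast
    qed
    have "int p dvd foldr (diff_op G) ys f x"
      if ys: "set ys \<subseteq> carrier G" "length ys = Suc i" "x \<in> carrier G" for ys x
    proof -
      obtain zs h where zs: "ys = zs @ [h]" using ys(2) by (metis length_Suc_conv_rev)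
      then show ?thesis using diff_F[of h f i zs x] f ys by auto
    qed
    then have "f \<in> F (Suc i)" using f(1) by (auto simp: F_def)
    then show ?thesis using f(2) by blast
  qed
  \<comment> \<open>Every strict inclusion adds an element, so an index exceeding the number of all
    functions forces the second alternative.\<close>
  have "i \<le> card (F i) \<or> F i = carrier ?A" for i
  proof (induction i)
    case (Suc i)
    show ?case
    proof (cases "F i = carrier ?A")
      case False
      then have "F i \<subset> F (Suc i)" using mono strict by blast
      then have "card (F i) < card (F (Suc i))" by (rule psubset_card_mono[OF finite_subset[OF F_sub finA]])
      then show ?thesis using Suc False by simp
    next
      case True
      then have "F (Suc i) = carrier ?A" using mono[of i] F_sub[of "Suc i"] by blast
      then show ?thesis ..
    qed
  qed simp
  then have "card (carrier ?A) + 1 \<le> card (F (card (carrier ?A) + 1)) \<or> F (card (carrier ?A) + 1) = carrier ?A" .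
  then obtain n where n: "F n = carrier ?A"
    using card_mono[OF finA F_sub, of "card (carrier ?A) + 1"] by fastforce
  show ?thesis
  proof (intro exI[of _ n] allI impI)
    fix ys f x assume H: "set ys \<subseteq> carrier G \<and> n \<le> length ys \<and> x \<in> carrier G"
    define zs ws where "zs = take (length ys - n) ys" and "ws = drop (length ys - n) ys"
    have zw: "ys = zs @ ws" "length ws = n" using H by (simp_all add: zs_def ws_def)
    have sub: "set zs \<subseteq> carrier G" "set ws \<subseteq> carrier G" using H zw(1) by auto
    \<comment> \<open>The innermost \<open>n\<close> operators already produce multiples of
      \<open>p\<close>. As \<open>f\<close> is arbitrary, its reduction modulo \<open>p\<close>
      takes its place as an element of \<open>F n\<close>.\<close>
    have "int p dvd foldr (diff_op G) ws f x" if x: "x \<in> carrier G" for x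
    proof (rule G.foldr_diff_cong[OF sub(2) _ x])
      let ?g = "\<lambda>x\<in>carrier G. f x mod int p"
      have "?g \<in> F n" unfolding n using p0 by (auto simp: fun_group_def)
      then show "int p dvd foldr (diff_op G) ws ?g x" using FD sub zw(2) x by blast
      show "int p dvd f x - ?g x" if "x \<in> carrier G" for x
        using that by (simp add: mod_eq_dvd_iff[symmetric])
    qed
    then have "int p dvd foldr (diff_op G) zs (foldr (diff_op G) ws f) x"
      using G.foldr_diff_dvd[OF sub(1)] H by blast
    then show "int p dvd foldr (diff_op G) ys f x" unfolding zw(1) by simp
  qed
qed

section \<open>Groups of graded matrices\<close>

text \<open>Entries are reduced modulo \<open>n\<close> and set to 0 outside \<open>W\<close>, so
  that equality of residue matrices is equality of functions.\<close>

definition mat_mult :: "int \<Rightarrow> 'w set \<Rightarrow> ('w \<Rightarrow> 'w \<Rightarrow> int) \<Rightarrow> ('w \<Rightarrow> 'w \<Rightarrow> int) \<Rightarrow> 'w \<Rightarrow> 'w \<Rightarrow> int" where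
  "mat_mult n W M N = (\<lambda>u v. if u \<in> W \<and> v \<in> W then (\<Sum>z\<in>W. M u z * N z v) mod n else 0)"

text \<open>Columns are the images of basis elements: column \<open>v\<close> has its 1 in row
  \<open>f v\<close>. With this convention composition of maps becomes multiplication of
  matrices.\<close>

definition perm_mat :: "'w set \<Rightarrow> ('w \<Rightarrow> 'w) \<Rightarrow> 'w \<Rightarrow> 'w \<Rightarrow> int" where
  "perm_mat W f = (\<lambda>u v. if u \<in> W \<and> v \<in> W then of_bool (u = f v) else 0)"

text \<open>The matrix of \<open>1 + X\<close> for the operator \<open>X\<close> sending
  \<open>v\<close> to \<open>a v\<close>. If \<open>a v\<close> falls outside \<open>W\<close>, the
  second summand is always 0, which is the truncation.\<close>

definition one_plus_mat :: "'w set \<Rightarrow> ('w \<Rightarrow> 'w) \<Rightarrow> 'w \<Rightarrow> 'w \<Rightarrow> int" where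
  "one_plus_mat W a =
     (\<lambda>u v. if u \<in> W \<and> v \<in> W then of_bool (u = v) + of_bool (u = a v) else 0)"

text \<open>
  Matrices that agree with the permutation matrix of \<open>q\<close> except for entries strictly raising the
  grading \<open>l\<close>. The component \<open>q\<close> is recorded since \<open>act\<close> need not be faithful.
\<close>

definition mat_group ::
  "int \<Rightarrow> ('q, 'r) monoid_scheme \<Rightarrow> 'w set \<Rightarrow> ('w \<Rightarrow> nat) \<Rightarrow> ('q \<Rightarrow> 'w \<Rightarrow> 'w) \<Rightarrow>
   (('w \<Rightarrow> 'w \<Rightarrow> int) \<times> 'q) monoid" where
  "mat_group n Q W l act =
     \<lparr>carrier = {(M, q). q \<in> carrier Q \<and> (\<forall>u v. M u v \<in> {0..<n}) \<and>
                   (\<forall>u v. u \<notin> W \<or> v \<notin> W \<longrightarrow> M u v = 0) \<and>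
                   (\<forall>u\<in>W. \<forall>v\<in>W. l u \<le> l v \<longrightarrow> M u v = of_bool (u = act q v))},
      monoid.mult = (\<lambda>(M, q) (N, r). (mat_mult n W M N, q \<otimes>\<^bsub>Q\<^esub> r)),
      one = (perm_mat W (act \<one>\<^bsub>Q\<^esub>), \<one>\<^bsub>Q\<^esub>)\<rparr>"

lemma mat_mult_assoc:
  "mat_mult n W (mat_mult n W M N) K = mat_mult n W M (mat_mult n W N K)"
proof (intro ext)
  fix u v
  have "(\<Sum>z\<in>W. (\<Sum>y\<in>W. M u y * N y z) mod n * K z v) mod n
      = (\<Sum>z\<in>W. (\<Sum>y\<in>W. M u y * N y z) * K z v) mod n"
    by (subst (1 2) mod_sum_eq[symmetric]) (simp add: mod_mult_left_eq)
  also have "\<dots> = (\<Sum>z\<in>W. M u z * (\<Sum>y\<in>W. N z y * K y v)) mod n"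
    by (simp add: sum_distrib_left sum_distrib_right mult.assoc) (subst sum.swap, rule refl)
  also have "\<dots> = (\<Sum>z\<in>W. M u z * ((\<Sum>y\<in>W. N z y * K y v) mod n)) mod n"
    by (subst (1 2) mod_sum_eq[symmetric]) (simp add: mod_mult_right_eq)
  finally show "mat_mult n W (mat_mult n W M N) K u v = mat_mult n W M (mat_mult n W N K) u v"
    by (simp add: mat_mult_def)
qed

text \<open>Maps that raise the degree leave \<open>W\<close> and are total on \<open>V\<close>
  only; the finite matrices are indexed by the part \<open>W\<close> of degree below
  \<open>c\<close>, which \<open>act\<close> respects because it preserves the degree.\<close>

locale graded_action = group Q for Q :: "('q, 'r) monoid_scheme" (structure) +
  fixes V W :: "'w set" and c :: nat and l :: "'w \<Rightarrow> nat" and act :: "'q \<Rightarrow> 'w \<Rightarrow> 'w" 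
  assumes W_eq: "W = {w \<in> V. l w < c}"
    and fin_W: "finite W" and fin_Q: "finite (carrier Q)"
    and act_V: "\<And>q w. q \<in> carrier Q \<Longrightarrow> w \<in> V \<Longrightarrow> act q w \<in> V"
    and l_act: "\<And>q w. q \<in> carrier Q \<Longrightarrow> w \<in> V \<Longrightarrow> l (act q w) = l w"
    and act_one: "\<And>w. w \<in> V \<Longrightarrow> act \<one> w = w"
    and act_mult: "\<And>q r w. q \<in> carrier Q \<Longrightarrow> r \<in> carrier Q \<Longrightarrow> w \<in> V \<Longrightarrow> act (q \<otimes> r) w = act q (act r w)"
begin

abbreviation "E n \<equiv> mat_group n Q W l act"

lemma act_W: "q \<in> carrier Q \<Longrightarrow> w \<in> W \<Longrightarrow> act q w \<in> W"
  and W_V: "w \<in> W \<Longrightarrow> w \<in> V"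
  by (auto simp: W_eq act_V l_act)

lemma mem_E: "(M, q) \<in> carrier (E n) \<longleftrightarrow> q \<in> carrier Q \<and> (\<forall>u v. M u v \<in> {0..<n}) \<and>
    (\<forall>u v. u \<notin> W \<or> v \<notin> W \<longrightarrow> M u v = 0) \<and>
    (\<forall>u\<in>W. \<forall>v\<in>W. l u \<le> l v \<longrightarrow> M u v = of_bool (u = act q v))"
  by (simp add: mat_group_def)

lemma mult_E: "(M, q) \<otimes>\<^bsub>E n\<^esub> (N, r) = (mat_mult n W M N, q \<otimes> r)"
  and one_E: "\<one>\<^bsub>E n\<^esub> = (perm_mat W (act \<one>), \<one>)"
  by (simp_all add: mat_group_def)

lemma perm_mem_E: "q \<in> carrier Q \<Longrightarrow> n > 1 \<Longrightarrow> (perm_mat W (act q), q) \<in> carrier (E n)"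
  by (auto simp: mem_E perm_mat_def)

lemma one_plus_mem_E:
  assumes "\<And>v. v \<in> V \<Longrightarrow> l (a v) = Suc (l v)" "n > 1"
  shows "(one_plus_mat W a, \<one>) \<in> carrier (E n)"
proof -
  have "a v \<noteq> v" "v \<in> W \<Longrightarrow> l (a v) \<noteq> l v" "v \<in> W \<Longrightarrow> \<not> l (a v) \<le> l v" if "v \<in> W" for v
    using assms(1)[OF W_V[OF that]] by (auto dest: arg_cong[where f = l])
  then show ?thesis using assms by (auto simp: mem_E one_plus_mat_def act_one dest: W_V)
qed

text \<open>At a non-zero entry the row index has at least the degree of the column index. For
  \<open>l u \<le> l v\<close> an intermediate index contributes only if all degrees agree, and
  there both factors are permutation matrices.\<close>

lemma mult_mem_E:
  assumes "x \<in> carrier (E n)" "y \<in> carrier (E n)" "n > 1"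
  shows "x \<otimes>\<^bsub>E n\<^esub> y \<in> carrier (E n)"
proof -
  obtain M q N r where xy: "x = (M, q)" "y = (N, r)" by (metis surj_pair)
  have M: "q \<in> carrier Q" "\<And>u v. u \<in> W \<Longrightarrow> v \<in> W \<Longrightarrow> l u \<le> l v \<Longrightarrow> M u v = of_bool (u = act q v)"
    and N: "r \<in> carrier Q" "\<And>u v. u \<in> W \<Longrightarrow> v \<in> W \<Longrightarrow> l u \<le> l v \<Longrightarrow> N u v = of_bool (u = act r v)"
    using assms unfolding xy mem_E by blast+
  have "(\<Sum>z\<in>W. M u z * N z v) = of_bool (u = act (q \<otimes> r) v)"
    if uv: "u \<in> W" "v \<in> W" "l u \<le> l v" for u v
  proof -
    have "M u z * N z v = (if z = act r v then of_bool (u = act q (act r v)) else 0)"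
      if "z \<in> W" for z
    proof (cases "l z \<le> l v")
      case True
      then show ?thesis using M(2)[of u z] N(2)[of z v] uv that l_act[OF N(1), of v] W_V by auto
    next
      case False
      then show ?thesis using M(2)[of u z] uv that l_act[OF M(1), of z] l_act[OF N(1), of v] W_V by auto
    qed
    then have "(\<Sum>z\<in>W. M u z * N z v) = (\<Sum>z\<in>W. if z = act r v then of_bool (u = act q (act r v)) else 0)"
      by (rule sum.cong[OF refl])
    then show ?thesis using act_W[OF N(1) uv(2)] fin_W act_mult[OF M(1) N(1) W_V[OF uv(2)]] by simp
  qed
  then show ?thesis
    unfolding xy mult_E mem_E using assms(3) M(1) N(1) by (auto simp: mat_mult_def)
qed

lemma perm_one_mult:
  assumes "\<And>u v. u \<notin> W \<or> v \<notin> W \<Longrightarrow> N u v = 0" "\<And>u v. N u v \<in> {0..<n}"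
  shows "mat_mult n W (perm_mat W (act \<one>)) N = N"
proof (intro ext)
  fix u v
  have "(\<Sum>z\<in>W. perm_mat W (act \<one>) u z * N z v) = (\<Sum>z\<in>W. if z = u then N u v else 0)" if "u \<in> W"
    using that by (intro sum.cong) (auto simp: perm_mat_def act_one dest: W_V)
  then show "mat_mult n W (perm_mat W (act \<one>)) N u v = N u v"
    using assms(1)[of u v] assms(2)[of u v] fin_W by (auto simp: mat_mult_def)
qed

lemma mult_perm_one:
  assumes "\<And>u v. u \<notin> W \<or> v \<notin> W \<Longrightarrow> N u v = 0" "\<And>u v. N u v \<in> {0..<n}"
  shows "mat_mult n W N (perm_mat W (act \<one>)) = N"
proof (intro ext)
  fix u v
  have "(\<Sum>z\<in>W. N u z * perm_mat W (act \<one>) z v) = (\<Sum>z\<in>W. if z = v then N u v else 0)" if "v \<in> W"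
    using that by (intro sum.cong) (auto simp: perm_mat_def act_one dest: W_V)
  then show "mat_mult n W N (perm_mat W (act \<one>)) u v = N u v"
    using assms(1)[of u v] assms(2)[of u v] fin_W by (auto simp: mat_mult_def)
qed

lemma monoid_E: assumes "n > 1" shows "monoid (E n)"
proof
  fix x y z
  show "x \<otimes>\<^bsub>E n\<^esub> y \<in> carrier (E n)" if "x \<in> carrier (E n)" "y \<in> carrier (E n)"
    using mult_mem_E that assms .
  show "x \<otimes>\<^bsub>E n\<^esub> y \<otimes>\<^bsub>E n\<^esub> z = x \<otimes>\<^bsub>E n\<^esub> (y \<otimes>\<^bsub>E n\<^esub> z)"
    if "x \<in> carrier (E n)" "y \<in> carrier (E n)" "z \<in> carrier (E n)"
    using that by (cases x, cases y, cases z) (simp add: mult_E mem_E mat_mult_assoc m_assoc)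
  show "\<one>\<^bsub>E n\<^esub> \<in> carrier (E n)" using perm_mem_E[OF one_closed assms] by (simp add: one_E)
  show "\<one>\<^bsub>E n\<^esub> \<otimes>\<^bsub>E n\<^esub> x = x" if "x \<in> carrier (E n)"
    using that perm_one_mult[of "fst x" n] by (cases x) (auto simp: one_E mult_E mem_E)
  show "x \<otimes>\<^bsub>E n\<^esub> \<one>\<^bsub>E n\<^esub> = x" if "x \<in> carrier (E n)"
    using that mult_perm_one[of "fst x" n] by (cases x) (auto simp: one_E mult_E mem_E)
qed

text \<open>Exactly the entries with \<open>l u > l v\<close> are free. So \<open>E n\<close> is a
  finite p-group as soon as \<open>n\<close> and the order of \<open>Q\<close> are powers of
  \<open>p\<close>.\<close>

lemma card_E:
  assumes "n > 1"
  shows "order (E n) = order Q * nat n ^ card {(u, v) \<in> W \<times> W. l u > l v}"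
    and "finite (carrier (E n))"
proof -
  let ?P = "{(u, v) \<in> W \<times> W. l u > l v}"
  let ?S = "\<lambda>q. {M. (M, q) \<in> carrier (E n)}"
  have fin_P: "finite ?P" by (rule finite_subset[OF _ finite_cartesian_product[OF fin_W fin_W]]) auto
  have card: "card (?S q) = nat n ^ card ?P" "finite (?S q)" if q: "q \<in> carrier Q" for q
  proof -
    define ext where "ext = (\<lambda>f u v. if u \<in> W \<and> v \<in> W then
        (if l u > l v then f (u, v) else of_bool (u = act q v)) else (0::int))"
    have "bij_betw ext (?P \<rightarrow>\<^sub>E {0..<n}) (?S q)"
    proof (rule bij_betw_byWitness[where f' = "\<lambda>M. restrict (\<lambda>(u, v). M u v) ?P"])
      show "\<forall>f\<in>?P \<rightarrow>\<^sub>E {0..<n}. restrict (\<lambda>(u, v). ext f u v) ?P = f"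
        by (auto simp: ext_def PiE_def extensional_def restrict_def fun_eq_iff)
      show "\<forall>M\<in>?S q. ext (restrict (\<lambda>(u, v). M u v) ?P) = M"
        by (auto simp: ext_def mem_E fun_eq_iff)
      show "ext ` (?P \<rightarrow>\<^sub>E {0..<n}) \<subseteq> ?S q"
      proof clarify
        fix f assume f: "f \<in> ?P \<rightarrow>\<^sub>E {0..<n}"
        then have "f (u, v) \<in> {0..<n}" if "u \<in> W" "v \<in> W" "l u > l v" for u v
          using that by (intro PiE_mem[OF f]) auto
        then show "(ext f, q) \<in> carrier (E n)"
          unfolding mem_E ext_def using q assms by auto
      qed
      show "(\<lambda>M. restrict (\<lambda>(u, v). M u v) ?P) ` ?S q \<subseteq> ?P \<rightarrow>\<^sub>E {0..<n}"
        by (force simp: mem_E)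
    qed
    then show "card (?S q) = nat n ^ card ?P" "finite (?S q)"
      using bij_betw_same_card[of ext] bij_betw_finite[of ext] card_funcsetE[OF fin_P, of "{0..<n}"]
        finite_PiE[OF fin_P, of "\<lambda>_. {0..<n}"] by auto
  qed
  have bij: "bij_betw (\<lambda>(q, M). (M, q)) (SIGMA q:carrier Q. ?S q) (carrier (E n))"
    by (rule bij_betw_byWitness[where f' = "\<lambda>(M, q). (q, M)"]) (auto simp: mem_E)
  have "card (SIGMA q:carrier Q. ?S q) = (\<Sum>q\<in>carrier Q. nat n ^ card ?P)"
    using card by (subst card_SigmaI[OF fin_Q]) auto
  then show "order (E n) = order Q * nat n ^ card ?P"
    unfolding order_def bij_betw_same_card[OF bij, symmetric] by simp
  show "finite (carrier (E n))"
    using card(2) by (subst bij_betw_finite[OF bij, symmetric]) (intro finite_SigmaI fin_Q)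
qed

text \<open>Forward substitution: row \<open>act q u\<close> of a product is row \<open>u\<close> of
  the right factor plus a combination of its rows of smaller degree. As the carrier is finite,
  cancellation already yields inverses.\<close>

lemma E_left_cancel:
  assumes x: "x \<in> carrier (E n)" "y \<in> carrier (E n)" "z \<in> carrier (E n)"
    and eq: "x \<otimes>\<^bsub>E n\<^esub> y = x \<otimes>\<^bsub>E n\<^esub> z"
  shows "y = z"
proof -
  obtain M q A r B s where xyz: "x = (M, q)" "y = (A, r)" "z = (B, s)" by (metis surj_pair)
  have M: "q \<in> carrier Q" "\<And>u v. u \<in> W \<Longrightarrow> v \<in> W \<Longrightarrow> l u \<le> l v \<Longrightarrow> M u v = of_bool (u = act q v)"
    and A: "r \<in> carrier Q" "\<And>u v. A u v \<in> {0..<n}" "\<And>u v. u \<notin> W \<or> v \<notin> W \<longrightarrow> A u v = 0"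
    and B: "s \<in> carrier Q" "\<And>u v. B u v \<in> {0..<n}" "\<And>u v. u \<notin> W \<or> v \<notin> W \<longrightarrow> B u v = 0"
    using x unfolding xyz mem_E by blast+
  have "q \<otimes> r = q \<otimes> s" and mm: "mat_mult n W M A = mat_mult n W M B"
    using eq by (simp_all add: xyz mult_E)
  then have "r = s" using M A B by simp
  have inj: "act q u = act q z \<longleftrightarrow> u = z" if "u \<in> W" "z \<in> W" for u z
    using act_mult[OF inv_closed[OF M(1)] M(1)] act_one that W_V M(1) by (metis l_inv)
  have "A u v = B u v" for u v
  proof (cases "u \<in> W \<and> v \<in> W")
    case True
    then show ?thesis
    proof (induction "l u" arbitrary: u rule: less_induct)
      case less
      have u: "act q u \<in> W" using less.prems act_W M(1) by simp
      have split: "(\<Sum>z\<in>W. M (act q u) z * X z v) = X u v + (\<Sum>z\<in>{z\<in>W. l z < l u}. M (act q u) z * X z v)" for X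
      proof -
        have "(\<Sum>z\<in>W. M (act q u) z * X z v)
            = (\<Sum>z\<in>{z\<in>W. l z < l u}. M (act q u) z * X z v) + (\<Sum>z\<in>{z\<in>W. \<not> l z < l u}. M (act q u) z * X z v)"
          using fin_W by (subst sum.union_disjoint[symmetric]) (auto intro!: sum.cong)
        also have "(\<Sum>z\<in>{z\<in>W. \<not> l z < l u}. M (act q u) z * X z v)
            = (\<Sum>z\<in>{z\<in>W. \<not> l z < l u}. if z = u then X u v else 0)"
          using M(2)[OF u] l_act[OF M(1) W_V] less.prems inj by (intro sum.cong) auto
        also have "\<dots> = X u v" using fin_W less.prems by simp
        finally show ?thesis by simp
      qed
      have "(\<Sum>z\<in>{z\<in>W. l z < l u}. M (act q u) z * A z v) = (\<Sum>z\<in>{z\<in>W. l z < l u}. M (act q u) z * B z v)"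
        using less by (intro sum.cong) auto
      moreover have "(\<Sum>z\<in>W. M (act q u) z * A z v) mod n = (\<Sum>z\<in>W. M (act q u) z * B z v) mod n"
        using fun_cong[OF fun_cong[OF mm], of "act q u" v] u less.prems by (simp add: mat_mult_def)
      ultimately have "A u v mod n = B u v mod n"
        unfolding split by (simp add: mod_eq_dvd_iff)
      then show ?case using A(2)[of u v] B(2)[of u v] by simp
    qed
  qed (use A B in auto)
  then show ?thesis using \<open>r = s\<close> xyz by (auto simp: fun_eq_iff)
qed

lemma group_E: assumes "n > 1" shows "group (E n)"
proof -
  interpret E: monoid "E n" using monoid_E[OF assms] .
  have right_inv: "\<exists>y\<in>carrier (E n). x \<otimes>\<^bsub>E n\<^esub> y = \<one>\<^bsub>E n\<^esub>" if "x \<in> carrier (E n)" for x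
  proof -
    have "inj_on (\<lambda>y. x \<otimes>\<^bsub>E n\<^esub> y) (carrier (E n))" using E_left_cancel that by (intro inj_onI) blast
    then have "(\<lambda>y. x \<otimes>\<^bsub>E n\<^esub> y) ` carrier (E n) = carrier (E n)"
      by (intro endo_inj_surj card_E(2)[OF assms]) (use that in auto)
    then show ?thesis using E.one_closed by (metis (no_types, lifting) imageE)
  qed
  have "\<exists>y\<in>carrier (E n). y \<otimes>\<^bsub>E n\<^esub> x = \<one>\<^bsub>E n\<^esub>" if x: "x \<in> carrier (E n)" for x
  proof -
    obtain y where y: "y \<in> carrier (E n)" "x \<otimes>\<^bsub>E n\<^esub> y = \<one>\<^bsub>E n\<^esub>" using right_inv x by blast
    obtain z where z: "z \<in> carrier (E n)" "y \<otimes>\<^bsub>E n\<^esub> z = \<one>\<^bsub>E n\<^esub>" using right_inv y by blast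
    have "z = x" using x y z by (metis E.m_assoc E.l_one E.r_one)
    then show ?thesis using y z by blast
  qed
  then show ?thesis by (intro groupI) (auto simp: E.m_assoc)
qed

lemma mat_mult_one_plus:
  assumes a: "\<And>v. v \<in> V \<Longrightarrow> l (a v) = Suc (l v)"
    and b: "\<And>v. v \<in> V \<Longrightarrow> b v \<in> V \<and> l (b v) = Suc (l v)"
    and u: "u \<in> W" and v: "v \<in> W"
  shows "mat_mult n W (one_plus_mat W a) (one_plus_mat W b) u v =
    (of_bool (u = v) + of_bool (u = a v) + (of_bool (u = b v) + of_bool (u = a (b v)))) mod n"
proof -
  have bv: "b v \<in> V" "l (b v) = Suc (l v)" "l (a (b v)) = Suc (Suc (l v))" "b v \<noteq> v"
    using b[OF W_V[OF v]] a by auto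
  have "(\<Sum>z\<in>W. one_plus_mat W a u z * one_plus_mat W b z v)
     = (\<Sum>z\<in>W. (if z = v then of_bool (u = v) + of_bool (u = a v) else 0) +
                (if z = b v then of_bool (u = b v) + of_bool (u = a (b v)) else 0))"
    using u v bv(4) by (intro sum.cong refl) (simp add: one_plus_mat_def)
  also have "\<dots> = of_bool (u = v) + of_bool (u = a v) +
      (if b v \<in> W then of_bool (u = b v) + of_bool (u = a (b v)) else 0)"
    using fin_W v by (simp add: sum.distrib)
  \<comment> \<open>If \<open>b v\<close> has degree at least \<open>c\<close>, so has
    \<open>a (b v)\<close>; neither can then equal the index \<open>u\<close> of \<open>W\<close>,
    and the case distinction may be dropped.\<close>
  also have "(if b v \<in> W then of_bool (u = b v) + of_bool (u = a (b v)) else 0) =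
      (of_bool (u = b v) + of_bool (u = a (b v)) :: int)"
  proof -
    have "u \<noteq> b v \<and> u \<noteq> a (b v)" if "b v \<notin> W"
    proof -
      have "l u < c" "\<not> l (b v) < c" using u that bv(1) by (simp_all add: W_eq)
      then have "l u \<noteq> l (b v)" "l u \<noteq> l (a (b v))" using bv by simp_all
      then show ?thesis by metis
    qed
    then show ?thesis by simp
  qed
  finally show ?thesis using u v by (simp add: mat_mult_def)
qed

lemma one_plus_commute:
  assumes a: "\<And>v. v \<in> V \<Longrightarrow> a v \<in> V \<and> l (a v) = Suc (l v)"
    and b: "\<And>v. v \<in> V \<Longrightarrow> b v \<in> V \<and> l (b v) = Suc (l v)"
    and ab: "\<And>v. v \<in> V \<Longrightarrow> a (b v) = b (a v)"
  shows "(one_plus_mat W a, \<one>) \<otimes>\<^bsub>E n\<^esub> (one_plus_mat W b, \<one>) =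
         (one_plus_mat W b, \<one>) \<otimes>\<^bsub>E n\<^esub> (one_plus_mat W a, \<one>)"
proof -
  have la: "l (a v) = Suc (l v)" and lb: "l (b v) = Suc (l v)" if "v \<in> V" for v
    using a b that by blast+
  have "mat_mult n W (one_plus_mat W a) (one_plus_mat W b) =
        mat_mult n W (one_plus_mat W b) (one_plus_mat W a)"
  proof (rule ext, rule ext, goal_cases)
    case (1 u v)
    show ?case
    proof (cases "u \<in> W \<and> v \<in> W")
      case True
      have "mat_mult n W (one_plus_mat W a) (one_plus_mat W b) u v =
        (of_bool (u = v) + of_bool (u = a v) + (of_bool (u = b v) + of_bool (u = a (b v)))) mod n"
        by (rule mat_mult_one_plus) (use True la b in auto)
      moreover have "mat_mult n W (one_plus_mat W b) (one_plus_mat W a) u v =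
        (of_bool (u = v) + of_bool (u = b v) + (of_bool (u = a v) + of_bool (u = b (a v)))) mod n"
        by (rule mat_mult_one_plus) (use True lb a in auto)
      moreover have "a (b v) = b (a v)" using True ab W_V by blast
      ultimately show ?thesis by (metis (no_types) add.assoc add.commute)
    qed (auto simp add: mat_mult_def)
  qed
  then show ?thesis by (simp only: mult_E)
qed

lemma perm_mat_mult:
  assumes "q \<in> carrier Q" "r \<in> carrier Q" "n > 1"
  shows "mat_mult n W (perm_mat W (act q)) (perm_mat W (act r)) = perm_mat W (act (q \<otimes> r))"
proof (intro ext)
  fix u v
  have "(\<Sum>z\<in>W. perm_mat W (act q) u z * perm_mat W (act r) z v)
      = (\<Sum>z\<in>W. if z = act r v then of_bool (u = act q (act r v)) else 0)"
    if "u \<in> W" "v \<in> W"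
    using that by (intro sum.cong) (auto simp: perm_mat_def)
  then show "mat_mult n W (perm_mat W (act q)) (perm_mat W (act r)) u v = perm_mat W (act (q \<otimes> r)) u v"
    using assms fin_W act_W[of r v] act_mult[of q r v] W_V[of v] by (auto simp: mat_mult_def perm_mat_def)
qed

lemma perm_hom:
  assumes "n > 1"
  shows "(\<lambda>q. (perm_mat W (act q), q)) \<in> hom Q (E n)"
  using assms by (auto simp: hom_def perm_mem_E mult_E perm_mat_mult)

lemma perm_commute_one_plus:
  assumes q: "q \<in> carrier Q" and a: "\<And>v. v \<in> V \<Longrightarrow> a v \<in> V \<and> l (a v) = Suc (l v)"
    and qa: "\<And>v. v \<in> V \<Longrightarrow> act q (a v) = a (act q v)"
  shows "(perm_mat W (act q), q) \<otimes>\<^bsub>E n\<^esub> (one_plus_mat W a, \<one>) =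
         (one_plus_mat W a, \<one>) \<otimes>\<^bsub>E n\<^esub> (perm_mat W (act q), q)"
proof -
  have "(\<Sum>z\<in>W. perm_mat W (act q) u z * one_plus_mat W a z v)
      = (\<Sum>z\<in>W. one_plus_mat W a u z * perm_mat W (act q) z v)" if u: "u \<in> W" and v: "v \<in> W" for u v
  proof -
    have av: "a v \<in> V" "a v \<noteq> v" "l (act q (a v)) = l (a v)" "act q v \<in> W"
      using a[OF W_V[OF v]] l_act[OF q] act_W[OF q v] by auto
    have "(\<Sum>z\<in>W. perm_mat W (act q) u z * one_plus_mat W a z v)
      = (\<Sum>z\<in>W. (if z = v then of_bool (u = act q v) else 0) + (if z = a v then of_bool (u = act q (a v)) else 0))"
      using u v av(2) by (intro sum.cong refl) (simp add: perm_mat_def one_plus_mat_def)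
    also have "\<dots> = of_bool (u = act q v) + (if a v \<in> W then of_bool (u = act q (a v)) else 0)"
      using fin_W v by (simp add: sum.distrib)
    also have "(if a v \<in> W then of_bool (u = act q (a v)) else 0) = (of_bool (u = act q (a v)) :: int)"
    proof -
      have "u \<noteq> act q (a v)" if "a v \<notin> W"
        using that u av by (auto simp: W_eq)
      then show ?thesis by simp
    qed
    also have "of_bool (u = act q v) + of_bool (u = act q (a v)) =
        (\<Sum>z\<in>W. if z = act q v then of_bool (u = act q v) + of_bool (u = a (act q v)) else 0 :: int)"
      using fin_W av qa[OF W_V[OF v]] by simp
    also have "\<dots> = (\<Sum>z\<in>W. one_plus_mat W a u z * perm_mat W (act q) z v)"
      using u v by (intro sum.cong refl) (simp add: perm_mat_def one_plus_mat_def)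
    finally show ?thesis .
  qed
  then show ?thesis using q by (simp add: mult_E mat_mult_def fun_eq_iff)
qed

text \<open>These are the transition maps of the inverse system that replaces matrices over the
  p-adic integers, taken for \<open>n = p ^ Suc m\<close> and \<open>k = p\<close>.\<close>

lemma reduce_hom:
  assumes "n > 1" "k > 0"
  shows "(\<lambda>(M, q). (\<lambda>u v. M u v mod n, q)) \<in> hom (E (n * k)) (E n)"
proof (rule homI)
  fix x assume "x \<in> carrier (E (n * k))"
  then show "(case x of (M, q) \<Rightarrow> (\<lambda>u v. M u v mod n, q)) \<in> carrier (E n)"
    using assms by (cases x) (auto simp: mem_E)
next
  fix x y assume "x \<in> carrier (E (n * k))" "y \<in> carrier (E (n * k))"
  obtain M q N r where xy: "x = (M, q)" "y = (N, r)" by (metis surj_pair)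
  have "(\<Sum>z\<in>W. M u z * N z v) mod (n * k) mod n = (\<Sum>z\<in>W. (M u z mod n) * (N z v mod n)) mod n" for u v
    by (subst (2) mod_sum_eq[symmetric]) (simp add: mod_mult_eq mod_sum_eq mod_mod_cancel)
  then show "(case x \<otimes>\<^bsub>E (n * k)\<^esub> y of (M, q) \<Rightarrow> (\<lambda>u v. M u v mod n, q)) =
     (case x of (M, q) \<Rightarrow> (\<lambda>u v. M u v mod n, q)) \<otimes>\<^bsub>E n\<^esub> (case y of (M, q) \<Rightarrow> (\<lambda>u v. M u v mod n, q))"
    by (simp add: xy mult_E mat_mult_def fun_eq_iff)
qed

end

section \<open>Partially commutative words\<close>

text \<open>
  Words are normal forms for monomials in variables indexed by pairs \<open>(s, j)\<close>, where variables commute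
  if they have the same \<open>s\<close>. Multiplication by \<open>(s, j)\<close> from the left inserts it into the initial
  block of letters with first component \<open>s\<close>, which is kept sorted.
\<close>

fun ins :: "'s \<Rightarrow> nat \<Rightarrow> ('s \<times> nat) list \<Rightarrow> ('s \<times> nat) list" where
  "ins s j [] = [(s, j)]"
| "ins s j ((t, i) # w) = (if t = s \<and> i < j then (t, i) # ins s j w else (s, j) # (t, i) # w)"

lemma length_ins: "length (ins s j w) = Suc (length w)"
  by (induction s j w rule: ins.induct) auto

lemma set_ins: "set (ins s j w) = insert (s, j) (set w)"
  by (induction s j w rule: ins.induct) auto

text \<open>A letter stops before the first one that is not a smaller letter of the family
  \<open>s\<close>, so two new letters end up in increasing order whichever comes first. This is the
  commutation of the variables of one family.\<close>

lemma ins_commute: "ins s i (ins s j w) = ins s j (ins s i w)"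
proof (induction w)
  case (Cons a w)
  then show ?case by (cases a) auto
qed auto

text \<open>\<open>ins\<close> tests first components only for equality, so a relabelling that is
  injective on them commutes with it.\<close>

lemma map_ins:
  assumes "inj_on f A" "s \<in> A" "set w \<subseteq> A \<times> UNIV"
  shows "map (\<lambda>(t, i). (f t, i)) (ins s j w) = ins (f s) j (map (\<lambda>(t, i). (f t, i)) w)"
  using assms(3)
proof (induction w)
  case (Cons a w)
  then show ?case using assms(1,2) by (cases a) (auto dest: inj_onD)
qed simp

text \<open>\<open>c\<close> is both the nilpotency bound and the length at which words are cut off;
  it is positive so that the empty word survives, at which elements of \<open>P\<close> are
  detected. \<open>k\<close> is the number of variables per family.\<close>

locale word_model = group P for P :: "('p, 'm) monoid_scheme" (structure) +
  fixes p e k c :: nat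
  assumes prime: "prime p" and order: "order P = p ^ e" and c_pos: "c > 0"
    and nilpotent: "\<And>ys f x. set ys \<subseteq> carrier P \<Longrightarrow> c \<le> length ys \<Longrightarrow> x \<in> carrier P \<Longrightarrow>
      int p dvd foldr (diff_op P) ys f x"
begin

definition tuples :: "(nat \<Rightarrow> 'p) set" where
  "tuples = {s. range s \<subseteq> carrier P \<and> (\<forall>j\<ge>k. s j = \<one>) \<and> (\<forall>i j. s i \<otimes> s j = s j \<otimes> s i)}"

definition conj_tuple :: "'p \<Rightarrow> (nat \<Rightarrow> 'p) \<Rightarrow> nat \<Rightarrow> 'p" where
  "conj_tuple q s = (\<lambda>i. q \<otimes> s i \<otimes> inv q)"

text \<open>Unsorted lists are included: insertion and conjugation preserve this larger set, and the
  identities below hold on all of it.\<close>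

definition words :: "((nat \<Rightarrow> 'p) \<times> nat) list set" where
  "words = lists (tuples \<times> {..<k})"

definition short_words :: "((nat \<Rightarrow> 'p) \<times> nat) list set" where
  "short_words = {w \<in> words. length w < c}"

definition conj_word :: "'p \<Rightarrow> ((nat \<Rightarrow> 'p) \<times> nat) list \<Rightarrow> ((nat \<Rightarrow> 'p) \<times> nat) list" where
  "conj_word q = map (\<lambda>(s, j). (conj_tuple q s, j))"

lemma finite_P: "finite (carrier P)"
  using order prime by (metis order_gt_0_iff_finite prime_gt_0_nat zero_less_power)

lemma tuple_closed: "s \<in> tuples \<Longrightarrow> s j \<in> carrier P" by (auto simp: tuples_def)

lemma finite_tuples: "finite tuples"
proof (rule finite_subset)
  show "tuples \<subseteq> (\<lambda>f j. if j < k then f j else \<one>) ` ({..<k} \<rightarrow>\<^sub>E carrier P)"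
  proof
    fix s assume s: "s \<in> tuples"
    then have "s = (\<lambda>j. if j < k then restrict s {..<k} j else \<one>)"
      by (auto simp: tuples_def fun_eq_iff)
    moreover have "restrict s {..<k} \<in> {..<k} \<rightarrow>\<^sub>E carrier P" using tuple_closed[OF s] by auto
    ultimately show "s \<in> (\<lambda>f j. if j < k then f j else \<one>) ` ({..<k} \<rightarrow>\<^sub>E carrier P)" by blast
  qed
qed (use finite_P in \<open>auto intro: finite_PiE\<close>)

lemma finite_short_words: "finite short_words"
proof (rule finite_subset)
  show "short_words \<subseteq> {w. set w \<subseteq> tuples \<times> {..<k} \<and> length w \<le> c}"
    by (auto simp: short_words_def words_def)
  show "finite {w. set w \<subseteq> tuples \<times> {..<k} \<and> length w \<le> c}"
    by (intro finite_lists_length_le) (simp add: finite_tuples)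
qed

lemma conj_mult:
  assumes "q \<in> carrier P" "x \<in> carrier P" "y \<in> carrier P"
  shows "(q \<otimes> x \<otimes> inv q) \<otimes> (q \<otimes> y \<otimes> inv q) = q \<otimes> (x \<otimes> y) \<otimes> inv q"
proof -
  have "(q \<otimes> x \<otimes> inv q) \<otimes> (q \<otimes> y \<otimes> inv q) = q \<otimes> x \<otimes> (inv q \<otimes> q) \<otimes> y \<otimes> inv q"
    using assms by (simp only: m_assoc inv_closed m_closed)
  then show ?thesis using assms by (simp add: m_assoc)
qed

lemma conj_tuple_closed: "q \<in> carrier P \<Longrightarrow> s \<in> tuples \<Longrightarrow> conj_tuple q s \<in> tuples"
  using conj_mult[of q] tuple_closed[of s] by (auto simp: tuples_def conj_tuple_def)

lemma conj_tuple_mult: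
  "q \<in> carrier P \<Longrightarrow> r \<in> carrier P \<Longrightarrow> s \<in> tuples \<Longrightarrow>
   conj_tuple (q \<otimes> r) s = conj_tuple q (conj_tuple r s)"
  using tuple_closed[of s] by (auto simp: conj_tuple_def fun_eq_iff m_assoc inv_mult_group)

lemma conj_tuple_one: "s \<in> tuples \<Longrightarrow> conj_tuple \<one> s = s"
  using tuple_closed[of s] by (auto simp: conj_tuple_def)

lemma inj_conj_tuple: "q \<in> carrier P \<Longrightarrow> inj_on (conj_tuple q) tuples"
  by (rule inj_on_inverseI[where g = "conj_tuple (inv q)"])
     (simp add: conj_tuple_mult[symmetric] conj_tuple_one)

lemma conj_word_closed: "q \<in> carrier P \<Longrightarrow> w \<in> words \<Longrightarrow> conj_word q w \<in> words"
  by (fastforce simp: conj_word_def words_def conj_tuple_closed in_lists_conv_set)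

sublocale graded_action P words short_words c length conj_word
proof
  show "conj_word \<one> w = w" if "w \<in> words" for w
    using that unfolding conj_word_def words_def by (intro map_idI) (auto simp: conj_tuple_one)
  show "conj_word (q \<otimes> r) w = conj_word q (conj_word r w)"
    if "q \<in> carrier P" "r \<in> carrier P" "w \<in> words" for q r w
    using that by (auto simp: conj_word_def words_def conj_tuple_mult)
qed (auto simp: short_words_def finite_P finite_short_words[unfolded short_words_def] conj_word_closed, auto simp: conj_word_def)

lemma ins_closed:
  "s \<in> tuples \<Longrightarrow> j < k \<Longrightarrow> w \<in> words \<Longrightarrow> ins s j w \<in> words \<and> length (ins s j w) = Suc (length w)"
  by (auto simp: words_def in_lists_conv_set set_ins length_ins)

lemma conj_word_ins:
  "q \<in> carrier P \<Longrightarrow> s \<in> tuples \<Longrightarrow> w \<in> words \<Longrightarrow>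
   conj_word q (ins s j w) = ins (conj_tuple q s) j (conj_word q w)"
  unfolding conj_word_def by (intro map_ins[OF inj_conj_tuple]) (auto simp: words_def)

text \<open>The matrix \<open>1 + X\<close> for the variable \<open>X = (s, j)\<close>. Its second
  component is the unit although it stands for the element \<open>s j\<close>: that component
  records only how families are permuted.\<close>

definition elem :: "(nat \<Rightarrow> 'p) \<Rightarrow> nat \<Rightarrow> (((nat \<Rightarrow> 'p) \<times> nat) list \<Rightarrow> ((nat \<Rightarrow> 'p) \<times> nat) list \<Rightarrow> int) \<times> 'p" where
  "elem s j = (one_plus_mat short_words (ins s j), \<one>)"

lemma elem_closed: "s \<in> tuples \<Longrightarrow> j < k \<Longrightarrow> n > 1 \<Longrightarrow> elem s j \<in> carrier (E n)"
  unfolding elem_def by (intro one_plus_mem_E) (simp add: length_ins)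

lemma elem_commute:
  "s \<in> tuples \<Longrightarrow> i < k \<Longrightarrow> j < k \<Longrightarrow> elem s i \<otimes>\<^bsub>E n\<^esub> elem s j = elem s j \<otimes>\<^bsub>E n\<^esub> elem s i"
  unfolding elem_def using ins_closed by (intro one_plus_commute) (auto simp: ins_commute)

text \<open>Meant for \<open>q\<close> in the image of the abelian group \<open>A\<close>, which
  centralises the entries of \<open>s\<close> because these are images from \<open>A\<close> as
  well.\<close>

lemma perm_commute_elem:
  assumes "q \<in> carrier P" "s \<in> tuples" "j < k" "conj_tuple q s = s"
  shows "(perm_mat short_words (conj_word q), q) \<otimes>\<^bsub>E n\<^esub> elem s j =
    elem s j \<otimes>\<^bsub>E n\<^esub> (perm_mat short_words (conj_word q), q)"
  unfolding elem_def using assms ins_closed conj_word_ins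
  by (intro perm_commute_one_plus) auto

text \<open>
  Functions on \<open>P\<close> modulo \<open>p\<close> replace the group algebra: the variable \<open>(s, j)\<close> acts as \<open>s j - 1\<close> by
  right translation, and \<open>theta w\<close> is the result of applying the monomial \<open>w\<close> to the unit.
\<close>

definition theta :: "((nat \<Rightarrow> 'p) \<times> nat) list \<Rightarrow> 'p \<Rightarrow> int" where
  "theta w = foldr (\<lambda>(s, j). diff_op P (s j)) w (\<lambda>x. of_bool (x = \<one>))"

lemma theta_Nil: "theta [] x = of_bool (x = \<one>)"
  and theta_Cons: "theta ((s, j) # w) x = theta w (x \<otimes> s j) - theta w x"
  by (simp_all add: theta_def diff_op_def)

text \<open>This makes the truncation harmless: words of length at least \<open>c\<close> may be set
  to 0 because \<open>theta\<close> vanishes on them modulo \<open>p\<close>.\<close>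

lemma theta_dvd:
  assumes "w \<in> words" "c \<le> length w" "x \<in> carrier P"
  shows "int p dvd theta w x"
proof -
  have "theta w = foldr (diff_op P) (map (\<lambda>(s, j). s j) w) (\<lambda>x. of_bool (x = \<one>))"
    unfolding theta_def foldr_map by (simp add: comp_def case_prod_unfold)
  moreover have "set (map (\<lambda>(s, j). s j) w) \<subseteq> carrier P"
    using assms(1) by (auto simp: words_def tuple_closed)
  ultimately show ?thesis using nilpotent assms by simp
qed

text \<open>Insertion differs from prepending only by moving a letter past others of its family, and
  their group elements commute because \<open>s\<close> is in \<open>tuples\<close>.\<close>

lemma theta_ins:
  assumes "s \<in> tuples" "w \<in> words" "x \<in> carrier P"
  shows "theta (ins s j w) x = theta w (x \<otimes> s j) - theta w x"
  using assms(2,3)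
proof (induction w arbitrary: x)
  case (Cons a w)
  obtain t i where a: "a = (t, i)" by (cases a)
  have ti: "t \<in> tuples" and w: "w \<in> words" using Cons.prems a by (auto simp: words_def)
  show ?case
  proof (cases "t = s \<and> i < j")
    case True
    have "x \<otimes> s i \<otimes> s j = x \<otimes> s j \<otimes> s i"
      using assms(1) Cons.prems tuple_closed[OF assms(1)] by (simp add: m_assoc) (simp add: tuples_def)
    then show ?thesis
      using True Cons.prems a tuple_closed[OF assms(1)] by (simp add: theta_Cons Cons.IH[OF w])
  qed (auto simp: a theta_Cons)
qed (simp add: theta_Cons)

text \<open>The indicator of the unit is invariant under conjugation, so conjugating every letter
  amounts to conjugating the argument.\<close>

lemma theta_conj_word:
  assumes "q \<in> carrier P" "w \<in> words" "x \<in> carrier P"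
  shows "theta (conj_word q w) x = theta w (inv q \<otimes> x \<otimes> q)"
  using assms(2,3)
proof (induction w arbitrary: x)
  case Nil
  have "inv q \<otimes> x \<otimes> q = \<one> \<longleftrightarrow> x = \<one>" (is "?l = _")
  proof
    assume ?l
    then have "q \<otimes> (inv q \<otimes> x \<otimes> q) \<otimes> inv q = \<one>" using assms(1) by simp
    moreover have "q \<otimes> (inv q \<otimes> x \<otimes> q) \<otimes> inv q = (q \<otimes> inv q) \<otimes> x \<otimes> (q \<otimes> inv q)"
      using assms(1) Nil by (simp only: m_assoc inv_closed m_closed)
    ultimately show "x = \<one>" using assms(1) Nil by simp
  qed (use assms in simp)
  then show ?case by (simp add: conj_word_def theta_Nil)
next
  case (Cons a w)
  obtain t i where a: "a = (t, i)" by (cases a)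
  have t: "t \<in> tuples" and w: "w \<in> words" using Cons.prems a by (auto simp: words_def)
  have ti: "t i \<in> carrier P" using tuple_closed[OF t] .
  have "inv q \<otimes> (x \<otimes> (q \<otimes> t i \<otimes> inv q)) \<otimes> q = inv q \<otimes> x \<otimes> q \<otimes> t i \<otimes> (inv q \<otimes> q)"
    using assms(1) Cons.prems ti by (simp only: m_assoc inv_closed m_closed)
  then have "inv q \<otimes> (x \<otimes> (q \<otimes> t i \<otimes> inv q)) \<otimes> q = inv q \<otimes> x \<otimes> q \<otimes> t i"
    using assms(1) Cons.prems ti by simp
  then show ?case
    using Cons.IH[OF w] Cons.prems assms(1) ti
    by (simp add: a conj_word_def theta_Cons conj_tuple_def)
qed

text \<open>
  \<open>theta\<close> intertwines \<open>(M, q)\<close> modulo \<open>p\<close> with multiplication by \<open>g\<close> on one side and by \<open>q\<close> on the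
  other; the second factor is needed because \<open>q\<close> acts on words by conjugation.
\<close>

fun rel :: "(((nat \<Rightarrow> 'p) \<times> nat) list \<Rightarrow> ((nat \<Rightarrow> 'p) \<times> nat) list \<Rightarrow> int) \<times> 'p \<Rightarrow> 'p \<Rightarrow> bool" where
  "rel (M, q) g \<longleftrightarrow> (\<forall>v\<in>short_words. \<forall>x\<in>carrier P.
     int p dvd (\<Sum>u\<in>short_words. M u v * theta u x) - theta v (inv q \<otimes> x \<otimes> g))"

lemma dvd_sum_diff:
  assumes "\<And>z. z \<in> A \<Longrightarrow> int p dvd f z - g z"
  shows "int p dvd (\<Sum>z\<in>A. f z) - (\<Sum>z\<in>A. g z)"
  using assms by (simp add: sum_subtractf[symmetric] dvd_sum)

text \<open>Since \<open>p\<close> divides \<open>n\<close>, the reductions in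
  \<open>mat_mult\<close> are invisible modulo \<open>p\<close>, and an exchange of sums
  remains.\<close>

lemma mat_mult_theta:
  assumes "int p dvd n" "v \<in> short_words"
  shows "int p dvd (\<Sum>u\<in>short_words. mat_mult n short_words M N u v * theta u x) -
    (\<Sum>z\<in>short_words. N z v * (\<Sum>u\<in>short_words. M u z * theta u x))"
proof -
  have "(\<Sum>z\<in>short_words. N z v * (\<Sum>u\<in>short_words. M u z * theta u x)) =
      (\<Sum>u\<in>short_words. (\<Sum>z\<in>short_words. M u z * N z v) * theta u x)"
    unfolding sum_distrib_left sum_distrib_right by (subst sum.swap) (simp add: ac_simps)
  moreover have "int p dvd (s mod n - s) * t" for s t
    using assms(1) by (intro dvd_mult2) (metis dvd_trans dvd_minus_mod dvd_diff_commute)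
  ultimately show ?thesis
    using assms(2) by (simp only:) (intro dvd_sum_diff, simp add: mat_mult_def left_diff_distrib)
qed

lemma rel_mult:
  assumes "int p dvd n" "rel a g" "rel b h" "a \<in> carrier (E n)" "b \<in> carrier (E n)"
    "g \<in> carrier P" "h \<in> carrier P"
  shows "rel (a \<otimes>\<^bsub>E n\<^esub> b) (g \<otimes> h)"
proof -
  obtain M q N r where ab: "a = (M, q)" "b = (N, r)" by (metis surj_pair)
  have qr: "q \<in> carrier P" "r \<in> carrier P" using assms ab by (auto simp: mem_E)
  have "int p dvd (\<Sum>u\<in>short_words. mat_mult n short_words M N u v * theta u x)
      - theta v (inv (q \<otimes> r) \<otimes> x \<otimes> (g \<otimes> h))"
    if v: "v \<in> short_words" and x: "x \<in> carrier P" for v x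
  proof -
    let ?y = "inv q \<otimes> x \<otimes> g"
    have y: "?y \<in> carrier P" using qr assms x by simp
    have "int p dvd (\<Sum>z\<in>short_words. N z v * (\<Sum>u\<in>short_words. M u z * theta u x))
        - (\<Sum>z\<in>short_words. N z v * theta z ?y)"
      using assms(2) x unfolding ab
      by (intro dvd_sum_diff) (simp add: right_diff_distrib[symmetric])
    moreover have "int p dvd (\<Sum>z\<in>short_words. N z v * theta z ?y) - theta v (inv r \<otimes> ?y \<otimes> h)"
      using assms(3) v y unfolding ab by simp
    moreover have "inv r \<otimes> ?y \<otimes> h = inv (q \<otimes> r) \<otimes> x \<otimes> (g \<otimes> h)"
      using qr assms x by (simp add: inv_mult_group m_assoc)
    ultimately show ?thesis
      using mat_mult_theta[OF assms(1) v, of M N x] by (smt (verit) dvd_add)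
  qed
  then show ?thesis by (simp add: ab mult_E)
qed

lemma rel_perm:
  assumes "q \<in> carrier P"
  shows "rel (perm_mat short_words (conj_word q), q) q"
proof -
  have "(\<Sum>u\<in>short_words. perm_mat short_words (conj_word q) u v * theta u x) =
      theta v (inv q \<otimes> x \<otimes> q)" if "v \<in> short_words" "x \<in> carrier P" for v x
  proof -
    have "(\<Sum>u\<in>short_words. perm_mat short_words (conj_word q) u v * theta u x) =
        (\<Sum>u\<in>short_words. if u = conj_word q v then theta (conj_word q v) x else 0)"
      using that by (intro sum.cong) (auto simp: perm_mat_def)
    also have "\<dots> = theta (conj_word q v) x"
      using act_W[OF assms that(1)] finite_short_words by simp
    finally show ?thesis using theta_conj_word assms that W_V by simp
  qed
  then show ?thesis by simp
qed

lemma rel_one: "rel \<one>\<^bsub>E n\<^esub> \<one>"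
  using rel_perm[OF one_closed] by (simp add: one_E)

lemma rel_inv:
  assumes n: "int p dvd n" "n > 1" and "rel a g" "a \<in> carrier (E n)" "g \<in> carrier P"
  shows "rel (inv\<^bsub>E n\<^esub> a) (inv g)"
proof -
  interpret E: group "E n" by (rule group_E[OF n(2)])
  obtain M q N r where ab: "a = (M, q)" "inv\<^bsub>E n\<^esub> a = (N, r)" by (metis surj_pair)
  have q: "q \<in> carrier P" and r: "r \<in> carrier P"
    using assms(4)[unfolded ab(1) mem_E] E.inv_closed[OF assms(4)] unfolding ab(2) mem_E by auto
  have one: "(mat_mult n short_words M N, q \<otimes> r) = (perm_mat short_words (conj_word \<one>), \<one>)"
    using E.r_inv[OF assms(4)] unfolding ab(2) unfolding ab(1) mult_E one_E .
  then have "inv r = q" using q r inv_equality[of q r] by simp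
  then have "r = inv q" using r by auto
  have "int p dvd (\<Sum>u\<in>short_words. N u v * theta u x) - theta v (inv r \<otimes> x \<otimes> inv g)"
    if v: "v \<in> short_words" and x: "x \<in> carrier P" for v x
  proof -
    \<comment> \<open>Chosen so that the relation for \<open>a\<close> at \<open>?y\<close> leads
      back to \<open>x\<close>; that the product of \<open>M\<close> and \<open>N\<close> is the
      identity matrix then turns it into the relation for \<open>N\<close> at
      \<open>x\<close>.\<close>
    let ?y = "q \<otimes> x \<otimes> inv g"
    have y: "?y \<in> carrier P" using q x assms by simp
    have "inv q \<otimes> ?y \<otimes> g = (inv q \<otimes> q) \<otimes> x \<otimes> (inv g \<otimes> g)"
      using q x assms(5) by (simp only: m_assoc inv_closed m_closed)
    then have xy: "inv q \<otimes> ?y \<otimes> g = x" using q x assms(5) by simp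
    have "int p dvd (\<Sum>z\<in>short_words. N z v * (\<Sum>u\<in>short_words. M u z * theta u ?y))
        - (\<Sum>z\<in>short_words. N z v * theta z x)"
    proof (rule dvd_sum_diff)
      fix z assume z: "z \<in> short_words"
      have "int p dvd (\<Sum>u\<in>short_words. M u z * theta u ?y) - theta z (inv q \<otimes> ?y \<otimes> g)"
        using assms(3) y z unfolding ab(1) rel.simps by blast
      then show "int p dvd N z v * (\<Sum>u\<in>short_words. M u z * theta u ?y) - N z v * theta z x"
        unfolding xy by (simp add: right_diff_distrib[symmetric])
    qed
    moreover have "(\<Sum>u\<in>short_words. mat_mult n short_words M N u v * theta u ?y) = theta v ?y"
    proof -
      have "(\<Sum>u\<in>short_words. perm_mat short_words (conj_word \<one>) u v * theta u ?y) =
          (\<Sum>u\<in>short_words. if u = v then theta v ?y else 0)"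
        using v by (intro sum.cong) (auto simp: perm_mat_def act_one dest: W_V)
      then show ?thesis using one v finite_short_words by simp
    qed
    moreover have "inv r = q" using \<open>r = inv q\<close> q by simp
    ultimately show ?thesis
      using mat_mult_theta[OF n(1) v, of M N ?y] by (simp only:) (smt (verit) dvd_add dvd_diff)
  qed
  then show ?thesis unfolding ab(2) by simp
qed

text \<open>\<open>1 + X\<close> adds the difference \<open>theta (ins s j v)\<close> to
  \<open>theta v\<close>, which gives the translate by \<open>s j\<close>. If the inserted word is
  too long, the matrix omits a term that is divisible by \<open>p\<close>.\<close>

lemma rel_elem:
  assumes s: "s \<in> tuples" "j < k"
  shows "rel (elem s j) (s j)"
proof -
  have "int p dvd (\<Sum>u\<in>short_words. one_plus_mat short_words (ins s j) u v * theta u x)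
      - theta v (x \<otimes> s j)"
    if v: "v \<in> short_words" and x: "x \<in> carrier P" for v x
  proof -
    have ins: "ins s j v \<in> words" "length (ins s j v) = Suc (length v)" "ins s j v \<noteq> v"
      using ins_closed[OF s W_V[OF v]] by auto
    have "(\<Sum>u\<in>short_words. one_plus_mat short_words (ins s j) u v * theta u x) =
        (\<Sum>u\<in>short_words. (if u = v then theta v x else 0) + (if u = ins s j v then theta (ins s j v) x else 0))"
      using v ins(3) by (intro sum.cong refl) (simp add: one_plus_mat_def)
    also have "\<dots> = theta v x + (if ins s j v \<in> short_words then theta (ins s j v) x else 0)"
      using v finite_short_words by (simp add: sum.distrib)
    finally have eq: "(\<Sum>u\<in>short_words. one_plus_mat short_words (ins s j) u v * theta u x) =
      theta v x + (if ins s j v \<in> short_words then theta (ins s j v) x else 0)" .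
    have "int p dvd theta (ins s j v) x" if "ins s j v \<notin> short_words"
      using that ins x by (intro theta_dvd) (auto simp: short_words_def)
    moreover have "theta v (x \<otimes> s j) = theta (ins s j v) x + theta v x"
      using theta_ins[OF s(1) W_V[OF v] x] by simp
    ultimately show ?thesis unfolding eq by auto
  qed
  then show ?thesis using tuple_closed[OF s(1)] by (simp add: elem_def)
qed

text \<open>The identity matrix fixes the empty word, whose \<open>theta\<close> is the indicator of
  the unit. Invariance under translation by \<open>g\<close> then says that this indicator agrees at
  \<open>\<one>\<close> and \<open>g\<close> modulo \<open>p\<close>.\<close>

lemma rel_detects:
  assumes "rel \<one>\<^bsub>E n\<^esub> g" "g \<in> carrier P"
  shows "g = \<one>"
proof (rule ccontr)
  assume "g \<noteq> \<one>"
  have nil: "[] \<in> short_words" using c_pos by (simp add: short_words_def words_def)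
  have "int p dvd (\<Sum>u\<in>short_words. perm_mat short_words (conj_word \<one>) u [] * theta u \<one>) - theta [] (inv \<one> \<otimes> \<one> \<otimes> g)"
    using assms(1) nil unfolding one_E rel.simps by blast
  moreover have "(\<Sum>u\<in>short_words. perm_mat short_words (conj_word \<one>) u [] * theta u \<one>) =
      (\<Sum>u\<in>short_words. if u = [] then theta [] \<one> else 0)"
    using nil by (intro sum.cong) (auto simp: perm_mat_def act_one dest: W_V)
  ultimately have "int p dvd 1" using nil finite_short_words assms(2) \<open>g \<noteq> \<one>\<close> by (simp add: theta_Nil)
  then show False using prime by (simp add: prime_nat_iff)
qed

end

section \<open>Locally constant homomorphisms\<close>

abbreviation loc_const :: "'a topgroup \<Rightarrow> ('a \<Rightarrow> 'b) \<Rightarrow> bool" where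
  "loc_const G f \<equiv> continuous_map (gtop G) (discrete_topology UNIV) f"

text \<open>The target carries no topology of its own, so it may be a plain group over any type,
  such as a matrix group.\<close>

definition disc_hom :: "'a topgroup \<Rightarrow> ('b, 'c) monoid_scheme \<Rightarrow> ('a \<Rightarrow> 'b) set" where
  "disc_hom G H = {f \<in> hom G H. loc_const G f}"

lemma loc_constI:
  assumes "\<And>x. x \<in> topspace (gtop G) \<Longrightarrow>
    \<exists>U. openin (gtop G) U \<and> x \<in> U \<and> (\<forall>y\<in>U. f y = f x)"
  shows "loc_const G f"
  unfolding continuous_map
proof (intro conjI allI impI)
  fix V :: "'b set"
  show "openin (gtop G) {x \<in> topspace (gtop G). f x \<in> V}"
  proof (subst openin_subopen, intro ballI)
    fix x assume x: "x \<in> {x \<in> topspace (gtop G). f x \<in> V}"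
    then obtain U where U: "openin (gtop G) U" "x \<in> U" "\<forall>y\<in>U. f y = f x" using assms by blast
    have "f y \<in> V" if "y \<in> U" for y using bspec[OF U(3) that] x by simp
    then show "\<exists>T. openin (gtop G) T \<and> x \<in> T \<and> T \<subseteq> {x \<in> topspace (gtop G). f x \<in> V}"
      using U(1,2) openin_subset[OF U(1)] by blast
  qed
qed auto

lemma openin_loc_const:
  "loc_const G f \<Longrightarrow> openin (gtop G) {x \<in> topspace (gtop G). f x \<in> V}"
  by (auto simp: continuous_map)

lemma loc_const_compose: "loc_const G f \<Longrightarrow> loc_const G (\<lambda>x. h (f x))"
  using continuous_map_compose[of "gtop G" "discrete_topology UNIV" f "discrete_topology UNIV" h]
  by (simp add: comp_def)

lemma loc_const_compose2:
  assumes "loc_const G f" "loc_const G g"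
  shows "loc_const G (\<lambda>x. h (f x) (g x))"
proof (rule loc_constI)
  fix x assume x: "x \<in> topspace (gtop G)"
  let ?U = "{y \<in> topspace (gtop G). f y \<in> {f x}} \<inter> {y \<in> topspace (gtop G). g y \<in> {g x}}"
  have "openin (gtop G) ?U" using assms by (intro openin_Int openin_loc_const)
  then show "\<exists>U. openin (gtop G) U \<and> x \<in> U \<and> (\<forall>y\<in>U. h (f y) (g y) = h (f x) (g x))"
    using x by (intro exI[of _ ?U]) auto
qed

lemma disc_hom_compose: "f \<in> disc_hom G H \<Longrightarrow> h \<in> hom H K \<Longrightarrow> (\<lambda>x. h (f x)) \<in> disc_hom G K"
  using loc_const_compose[of G f h] hom_compose[of f G H h K] by (auto simp: disc_hom_def comp_def)

lemma cont_hom_disc_hom: "f \<in> cont_hom G G' \<Longrightarrow> h \<in> disc_hom G' H \<Longrightarrow> (\<lambda>x. h (f x)) \<in> disc_hom G H"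
  using continuous_map_compose[of "gtop G" "gtop G'" f "discrete_topology UNIV" h]
    hom_compose[of f G G' h H] by (auto simp: disc_hom_def cont_hom_def comp_def)

lemma cont_hom_compose: "f \<in> cont_hom G H \<Longrightarrow> g \<in> cont_hom H K \<Longrightarrow> (\<lambda>x. g (f x)) \<in> cont_hom G K"
  using continuous_map_compose[of "gtop G" "gtop H" f "gtop K" g] hom_compose[of f G H g K]
  by (auto simp: cont_hom_def comp_def)

lemma pro_p_groupD:
  assumes "pro_p_group p G"
  shows "topological_group G" "compact_space (gtop G)" "Hausdorff_space (gtop G)"
  using assms by (auto simp: pro_p_group_def profinite_group_def)

section \<open>Open subgroups and quotients of compact topological groups\<close>

context topological_group
begin

lemma continuous_op:
  assumes "continuous_map X (gtop G) f" "continuous_map X (gtop G) g"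
  shows "continuous_map X (gtop G) (\<lambda>x. f x \<otimes> g x)"
  using continuous_map_compose[OF continuous_map_pairedI[OF assms] continuous_mult] by (simp add: comp_def)

lemma continuous_const: "g \<in> carrier G \<Longrightarrow> continuous_map X (gtop G) (\<lambda>_. g)"
  by (simp add: topspace_gtop)

lemma openin_preimage:
  assumes "continuous_map (gtop G) (gtop G) f" "openin (gtop G) U"
  shows "openin (gtop G) {x \<in> carrier G. f x \<in> U}"
  using openin_continuous_map_preimage[OF assms] by (simp add: topspace_gtop)

lemma openin_rcoset:
  assumes "openin (gtop G) U" "g \<in> carrier G"
  shows "openin (gtop G) (U #> g)"
proof -
  have U: "U \<subseteq> carrier G" using openin_subset[OF assms(1)] by (simp add: topspace_gtop)
  have "U #> g = {x \<in> carrier G. x \<otimes> inv g \<in> U}"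
  proof (intro subset_antisym subsetI)
    fix x assume "x \<in> U #> g"
    then obtain u where "u \<in> U" "x = u \<otimes> g" by (auto simp: r_coset_def)
    then show "x \<in> {x \<in> carrier G. x \<otimes> inv g \<in> U}" using assms(2) U by (auto simp: m_assoc)
  next
    fix x assume "x \<in> {x \<in> carrier G. x \<otimes> inv g \<in> U}"
    then have "(x \<otimes> inv g) \<otimes> g = x" "x \<otimes> inv g \<in> U" using assms(2) by (simp_all add: m_assoc)
    then show "x \<in> U #> g" unfolding r_coset_def by blast
  qed
  moreover have "openin (gtop G) {x \<in> carrier G. x \<otimes> inv g \<in> U}"
    using assms by (intro openin_preimage continuous_op continuous_const continuous_map_id[unfolded id_def]) auto
  ultimately show ?thesis by simp
qed

lemma finite_rcosets_cover:
  assumes "compact_space (gtop G)" "subgroup S G" "openin (gtop G) S"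
  obtains T where "finite T" "T \<subseteq> carrier G" "carrier G = (\<Union>t\<in>T. S #> t)"
proof -
  have "(\<forall>U\<in>rcosets S. openin (gtop G) U) \<and> topspace (gtop G) \<subseteq> \<Union>(rcosets S)"
    using openin_rcoset[OF assms(3)] rcosets_part_G[OF assms(2)] by (auto simp: topspace_gtop RCOSETS_def)
  then obtain F where F: "finite F" "F \<subseteq> rcosets S" "topspace (gtop G) \<subseteq> \<Union>F"
    using assms(1) unfolding compact_space_alt by meson
  have "\<forall>C\<in>F. \<exists>t. t \<in> carrier G \<and> C = S #> t" using F(2) by (auto simp: RCOSETS_def)
  then obtain t where t: "\<And>C. C \<in> F \<Longrightarrow> t C \<in> carrier G \<and> S #> t C = C" by metis
  have "\<Union>F \<subseteq> carrier G" using F(2) rcosets_part_G[OF assms(2)] by blast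
  then have "carrier G = \<Union>F" using F(3) by (simp add: topspace_gtop)
  also have "\<Union>F = (\<Union>t\<in>t ` F. S #> t)" using t by auto
  finally show thesis using that[of "t ` F"] F(1) t by blast
qed

text \<open>By compactness \<open>S\<close> has finitely many cosets, hence finitely many
  conjugates, and their intersection remains open.\<close>

lemma open_normal_core:
  assumes compact: "compact_space (gtop G)" and S: "subgroup S G" "openin (gtop G) S"
  obtains N where "N \<lhd> G" "openin (gtop G) N" "N \<subseteq> S"
proof -
  interpret S: subgroup S G by fact
  obtain T where T: "finite T" "T \<subseteq> carrier G" "carrier G = (\<Union>t\<in>T. S #> t)"
    using finite_rcosets_cover[OF assms] .
  define N where "N = {x \<in> carrier G. \<forall>g\<in>carrier G. g \<otimes> x \<otimes> inv g \<in> S}"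
  \<comment> \<open>Conjugation by an element of \<open>S\<close> preserves \<open>S\<close>, so in
    \<open>g = s \<otimes> t\<close> only the representative \<open>t\<close> matters.\<close>
  have "N = carrier G \<inter> (\<Inter>t\<in>T. {x \<in> carrier G. t \<otimes> x \<otimes> inv t \<in> S})"
  proof (intro subset_antisym subsetI)
    fix x assume x: "x \<in> carrier G \<inter> (\<Inter>t\<in>T. {x \<in> carrier G. t \<otimes> x \<otimes> inv t \<in> S})"
    have "g \<otimes> x \<otimes> inv g \<in> S" if "g \<in> carrier G" for g
    proof -
      have "g \<in> (\<Union>t\<in>T. S #> t)" using that by (subst T(3)[symmetric])
      then obtain t s where ts: "t \<in> T" "s \<in> S" "g = s \<otimes> t"
        unfolding r_coset_def by blast
      then have t: "t \<in> carrier G" using T(2) by blast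
      have "g \<otimes> x \<otimes> inv g = s \<otimes> (t \<otimes> x \<otimes> inv t) \<otimes> inv s"
        using ts t x by (simp add: inv_mult_group m_assoc)
      moreover have "t \<otimes> x \<otimes> inv t \<in> S" using x ts(1) by blast
      ultimately show ?thesis using ts(2) by simp
    qed
    then show "x \<in> N" using x by (auto simp: N_def)
  qed (use T(2) in \<open>auto simp: N_def\<close>)
  moreover have "openin (gtop G) {x \<in> carrier G. t \<otimes> x \<otimes> inv t \<in> S}" if "t \<in> T" for t
    using S(2) that T(2)
    by (intro openin_preimage continuous_op continuous_const continuous_map_id[unfolded id_def]) auto
  then have "openin (gtop G) (topspace (gtop G) \<inter> (\<Inter>t\<in>T. {x \<in> carrier G. t \<otimes> x \<otimes> inv t \<in> S}))"
    by (intro openin_Int_Inter T(1)[THEN finite_imageI] openin_topspace) auto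
  ultimately have "openin (gtop G) N" by (simp add: topspace_gtop)
  moreover have "N \<lhd> G"
  proof -
    have "subgroup N G"
    proof (rule subgroupI)
      have "\<one> \<in> N" using S.one_closed by (simp add: N_def)
      then show "N \<noteq> {}" by blast
    next
      fix x assume x: "x \<in> N"
      have "g \<otimes> inv x \<otimes> inv g \<in> S" if "g \<in> carrier G" for g
      proof -
        have "inv (g \<otimes> x \<otimes> inv g) \<in> S" using x that by (auto simp: N_def)
        then show ?thesis using x that by (simp add: N_def inv_mult_group m_assoc)
      qed
      then show "inv x \<in> N" using x by (simp add: N_def)
    next
      fix x y assume xy: "x \<in> N" "y \<in> N"
      have "g \<otimes> (x \<otimes> y) \<otimes> inv g \<in> S" if g: "g \<in> carrier G" for g
      proof -
        have "(g \<otimes> x \<otimes> inv g) \<otimes> (g \<otimes> y \<otimes> inv g) = g \<otimes> x \<otimes> (inv g \<otimes> g) \<otimes> y \<otimes> inv g"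
          using xy g by (simp only: m_assoc inv_closed m_closed N_def mem_Collect_eq)
        then have "(g \<otimes> x \<otimes> inv g) \<otimes> (g \<otimes> y \<otimes> inv g) = g \<otimes> (x \<otimes> y) \<otimes> inv g"
          using xy g by (simp add: N_def m_assoc)
        moreover have "(g \<otimes> x \<otimes> inv g) \<otimes> (g \<otimes> y \<otimes> inv g) \<in> S"
          by (rule S.m_closed) (use xy g in \<open>auto simp: N_def\<close>)
        ultimately show ?thesis by simp
      qed
      then show "x \<otimes> y \<in> N" using xy by (simp add: N_def)
    qed (auto simp: N_def)
    moreover have "g \<otimes> x \<otimes> inv g \<in> N" if "x \<in> N" "g \<in> carrier G" for x g
    proof -
      have "h \<otimes> (g \<otimes> x \<otimes> inv g) \<otimes> inv h = (h \<otimes> g) \<otimes> x \<otimes> inv (h \<otimes> g)" if "h \<in> carrier G" for h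
        using that \<open>x \<in> N\<close> \<open>g \<in> carrier G\<close> by (simp add: N_def inv_mult_group m_assoc)
      then have "h \<otimes> (g \<otimes> x \<otimes> inv g) \<otimes> inv h \<in> S" if "h \<in> carrier G" for h
        using that \<open>x \<in> N\<close> \<open>g \<in> carrier G\<close> unfolding N_def by (metis (no_types, lifting) m_closed mem_Collect_eq)
      moreover have "g \<otimes> x \<otimes> inv g \<in> carrier G"
        using \<open>x \<in> N\<close> \<open>g \<in> carrier G\<close> by (simp add: N_def)
      ultimately show ?thesis unfolding N_def by blast
    qed
    ultimately show ?thesis by (simp add: normal_inv_iff)
  qed
  moreover have "N \<subseteq> S" 
  proof
    fix x assume "x \<in> N"
    then have "\<one> \<otimes> x \<otimes> inv \<one> \<in> S" "x \<in> carrier G" unfolding N_def by blast+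
    then show "x \<in> S" by simp
  qed
  ultimately show thesis by (intro that[of N])
qed

lemma quotient_disc_hom:
  assumes "N \<lhd> G" "openin (gtop G) N"
  shows "(\<lambda>g. N #> g) \<in> disc_hom G (G Mod N)"
proof -
  interpret N: normal N G by fact
  have "loc_const G (\<lambda>g. N #> g)"
  proof (rule loc_constI)
    fix x assume x: "x \<in> topspace (gtop G)"
    then have x: "x \<in> carrier G" by (simp add: topspace_gtop)
    have "N #> y = N #> x" if "y \<in> N #> x" for y
      using repr_independence[OF that x N.subgroup_axioms] by simp
    then show "\<exists>U. openin (gtop G) U \<and> x \<in> U \<and> (\<forall>y\<in>U. N #> y = N #> x)"
      using openin_rcoset[OF assms(2) x] rcos_self[OF x N.subgroup_axioms] by blast
  qed
  then show ?thesis using N.r_coset_hom_Mod by (simp add: disc_hom_def)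
qed

end

lemma pro_p_residually_finite:
  assumes G: "pro_p_group p G" and w: "w \<in> carrier G" "w \<noteq> \<one>\<^bsub>G\<^esub>"
  obtains N where "N \<lhd> G" "openin (gtop G) N" "w \<notin> N"
proof -
  interpret topological_group G using pro_p_groupD(1)[OF G] .
  have "closedin (gtop G) {w}"
    using closedin_Hausdorff_singleton[OF pro_p_groupD(3)[OF G]] w(1) by (simp add: topspace_gtop)
  then have "openin (gtop G) (carrier G - {w})"
    using openin_diff openin_topspace by (metis topspace_gtop)
  then obtain S where S: "subgroup S G" "openin (gtop G) S" "S \<subseteq> carrier G - {w}"
  proof -
    have "\<one>\<^bsub>G\<^esub> \<in> carrier G - {w}" using w by auto
    then show thesis
      using G that \<open>openin (gtop G) (carrier G - {w})\<close> unfolding pro_p_group_def profinite_group_def by blast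
  qed
  obtain N where "N \<lhd> G" "openin (gtop G) N" "N \<subseteq> S"
    using open_normal_core[OF pro_p_groupD(2)[OF G] S(1,2)] .
  then show thesis using S(3) by (intro that[of N]) auto
qed

text \<open>The universal properties only test groups with elements in \<open>'a\<close>, while the
  matrix groups have another type. A finite p-group is carried over to a finite subset of
  \<open>'a\<close> and made discrete.\<close>

lemma p_group_topgroup_copy:
  fixes H :: "('b, 'c) monoid_scheme"
  assumes p: "prime p" and H: "group H" "order H = p ^ k"
  obtains D :: "('a :: infinite) topgroup" and f
  where "pro_p_group p D" "gtop D = discrete_topology (carrier D)" "f \<in> iso H D"
proof -
  interpret H: group H by fact
  have finH: "finite (carrier H)" using H(2) p by (metis H.order_gt_0_iff_finite prime_gt_0_nat zero_less_power)
  obtain A :: "'a set" where A: "finite A" "card A = card (carrier H)"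
    using infinite_arbitrarily_large[OF infinite_UNIV] by metis
  then obtain f where f: "bij_betw f (carrier H) A" using finite_same_card_bij finH by metis
  define f' where "f' = inv_into (carrier H) f"
  have f'f: "f' (f x) = x" if "x \<in> carrier H" for x
    using f that by (auto simp: f'_def bij_betw_def)
  have fA: "A = f ` carrier H" using f by (simp add: bij_betw_def)
  define D where "D = \<lparr>carrier = A, monoid.mult = (\<lambda>x y. f (f' x \<otimes>\<^bsub>H\<^esub> f' y)), one = f \<one>\<^bsub>H\<^esub>, gtop = discrete_topology A\<rparr>"
  have hom: "f \<in> hom H D" by (auto simp: hom_def D_def fA f'f)
  have grp: "group D"
  proof (rule groupI)
    show "\<exists>y\<in>carrier D. y \<otimes>\<^bsub>D\<^esub> x = \<one>\<^bsub>D\<^esub>" if "x \<in> carrier D" for x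
      using that by (auto simp: D_def fA f'f intro!: bexI[of _ "inv\<^bsub>H\<^esub> (f' x)"])
  qed (auto simp: D_def fA f'f H.m_assoc)
  have ordD: "order D = p ^ k" using A H(2) by (simp add: order_def D_def)
  have top: "topological_group D"
    unfolding topological_group_def topological_group_axioms_def
  proof (intro conjI grp)
    have "prod_topology (gtop D) (gtop D) = discrete_topology (A \<times> A)"
      by (simp add: D_def prod_topology_discrete_topology)
    then show "continuous_map (prod_topology (gtop D) (gtop D)) (gtop D) (\<lambda>(x, y). x \<otimes>\<^bsub>D\<^esub> y)"
      using group.subgroup_self[OF grp] by (auto simp: D_def fA f'f)
    show "continuous_map (gtop D) (gtop D) (\<lambda>x. inv\<^bsub>D\<^esub> x)"
      using group.inv_closed[OF grp] by (auto simp: D_def)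
  qed (simp add: D_def)
  have "pro_p_group p D"
    unfolding pro_p_group_def profinite_group_def
  proof (intro conjI allI impI top)
    show "compact_space (gtop D)" using A by (simp add: D_def compact_space_discrete_topology)
    show "Hausdorff_space (gtop D)" by (simp add: D_def)
    show "\<exists>N. subgroup N D \<and> openin (gtop D) N \<and> N \<subseteq> U" if "openin (gtop D) U \<and> \<one>\<^bsub>D\<^esub> \<in> U" for U
      using that group.triv_subgroup[OF grp] openin_subset[of "gtop D" U]
      by (intro exI[of _ "{\<one>\<^bsub>D\<^esub>}"]) (auto simp: D_def)
    show "\<exists>k. order (D Mod N) = p ^ k" if N: "N \<lhd> D \<and> openin (gtop D) N" for N
    proof -
      have "card (rcosets\<^bsub>D\<^esub> N) * card N = p ^ k"
        using group.lagrange[OF grp] N normal_imp_subgroup ordD by metis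
      then show ?thesis using divides_primepow_nat[OF p]
        by (simp add: order_def FactGroup_def) (metis dvd_triv_left)
    qed
  qed
  moreover have "f \<in> iso H D" using hom f by (simp add: iso_def D_def)
  ultimately show thesis using that[of D f] by (simp add: D_def)
qed

section \<open>Universal properties for finite \<open>p\<close>-groups\<close>

text \<open>In a profinite group this means that \<open>Y\<close> generates a dense subgroup. The
  form with open subgroups suits equalisers of locally constant homomorphisms, which are
  open.\<close>

definition topgen :: "'a topgroup \<Rightarrow> 'a set \<Rightarrow> bool" where
  "topgen G Y \<longleftrightarrow> (\<forall>S. subgroup S G \<and> openin (gtop G) S \<and> Y \<subseteq> S \<longrightarrow> S = carrier G)"

lemma topgen_equalizer:
  assumes G: "topological_group G" and gen: "topgen G Y" "Y \<subseteq> carrier G" and H: "group H"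
    and f: "f \<in> disc_hom G H" and g: "g \<in> disc_hom G H"
    and eq: "\<And>y. y \<in> Y \<Longrightarrow> f y = g y" and x: "x \<in> carrier G"
  shows "f x = g x"
proof -
  interpret topological_group G by fact
  have hom: "f \<in> hom G H" "g \<in> hom G H" using f g by (simp_all add: disc_hom_def)
  have ghom: "group_hom G H f" "group_hom G H g"
    using hom H is_group by (simp_all add: group_hom_def group_hom_axioms_def)
  let ?S = "{x \<in> carrier G. f x = g x}"
  have "loc_const G (\<lambda>x. f x = g x)" 
    using f g loc_const_compose2[of G f g "(=)"] by (simp add: disc_hom_def)
  from openin_loc_const[OF this, of "{True}"] have "openin (gtop G) ?S" by (simp add: topspace_gtop)
  moreover have "subgroup ?S G"
  proof (rule subgroupI)
    have "\<one>\<^bsub>G\<^esub> \<in> ?S" using ghom by (simp add: group_hom.hom_one)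
    then show "?S \<noteq> {}" by blast
  qed (use ghom in \<open>auto simp: group_hom.hom_mult group_hom.hom_inv\<close>)
  moreover have "Y \<subseteq> ?S" using gen(2) eq by auto
  ultimately have "?S = carrier G" using gen(1) unfolding topgen_def by blast
  then show ?thesis using x by blast
qed

lemma pro_p_order_quotient:
  "pro_p_group p G \<Longrightarrow> N \<lhd> G \<Longrightarrow> openin (gtop G) N \<Longrightarrow> \<exists>k. order (G Mod N) = p ^ k"
  by (auto simp: pro_p_group_def)

text \<open>An open subgroup contains an open normal subgroup \<open>N\<close> and is then
  determined by its image in the finite quotient by \<open>N\<close>.\<close>

lemma topgenI:
  assumes G: "pro_p_group p G"
    and R: "\<And>N R. N \<lhd> G \<Longrightarrow> openin (gtop G) N \<Longrightarrow> subgroup R (G Mod N) \<Longrightarrow>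
      (\<lambda>g. N #>\<^bsub>G\<^esub> g) ` Y \<subseteq> R \<Longrightarrow> (\<lambda>g. N #>\<^bsub>G\<^esub> g) ` carrier G \<subseteq> R"
  shows "topgen G Y"
  unfolding topgen_def
proof (intro allI impI subset_antisym)
  interpret topological_group G using pro_p_groupD(1)[OF G] .
  fix S assume S: "subgroup S G \<and> openin (gtop G) S \<and> Y \<subseteq> S"
  then show "S \<subseteq> carrier G" using subgroup.subset by blast
  obtain N where N: "N \<lhd> G" "openin (gtop G) N" "N \<subseteq> S"
    using open_normal_core[OF pro_p_groupD(2)[OF G]] S by blast
  interpret N: normal N G by fact
  interpret S: subgroup S G using S by blast
  let ?q = "\<lambda>g. N #>\<^bsub>G\<^esub> g"
  have "group_hom G (G Mod N) ?q"
    using N.factorgroup_is_group N.r_coset_hom_Mod by (simp add: group_hom_def group_hom_axioms_def)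
  then have "subgroup (?q ` S) (G Mod N)" by (rule group_hom.subgroup_img_is_subgroup) (rule S.subgroup_axioms)
  then have sub: "?q ` carrier G \<subseteq> ?q ` S" using R[OF N(1,2)] S by blast
  show "carrier G \<subseteq> S"
  proof
    fix g assume g: "g \<in> carrier G"
    then obtain s where s: "s \<in> S" "N #>\<^bsub>G\<^esub> g = N #>\<^bsub>G\<^esub> s" using sub by blast
    have "g \<in> N #>\<^bsub>G\<^esub> s" using s(2) rcos_self[OF g N.subgroup_axioms] by simp
    then show "g \<in> S" using s(1) N(3) unfolding r_coset_def by auto
  qed
qed

lemma cont_hom_discrete:
  assumes D: "gtop D = discrete_topology (carrier D)" and G: "topological_group G"
  shows "cont_hom G D = disc_hom G D"
proof -
  have top: "topspace (gtop G) = carrier G" using topological_group.topspace_gtop[OF G] .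
  have sub: "gtop D = subtopology (discrete_topology UNIV) (carrier D)" using D by simp
  have "continuous_map (gtop G) (gtop D) f \<longleftrightarrow> loc_const G f" if "f \<in> hom G D" for f
    unfolding sub continuous_map_in_subtopology top using that by (auto simp: hom_def)
  then show ?thesis by (auto simp: cont_hom_def disc_hom_def)
qed

lemma order_subgroup_p_group:
  assumes "prime (p :: nat)" "group P" "order P = p ^ k" "subgroup R P"
  shows "\<exists>j. order (P\<lparr>carrier := R\<rparr>) = p ^ j"
proof -
  have "card R dvd p ^ k"
    using group.lagrange[OF assms(2,4)] assms(3) by (metis dvd_triv_right)
  then show ?thesis using divides_primepow_nat[OF assms(1)] by (auto simp: order_def)
qed

lemma comm_group_subgroup:
  assumes "comm_group P" "subgroup R P"
  shows "comm_group (P\<lparr>carrier := R\<rparr>)"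
proof -
  interpret comm_group P by fact
  interpret R: subgroup R P by fact
  show ?thesis using R.subset by (intro group.group_comm_groupI R.subgroup_is_group is_group) (auto intro: m_comm)
qed

lemma disc_hom_subgroup_mono:
  "f \<in> disc_hom G (P\<lparr>carrier := R\<rparr>) \<Longrightarrow> subgroup R P \<Longrightarrow> f \<in> disc_hom G P"
  using subgroup.subset by (fastforce simp: disc_hom_def hom_def)

lemma disc_hom_into_subgroup:
  "f \<in> disc_hom G P \<Longrightarrow> f ` carrier G \<subseteq> R \<Longrightarrow> f \<in> disc_hom G (P\<lparr>carrier := R\<rparr>)"
  by (auto simp: disc_hom_def hom_def)

text \<open>Finite \<open>p\<close>-groups over an arbitrary type have a copy over the infinite type \<open>'a\<close>, so the
  universal properties apply to them.\<close>

lemma free_object_finite: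
  fixes F :: "('a :: infinite) topgroup" and H :: "('b, 'c) monoid_scheme"
  assumes p: "prime p" and F: "free_object (\<lambda>H. pro_p_group p H \<and> (ab \<longrightarrow> comm_group H)) F X"
    and H: "group H" "order H = p ^ k" "ab \<longrightarrow> comm_group H"
  shows "f \<in> X \<rightarrow> carrier H \<Longrightarrow> \<exists>h\<in>disc_hom F H. \<forall>x\<in>X. h x = f x"
    and "h \<in> disc_hom F H \<Longrightarrow> h' \<in> disc_hom F H \<Longrightarrow> (\<And>x. x \<in> X \<Longrightarrow> h x = h' x) \<Longrightarrow>
      x \<in> carrier F \<Longrightarrow> h x = h' x"
proof -
  have topF: "topological_group F" using F by (auto simp: free_object_def dest: pro_p_groupD)
  have XF: "X \<subseteq> carrier F" using F by (simp add: free_object_def)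
  obtain D :: "'a topgroup" and e where D: "pro_p_group p D" "gtop D = discrete_topology (carrier D)"
    and e: "e \<in> iso H D" using p_group_topgroup_copy[OF p H(1,2)] .
  have grpD: "group D" using D(1) by (metis pro_p_groupD(1) topological_group.axioms(1))
  have "ab \<longrightarrow> comm_group D" using comm_group.iso_imp_comm_group[of H D] H(3) e grpD
    by (metis group.is_monoid is_isoI)
  then have univ: "\<exists>h\<in>cont_hom F D. (\<forall>x\<in>X. h x = g x) \<and>
      (\<forall>h'\<in>cont_hom F D. (\<forall>x\<in>X. h' x = g x) \<longrightarrow> (\<forall>x\<in>carrier F. h' x = h x))"
    if "g \<in> X \<rightarrow> carrier D" for g
    using F D(1) that unfolding free_object_def by blast
  have eq: "cont_hom F D = disc_hom F D" by (rule cont_hom_discrete[OF D(2) topF])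
  have e_hom: "e \<in> hom H D" and e_bij: "bij_betw e (carrier H) (carrier D)"
    using e by (auto simp: iso_def)
  have e'_hom: "inv_into (carrier H) e \<in> hom D H"
    using group.iso_set_sym[OF H(1) e] by (simp add: iso_def)
  show "\<exists>h\<in>disc_hom F H. \<forall>x\<in>X. h x = f x" if f: "f \<in> X \<rightarrow> carrier H"
  proof -
    have "(\<lambda>x. e (f x)) \<in> X \<rightarrow> carrier D" using f hom_in_carrier[OF e_hom] by auto
    then obtain h where h: "h \<in> disc_hom F D" "\<forall>x\<in>X. h x = e (f x)" using univ eq by blast
    have "inv_into (carrier H) e (h x) = f x" if "x \<in> X" for x
    proof -
      have "f x \<in> carrier H" "h x = e (f x)" using h(2) f that by auto
      then show ?thesis using e_bij by (simp add: bij_betw_def)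
    qed
    then show ?thesis by (intro bexI[OF _ disc_hom_compose[OF h(1) e'_hom]]) simp
  qed
  show "h x = h' x" if h: "h \<in> disc_hom F H" "h' \<in> disc_hom F H" "\<And>x. x \<in> X \<Longrightarrow> h x = h' x"
    and x: "x \<in> carrier F"
  proof -
    have mem: "h y \<in> carrier H" "h' y \<in> carrier H" if "y \<in> carrier F" for y
      using h(1,2) that by (auto simp: disc_hom_def hom_def)
    have "(\<lambda>x. e (h x)) \<in> X \<rightarrow> carrier D" using mem XF hom_in_carrier[OF e_hom] by auto
    from univ[OF this] obtain u where "\<And>v. v \<in> disc_hom F D \<Longrightarrow> (\<forall>x\<in>X. v x = e (h x)) \<Longrightarrow> (\<forall>x\<in>carrier F. v x = u x)"
      unfolding eq by blast
    from this[OF disc_hom_compose[OF h(1) e_hom]] this[OF disc_hom_compose[OF h(2) e_hom]]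
    have "e (h x) = e (h' x)" using h(3) x by simp
    then show ?thesis using e_bij mem[OF x] by (auto simp: bij_betw_def dest: inj_onD)
  qed
qed

text \<open>The projection restricted to \<open>X\<close> extends to a homomorphism with values in
  \<open>R\<close>. By uniqueness, applied in the whole quotient, this is the projection itself, so
  its image lies in \<open>R\<close>.\<close>

lemma free_object_topgen:
  fixes F :: "('a :: infinite) topgroup"
  assumes p: "prime p" and F: "free_object (\<lambda>H. pro_p_group p H \<and> (ab \<longrightarrow> comm_group H)) F X"
  shows "topgen F X"
proof (rule topgenI)
  show proF: "pro_p_group p F" using F by (simp add: free_object_def)
  interpret topological_group F using pro_p_groupD(1)[OF proF] .
  have XF: "X \<subseteq> carrier F" and ab: "ab \<longrightarrow> comm_group F" using F by (simp_all add: free_object_def)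
  fix N R assume N: "N \<lhd> F" "openin (gtop F) N" and R: "subgroup R (F Mod N)" "(\<lambda>g. N #>\<^bsub>F\<^esub> g) ` X \<subseteq> R"
  interpret N: normal N F by fact
  obtain k where k: "order (F Mod N) = p ^ k" using pro_p_order_quotient[OF proF N] by blast
  then obtain j where j: "order ((F Mod N)\<lparr>carrier := R\<rparr>) = p ^ j"
    using order_subgroup_p_group[OF p N.factorgroup_is_group _ R(1)] by blast
  have abF: "ab \<longrightarrow> comm_group (F Mod N)"
    using ab comm_group.abelian_FactGroup N.subgroup_axioms by blast
  then have abR: "ab \<longrightarrow> comm_group ((F Mod N)\<lparr>carrier := R\<rparr>)" using comm_group_subgroup R(1) by blast
  have grpR: "group ((F Mod N)\<lparr>carrier := R\<rparr>)"
    using subgroup.subgroup_is_group[OF R(1) N.factorgroup_is_group] .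
  have "(\<lambda>x. N #>\<^bsub>F\<^esub> x) \<in> X \<rightarrow> carrier ((F Mod N)\<lparr>carrier := R\<rparr>)" using R(2) by auto
  from free_object_finite(1)[OF p F grpR j abR this]
  obtain h where h: "h \<in> disc_hom F ((F Mod N)\<lparr>carrier := R\<rparr>)" "\<And>x. x \<in> X \<Longrightarrow> h x = N #>\<^bsub>F\<^esub> x"
    by blast
  have "h x = N #>\<^bsub>F\<^esub> x" if "x \<in> carrier F" for x
    using free_object_finite(2)[OF p F N.factorgroup_is_group k abF
        disc_hom_subgroup_mono[OF h(1) R(1)] quotient_disc_hom[OF N] h(2) that] .
  moreover have "h x \<in> R" if "x \<in> carrier F" for x
    using h(1) that by (auto simp: disc_hom_def hom_def)
  ultimately show "(\<lambda>g. N #>\<^bsub>F\<^esub> g) ` carrier F \<subseteq> R" by auto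
qed

lemma amalgamated_product_finite:
  fixes G :: "('a :: infinite) topgroup" and H :: "('b, 'c) monoid_scheme"
  assumes p: "prime p" and G: "amalgamated_product p C f G1 g G2 G \<phi> \<psi>"
    and H: "group H" "order H = p ^ k"
  shows "\<alpha> \<in> disc_hom G1 H \<Longrightarrow> \<beta> \<in> disc_hom G2 H \<Longrightarrow> (\<And>c. c \<in> carrier C \<Longrightarrow> \<alpha> (f c) = \<beta> (g c)) \<Longrightarrow>
      \<exists>h\<in>disc_hom G H. (\<forall>x\<in>carrier G1. h (\<phi> x) = \<alpha> x) \<and> (\<forall>y\<in>carrier G2. h (\<psi> y) = \<beta> y)"
    and "h \<in> disc_hom G H \<Longrightarrow> h' \<in> disc_hom G H \<Longrightarrow>
      (\<And>x. x \<in> carrier G1 \<Longrightarrow> h (\<phi> x) = h' (\<phi> x)) \<Longrightarrow>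
      (\<And>y. y \<in> carrier G2 \<Longrightarrow> h (\<psi> y) = h' (\<psi> y)) \<Longrightarrow> z \<in> carrier G \<Longrightarrow> h z = h' z"
proof -
  have top: "topological_group G" "topological_group G1" "topological_group G2"
    using G by (auto simp: amalgamated_product_def dest: pro_p_groupD)
  have maps: "\<phi> \<in> cont_hom G1 G" "\<psi> \<in> cont_hom G2 G" "f \<in> cont_hom C G1" "g \<in> cont_hom C G2"
    "\<And>c. c \<in> carrier C \<Longrightarrow> \<phi> (f c) = \<psi> (g c)"
    using G by (simp_all add: amalgamated_product_def)
  obtain D :: "'a topgroup" and e where D: "pro_p_group p D" "gtop D = discrete_topology (carrier D)"
    and e: "e \<in> iso H D" using p_group_topgroup_copy[OF p H] .
  have univ: "\<exists>h\<in>cont_hom G D. (\<forall>x\<in>carrier G1. h (\<phi> x) = \<alpha> x) \<and> (\<forall>y\<in>carrier G2. h (\<psi> y) = \<beta> y) \<and>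
           (\<forall>h'\<in>cont_hom G D.
              (\<forall>x\<in>carrier G1. h' (\<phi> x) = \<alpha> x) \<and> (\<forall>y\<in>carrier G2. h' (\<psi> y) = \<beta> y) \<longrightarrow>
              (\<forall>z\<in>carrier G. h' z = h z))"
    if "\<alpha> \<in> cont_hom G1 D" "\<beta> \<in> cont_hom G2 D" "\<forall>c\<in>carrier C. \<alpha> (f c) = \<beta> (g c)" for \<alpha> \<beta>
    using G D(1) that unfolding amalgamated_product_def by blast
  have eq: "cont_hom G D = disc_hom G D" "cont_hom G1 D = disc_hom G1 D" "cont_hom G2 D = disc_hom G2 D"
    using top by (simp_all add: cont_hom_discrete[OF D(2)])
  have e_hom: "e \<in> hom H D" and e_bij: "bij_betw e (carrier H) (carrier D)"
    using e by (auto simp: iso_def)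
  have e'_hom: "inv_into (carrier H) e \<in> hom D H"
    using group.iso_set_sym[OF H(1) e] by (simp add: iso_def)
  have e'e: "inv_into (carrier H) e (e x) = x" if "x \<in> carrier H" for x
    using that e_bij by (auto simp: bij_betw_def)
  show "\<exists>h\<in>disc_hom G H. (\<forall>x\<in>carrier G1. h (\<phi> x) = \<alpha> x) \<and> (\<forall>y\<in>carrier G2. h (\<psi> y) = \<beta> y)"
    if \<alpha>: "\<alpha> \<in> disc_hom G1 H" and \<beta>: "\<beta> \<in> disc_hom G2 H" and c: "\<And>c. c \<in> carrier C \<Longrightarrow> \<alpha> (f c) = \<beta> (g c)"
  proof -
    have mem: "\<And>x. x \<in> carrier G1 \<Longrightarrow> \<alpha> x \<in> carrier H" "\<And>y. y \<in> carrier G2 \<Longrightarrow> \<beta> y \<in> carrier H"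
      using \<alpha> \<beta> by (auto simp: disc_hom_def hom_def)
    obtain h where h: "h \<in> disc_hom G D" "\<forall>x\<in>carrier G1. h (\<phi> x) = e (\<alpha> x)" "\<forall>y\<in>carrier G2. h (\<psi> y) = e (\<beta> y)"
    proof -
      have "\<forall>x\<in>carrier C. e (\<alpha> (f x)) = e (\<beta> (g x))" using c by simp
      from univ[unfolded eq, OF disc_hom_compose[OF \<alpha> e_hom] disc_hom_compose[OF \<beta> e_hom] this] that
      show thesis by blast
    qed
    show ?thesis
      using h(2,3) mem e'e by (intro bexI[OF _ disc_hom_compose[OF h(1) e'_hom]]) simp
  qed
  show "h z = h' z" if h: "h \<in> disc_hom G H" "h' \<in> disc_hom G H"
    "\<And>x. x \<in> carrier G1 \<Longrightarrow> h (\<phi> x) = h' (\<phi> x)" "\<And>y. y \<in> carrier G2 \<Longrightarrow> h (\<psi> y) = h' (\<psi> y)"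
    and z: "z \<in> carrier G"
  proof -
    have mem: "h y \<in> carrier H" "h' y \<in> carrier H" if "y \<in> carrier G" for y
      using h(1,2) that by (auto simp: disc_hom_def hom_def)
    have eh: "(\<lambda>x. e (h x)) \<in> cont_hom G D" "(\<lambda>x. e (h' x)) \<in> cont_hom G D"
      unfolding eq using disc_hom_compose[OF h(1) e_hom] disc_hom_compose[OF h(2) e_hom] by auto
    \<comment> \<open>Uniqueness refers to a prescribed pair of maps; the pair induced by
      \<open>h\<close> itself is taken, and \<open>h'\<close> induces the same one.\<close>
    have "\<forall>c\<in>carrier C. e (h (\<phi> (f c))) = e (h (\<psi> (g c)))" using maps(5) by simp
    from univ[OF cont_hom_compose[OF maps(1) eh(1)] cont_hom_compose[OF maps(2) eh(1)] this]
    obtain u where u: "\<forall>h'\<in>cont_hom G D. (\<forall>x\<in>carrier G1. h' (\<phi> x) = e (h (\<phi> x))) \<and>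
        (\<forall>y\<in>carrier G2. h' (\<psi> y) = e (h (\<psi> y))) \<longrightarrow> (\<forall>z\<in>carrier G. h' z = u z)"
      by (elim bexE conjE) (rule that)
    have "\<forall>z\<in>carrier G. e (h z) = u z"
      by (rule mp[OF bspec[OF u eh(1)]]) simp
    moreover have "\<forall>z\<in>carrier G. e (h' z) = u z"
      by (rule mp[OF bspec[OF u eh(2)]]) (simp add: h(3,4))
    ultimately have "e (h z) = e (h' z)" using z by simp
    then show ?thesis using e_bij mem[OF z] by (auto simp: bij_betw_def dest: inj_onD)
  qed
qed

text \<open>As for free objects, uniqueness identifies the projection with a map that takes values
  in \<open>R\<close>.\<close>

lemma amalgamated_product_topgen:
  fixes G :: "('a :: infinite) topgroup"
  assumes p: "prime p" and G: "amalgamated_product p C f G1 g G2 G \<phi> \<psi>"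
  shows "topgen G (\<phi> ` carrier G1 \<union> \<psi> ` carrier G2)"
proof (rule topgenI)
  show proG: "pro_p_group p G" using G by (simp add: amalgamated_product_def)
  interpret topological_group G using pro_p_groupD(1)[OF proG] .
  have maps: "\<phi> \<in> cont_hom G1 G" "\<psi> \<in> cont_hom G2 G" "f \<in> cont_hom C G1" "g \<in> cont_hom C G2"
    "\<And>c. c \<in> carrier C \<Longrightarrow> \<phi> (f c) = \<psi> (g c)"
    using G by (simp_all add: amalgamated_product_def)
  fix N R assume N: "N \<lhd> G" "openin (gtop G) N" and R: "subgroup R (G Mod N)"
    "(\<lambda>g. N #>\<^bsub>G\<^esub> g) ` (\<phi> ` carrier G1 \<union> \<psi> ` carrier G2) \<subseteq> R"
  interpret N: normal N G by fact
  obtain k where k: "order (G Mod N) = p ^ k" using pro_p_order_quotient[OF proG N] by blast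
  then obtain j where j: "order ((G Mod N)\<lparr>carrier := R\<rparr>) = p ^ j"
    using order_subgroup_p_group[OF p N.factorgroup_is_group _ R(1)] by blast
  have grpR: "group ((G Mod N)\<lparr>carrier := R\<rparr>)"
    using subgroup.subgroup_is_group[OF R(1) N.factorgroup_is_group] .
  have q: "(\<lambda>x. N #>\<^bsub>G\<^esub> \<phi> x) \<in> disc_hom G1 ((G Mod N)\<lparr>carrier := R\<rparr>)"
    "(\<lambda>x. N #>\<^bsub>G\<^esub> \<psi> x) \<in> disc_hom G2 ((G Mod N)\<lparr>carrier := R\<rparr>)"
    using cont_hom_disc_hom[OF maps(1) quotient_disc_hom[OF N]]
      cont_hom_disc_hom[OF maps(2) quotient_disc_hom[OF N]] R(2)
    by (auto intro!: disc_hom_into_subgroup)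
  have "N #>\<^bsub>G\<^esub> \<phi> (f c) = N #>\<^bsub>G\<^esub> \<psi> (g c)" if "c \<in> carrier C" for c using maps(5)[OF that] by simp
  from amalgamated_product_finite(1)[OF p G grpR j q this]
  obtain h where h: "h \<in> disc_hom G ((G Mod N)\<lparr>carrier := R\<rparr>)"
    "\<And>x. x \<in> carrier G1 \<Longrightarrow> h (\<phi> x) = N #>\<^bsub>G\<^esub> \<phi> x"
    "\<And>x. x \<in> carrier G2 \<Longrightarrow> h (\<psi> x) = N #>\<^bsub>G\<^esub> \<psi> x"
    by blast
  have "h x = N #>\<^bsub>G\<^esub> x" if "x \<in> carrier G" for x
    using amalgamated_product_finite(2)[OF p G N.factorgroup_is_group k
        disc_hom_subgroup_mono[OF h(1) R(1)] quotient_disc_hom[OF N] h(2,3) that] .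
  moreover have "h x \<in> R" if "x \<in> carrier G" for x
    using h(1) that by (auto simp: disc_hom_def hom_def)
  ultimately show "(\<lambda>g. N #>\<^bsub>G\<^esub> g) ` carrier G \<subseteq> R" by auto
qed

section \<open>Elements of infinite order modulo the derived subgroup\<close>

text \<open>\<open>H\<close> need not be closed, so images of subgroups can be used as they are; the
  closure is taken in \<open>G\<close>.\<close>

definition infinite_order_mod_derived :: "'a topgroup \<Rightarrow> 'a set \<Rightarrow> bool" where
  "infinite_order_mod_derived G H \<longleftrightarrow>
     (\<exists>k\<in>H. \<forall>n>0. k [^]\<^bsub>G\<^esub> (n :: nat) \<notin> gtop G closure_of derived G H)"

lemma prime_power_dvd_mult_split:
  fixes p x y :: int
  assumes "prime p" "p ^ (a + b) dvd x * y" "\<not> p ^ a dvd x"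
  shows "p ^ b dvd y"
proof (cases "x = 0 \<or> y = 0")
  case False
  have "a + b \<le> multiplicity p (x * y)"
    using assms(1,2) False by (subst (asm) power_dvd_iff_le_multiplicity) (auto dest: not_prime_unit)
  also have "\<dots> = multiplicity p x + multiplicity p y"
    using assms(1) False by (intro prime_elem_multiplicity_mult_distrib) auto
  finally have "b \<le> multiplicity p y"
    using assms(3) multiplicity_dvd'[of a p x] by fastforce
  then show ?thesis by (rule multiplicity_dvd')
qed (use assms in auto)

context graded_action
begin

theorem detect_infinite_order:
  fixes G :: "'g topgroup" and p :: nat
  assumes G: "topological_group G" and p: "prime p"
    and h: "\<And>m. h m \<in> disc_hom G (E (int p ^ Suc m))"
    and compat: "\<And>m g u v. g \<in> carrier G \<Longrightarrow>
      fst (h (Suc m) g) u v mod int p ^ Suc m = fst (h m g) u v"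
    and H: "subgroup H G" and snd: "\<And>m g. g \<in> H \<Longrightarrow> snd (h m g) = \<one>"
    and w: "w \<in> H" "h m1 w \<noteq> \<one>\<^bsub>E (int p ^ Suc m1)\<^esub>"
  shows "infinite_order_mod_derived G H"
proof -
  interpret G: topological_group G by fact
  interpret H: subgroup H G by fact
  have HG: "g \<in> carrier G" if "g \<in> H" for g using that H.subset by blast
  define c where "c m g = fst (h m g)" for m g
  have hE: "(c m g, \<one>) \<in> carrier (E (int p ^ Suc m))" "h m g = (c m g, \<one>)" if "g \<in> H" for m g
    using h[of m] HG[OF that] snd[OF that, of m]
    by (auto simp: disc_hom_def hom_def c_def prod_eq_iff Pi_iff) (metis prod.collapse)
  have c_diag: "c m g u v = of_bool (u = v)" if "g \<in> H" "u \<in> W" "v \<in> W" "l u \<le> l v" for m g u v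
    using hE(1)[OF that(1)] that act_one W_V unfolding mem_E by auto
  have c_range: "c m g u v \<in> {0..<int p ^ Suc m}" if "g \<in> H" for m g u v
    using hE(1)[OF that] unfolding mem_E by blast
  have c_mult: "c m (g \<otimes>\<^bsub>G\<^esub> g') u v = (\<Sum>z\<in>W. c m g u z * c m g' z v) mod int p ^ Suc m"
    if "g \<in> H" "g' \<in> H" "u \<in> W" "v \<in> W" for m g g' u v
  proof -
    have "h m (g \<otimes>\<^bsub>G\<^esub> g') = h m g \<otimes>\<^bsub>E (int p ^ Suc m)\<^esub> h m g'"
      using h[of m] HG that by (auto simp: disc_hom_def hom_def)
    then show ?thesis using that by (simp add: hE(2) mult_E mat_mult_def)
  qed
  \<comment> \<open>The degree is minimised over all levels \<open>m\<close> simultaneously, since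
    one and the same entry has to be additive at every level.\<close>
  define D where "D d \<longleftrightarrow> d > 0 \<and> (\<exists>m. \<exists>g\<in>H. \<exists>u\<in>W. \<exists>v\<in>W. l u = l v + d \<and> c m g u v \<noteq> 0)" for d
  have "\<exists>d. D d"
  proof (rule ccontr)
    assume no: "\<not> (\<exists>d. D d)"
    have "c m1 w u v = perm_mat W (act \<one>) u v" for u v
    proof (cases "u \<in> W \<and> v \<in> W")
      case True
      show ?thesis
      proof (cases "l u \<le> l v")
        case True
        then show ?thesis using \<open>u \<in> W \<and> v \<in> W\<close> c_diag w(1) act_one W_V by (simp add: perm_mat_def)
      next
        case False
        then have "\<not> D (l u - l v)" "l u = l v + (l u - l v)" "l u - l v > 0" "u \<noteq> v" using no by auto
        then have "c m1 w u v = 0" unfolding D_def using w(1) True by blast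
        then show ?thesis using \<open>u \<noteq> v\<close> True act_one W_V by (simp add: perm_mat_def)
      qed
    qed (use hE(1)[OF w(1), of m1] in \<open>auto simp: mem_E perm_mat_def\<close>)
    then have "h m1 w = \<one>\<^bsub>E (int p ^ Suc m1)\<^esub>" using hE(2)[OF w(1), of m1] by (simp add: one_E fun_eq_iff)
    then show False using w(2) by simp
  qed
  define d where "d = (LEAST d. D d)"
  have "D d" using \<open>\<exists>d. D d\<close> unfolding d_def by (auto intro: LeastI)
  then obtain m0 k u0 v0 where d: "d > 0" "k \<in> H" "u0 \<in> W" "v0 \<in> W" "l u0 = l v0 + d" "c m0 k u0 v0 \<noteq> 0"
    unfolding D_def by blast
  have low: "c m g u v = 0" if "g \<in> H" "u \<in> W" "v \<in> W" "l v < l u" "l u < l v + d" for m g u v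
  proof (rule ccontr)
    assume "c m g u v \<noteq> 0"
    then have "D (l u - l v)" unfolding D_def using that
      by (intro conjI exI[of _ m] bexI[of _ g] bexI[of _ u] bexI[of _ v]) auto
    then have "d \<le> l u - l v" unfolding d_def by (rule Least_le)
    then show False using that by simp
  qed
  define ent where "ent m g = c m g u0 v0" for m g
  have u0v0: "u0 \<noteq> v0" using d by auto
  have ent_mult: "ent m (g \<otimes>\<^bsub>G\<^esub> g') = (ent m g + ent m g') mod int p ^ Suc m" if g: "g \<in> H" "g' \<in> H" for m g g'
  proof -
    \<comment> \<open>For \<open>z\<close> of degree strictly between those of \<open>v0\<close> and
      \<open>u0\<close> the second factor vanishes by minimality of \<open>d\<close>; for any other
      \<open>z\<close> besides \<open>u0\<close> and \<open>v0\<close> a factor vanishes because the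
      matrices are unipotent.\<close>
    have "c m g u0 z * c m g' z v0 = (if z = u0 then ent m g' else 0) + (if z = v0 then ent m g else 0)"
      if z: "z \<in> W" for z
    proof -
      consider "z = u0" | "z = v0" | "z \<noteq> u0" "z \<noteq> v0" by blast
      then show ?thesis
      proof cases
        case 1 then show ?thesis using c_diag[OF g(1) d(3) d(3)] u0v0 by (simp add: ent_def)
      next
        case 2 then show ?thesis using c_diag[OF g(2) d(4) d(4)] u0v0 by (simp add: ent_def)
      next
        case 3
        have "c m g u0 z = 0 \<or> c m g' z v0 = 0"
        proof (cases "l z \<le> l v0 \<or> l u0 \<le> l z")
          case True
          then show ?thesis using c_diag[OF g(2) z d(4), of m] c_diag[OF g(1) d(3) z, of m] 3 by auto
        next
          case False
          then show ?thesis using low[OF g(2) z d(4), of m] d(5) by auto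
        qed
        then show ?thesis using 3 by auto
      qed
    qed
    then have "(\<Sum>z\<in>W. c m g u0 z * c m g' z v0) = ent m g' + ent m g"
      using fin_W d(3,4) by (simp add: sum.distrib)
    then show ?thesis using c_mult[OF g d(3,4)] by (simp add: ent_def add.commute)
  qed
  have ent_range: "ent m g mod int p ^ Suc m = ent m g" if "g \<in> H" for m g
    using c_range[OF that, of m u0 v0] by (simp add: ent_def)
  have ent_one: "ent m \<one>\<^bsub>G\<^esub> = 0" for m
  proof -
    have "(ent m \<one>\<^bsub>G\<^esub> + ent m \<one>\<^bsub>G\<^esub>) mod int p ^ Suc m = ent m \<one>\<^bsub>G\<^esub> mod int p ^ Suc m"
      using ent_mult[OF H.one_closed H.one_closed, of m] ent_range[OF H.one_closed, of m] by simp
    then have "int p ^ Suc m dvd ent m \<one>\<^bsub>G\<^esub>" by (simp only: mod_eq_dvd_iff add_diff_cancel_right')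
    then show ?thesis using ent_range[OF H.one_closed, of m] by (simp only: dvd_eq_mod_eq_0)
  qed
  have ent_inv: "(ent m g + ent m (inv\<^bsub>G\<^esub> g)) mod int p ^ Suc m = 0" if "g \<in> H" for m g
    using ent_mult[OF that H.m_inv_closed[OF that], of m] HG[OF that] ent_one by simp
  have ent_pow: "ent m (k [^]\<^bsub>G\<^esub> (n :: nat)) = (int n * ent m k) mod int p ^ Suc m" for m n
  proof (induction n)
    case (Suc n)
    have "k [^]\<^bsub>G\<^esub> n \<in> H" using d(2) by (induction n) auto
    then show ?case using Suc ent_mult[OF _ d(2)] by (simp add: mod_add_left_eq mod_add_right_eq algebra_simps)
  qed (use ent_one in simp)
  have ent_derived: "ent m g = 0" if "g \<in> derived G H" for m g
  proof -
    let ?K = "{g \<in> H. ent m g = 0}"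
    have "subgroup ?K G"
    proof (rule G.subgroupI)
      have "\<one>\<^bsub>G\<^esub> \<in> ?K" using ent_one by simp
      then show "?K \<noteq> {}" by blast
      show "inv\<^bsub>G\<^esub> g \<in> ?K" if "g \<in> ?K" for g
        using that ent_inv[of g m] ent_range[of "inv\<^bsub>G\<^esub> g" m] by simp
    qed (use HG ent_mult in auto)
    moreover have "derived_set G H \<subseteq> ?K"
    proof clarify
      fix a b assume ab: "a \<in> H" "b \<in> H"
      have "ent m (a \<otimes>\<^bsub>G\<^esub> b \<otimes>\<^bsub>G\<^esub> inv\<^bsub>G\<^esub> a \<otimes>\<^bsub>G\<^esub> inv\<^bsub>G\<^esub> b) =
          (((ent m a + ent m b) mod int p ^ Suc m + ent m (inv\<^bsub>G\<^esub> a)) mod int p ^ Suc m + ent m (inv\<^bsub>G\<^esub> b)) mod int p ^ Suc m"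
        using ab by (simp only: ent_mult H.m_closed H.m_inv_closed)
      also have "\<dots> = ((ent m a + ent m (inv\<^bsub>G\<^esub> a)) + (ent m b + ent m (inv\<^bsub>G\<^esub> b))) mod int p ^ Suc m"
        by (simp only: mod_add_left_eq) (simp only: ac_simps)
      also have "\<dots> = ((ent m a + ent m (inv\<^bsub>G\<^esub> a)) mod int p ^ Suc m + (ent m b + ent m (inv\<^bsub>G\<^esub> b)) mod int p ^ Suc m) mod int p ^ Suc m"
        by (simp only: mod_add_eq)
      also have "\<dots> = 0" using ab ent_inv by simp
      finally show "a \<otimes>\<^bsub>G\<^esub> b \<otimes>\<^bsub>G\<^esub> inv\<^bsub>G\<^esub> a \<otimes>\<^bsub>G\<^esub> inv\<^bsub>G\<^esub> b \<in> H \<and>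
          ent m (a \<otimes>\<^bsub>G\<^esub> b \<otimes>\<^bsub>G\<^esub> inv\<^bsub>G\<^esub> a \<otimes>\<^bsub>G\<^esub> inv\<^bsub>G\<^esub> b) = 0" using ab by simp
    qed
    ultimately show ?thesis
      using G.generate_subgroup_incl that unfolding derived_def by blast
  qed
  have ent_compat: "ent (m + i) g mod int p ^ Suc m = ent m g" if "g \<in> H" for m i g
  proof (induction i)
    case (Suc i)
    have "ent (m + Suc i) g mod int p ^ Suc m = ent (Suc (m + i)) g mod int p ^ Suc (m + i) mod int p ^ Suc m"
      by (subst mod_mod_cancel) (auto intro: le_imp_power_dvd)
    then show ?case using Suc compat[OF HG[OF that], of "m + i" u0 v0] by (simp add: ent_def c_def)
  qed (use ent_range[OF that] in simp)
  have "k [^]\<^bsub>G\<^esub> n \<notin> gtop G closure_of derived G H" if n: "n > 0" for n :: nat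
  proof
    assume cl: "k [^]\<^bsub>G\<^esub> n \<in> gtop G closure_of derived G H"
    \<comment> \<open>Multiplication by \<open>n\<close> absorbs fewer than \<open>n\<close> factors
      \<open>p\<close>, because \<open>n < p ^ n\<close>. So if \<open>n\<close> times the entry of
      \<open>k\<close> vanished at level \<open>m0 + n\<close>, the entry itself would vanish at
      level \<open>m0\<close>.\<close>
    let ?m = "m0 + n"
    \<comment> \<open>A locally constant map takes at a point of the closure a value that it already
      takes on the derived subgroup.\<close>
    let ?U = "{g \<in> topspace (gtop G). h ?m g \<in> {h ?m (k [^]\<^bsub>G\<^esub> n)}}"
    have "openin (gtop G) ?U" using h by (intro openin_loc_const) (simp add: disc_hom_def)
    moreover have "k [^]\<^bsub>G\<^esub> n \<in> ?U" using HG[OF d(2)] by (simp add: G.topspace_gtop)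
    ultimately obtain g where g: "g \<in> derived G H" "g \<in> ?U"
      using spec[OF conjunct2[OF cl[unfolded in_closure_of]], of ?U] by (elim impE exE conjE) (rule conjI)
    have "ent ?m (k [^]\<^bsub>G\<^esub> n) = ent ?m g" using g(2) by (simp add: ent_def c_def)
    then have "(int n * ent ?m k) mod int p ^ Suc ?m = 0" using ent_derived[OF g(1)] ent_pow by simp
    then have "int p ^ (n + Suc m0) dvd int n * ent ?m k" by (simp add: dvd_eq_mod_eq_0 add.commute)
    moreover have "\<not> int p ^ n dvd int n"
    proof
      assume "int p ^ n dvd int n"
      then have "p ^ n dvd n" by (simp flip: of_nat_power add: of_nat_dvd_iff)
      then have "p ^ n \<le> n" using n by (rule dvd_imp_le)
      moreover have "n < p ^ n" using p prime_gt_1_nat by (intro power_gt_expt) auto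
      ultimately show False by simp
    qed
    ultimately have "int p ^ Suc m0 dvd ent ?m k" 
      using p by (intro prime_power_dvd_mult_split[of "int p" n "Suc m0" "int n"]) simp_all
    then have "ent ?m k mod int p ^ Suc m0 = 0" by (simp only: dvd_eq_mod_eq_0)
    then show False using ent_compat[OF d(2), of m0 n] d(6) by (simp only: ent_def)
  qed
  then show ?thesis using d(2) unfolding infinite_order_mod_derived_def by blast
qed

end

section \<open>Compatible families of homomorphisms into the matrix groups\<close>

lemma (in graded_action) reduce_id:
  "x \<in> carrier (E n) \<Longrightarrow> (case x of (M, q) \<Rightarrow> (\<lambda>u v. M u v mod n, q)) = x"
  by (cases x) (auto simp: mem_E fun_eq_iff)

lemma (in graded_action) reduce_perm:
  "q \<in> carrier Q \<Longrightarrow> n > 1 \<Longrightarrow> (case (perm_mat W (act q), q) of (M, q) \<Rightarrow> (\<lambda>u v. M u v mod n, q)) = (perm_mat W (act q), q)"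
  by (rule reduce_id[OF perm_mem_E])

lemma (in graded_action) snd_hom: "snd \<in> hom (E n) Q"
  by (auto simp: hom_def mem_E mult_E)

lemma word_model_exists:
  assumes "group P" "prime p" "order P = p ^ e"
  obtains c where "word_model P p e c"
proof -
  obtain c where c: "\<forall>ys f x. set ys \<subseteq> carrier P \<and> c \<le> length ys \<and> x \<in> carrier P \<longrightarrow>
      int p dvd foldr (diff_op P) ys f x"
    using diff_op_nilpotent[OF assms(2,1,3)] by blast
  \<comment> \<open>\<open>Suc c\<close> makes the truncation length positive. The number
    \<open>k\<close> of variables per family is chosen at the interpretation.\<close>
  have "word_model P p e (Suc c)"
    unfolding word_model_def word_model_axioms_def using assms c by auto
  then show thesis by (rule that)
qed

context word_model
begin

lemma snd_elem: "snd (elem s j) = \<one>"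
  by (simp add: elem_def)

lemma modulus: "int p ^ Suc m > 1" "int p dvd int p ^ Suc m"
  using prime prime_gt_1_nat[of p] one_less_power[of "int p" "Suc m"] by auto

lemma group_E_power: "group (E (int p ^ Suc m))"
  by (rule group_E[OF modulus(1)])

lemma order_E_power: "\<exists>j. order (E (int p ^ Suc m)) = p ^ j"
proof -
  let ?k = "card {(u, v) \<in> short_words \<times> short_words. length u > length v}"
  have "nat (int p ^ Suc m) = p ^ Suc m" by (simp only: of_nat_power[symmetric] nat_int)
  then have "order (E (int p ^ Suc m)) = p ^ e * (p ^ Suc m) ^ ?k"
    using card_E(1)[OF modulus(1), of m] order by (simp only:)
  also have "\<dots> = p ^ (e + Suc m * ?k)" by (simp only: power_add power_mult)
  finally show ?thesis by blast
qed

text \<open>\<open>rel\<close> respects products and inverses and depends on locally constant data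
  only, so it cuts out an open subgroup.\<close>

lemma rel_topgen:
  assumes G: "topological_group G" and gen: "topgen G Y" "Y \<subseteq> carrier G"
    and a: "a \<in> disc_hom G (E (int p ^ Suc m))" and b: "b \<in> disc_hom G P"
    and rel: "\<And>y. y \<in> Y \<Longrightarrow> rel (a y) (b y)" and g: "g \<in> carrier G"
  shows "rel (a g) (b g)"
proof -
  interpret G: topological_group G by fact
  let ?n = "int p ^ Suc m"
  let ?S = "{x \<in> carrier G. rel (a x) (b x)}"
  have ha: "group_hom G (E ?n) a" and hb: "group_hom G P b"
    using a b group_E_power is_group G.is_group
    by (simp_all add: disc_hom_def group_hom_def group_hom_axioms_def)
  note mem = group_hom.hom_closed[OF ha] group_hom.hom_closed[OF hb]
  have "loc_const G (\<lambda>x. rel (a x) (b x))"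
    using a b loc_const_compose2[of G a b rel] by (simp add: disc_hom_def)
  from openin_loc_const[OF this, of "{True}"] have "openin (gtop G) ?S" by (simp add: G.topspace_gtop)
  moreover have "subgroup ?S G"
  proof (rule G.subgroupI)
    have "\<one>\<^bsub>G\<^esub> \<in> ?S" using group_hom.hom_one[OF ha] group_hom.hom_one[OF hb] rel_one by simp
    then show "?S \<noteq> {}" by blast
    show "inv\<^bsub>G\<^esub> x \<in> ?S" if "x \<in> ?S" for x
      using that rel_inv[OF modulus(2,1)] mem group_hom.hom_inv[OF ha] group_hom.hom_inv[OF hb] by auto
    show "x \<otimes>\<^bsub>G\<^esub> y \<in> ?S" if "x \<in> ?S" "y \<in> ?S" for x y
      using that rel_mult[OF modulus(2)] mem group_hom.hom_mult[OF ha] group_hom.hom_mult[OF hb] by auto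
  qed auto
  moreover have "Y \<subseteq> ?S" using gen(2) rel by auto
  ultimately have "?S = carrier G" using gen(1) unfolding topgen_def by blast
  then show ?thesis using g by blast
qed

lemma reduce_power_hom:
  "(\<lambda>(M, q). (\<lambda>u v. M u v mod int p ^ Suc m, q)) \<in> hom (E (int p ^ Suc (Suc m))) (E (int p ^ Suc m))"
proof -
  have "(\<lambda>(M, q). (\<lambda>u v. M u v mod int p ^ Suc m, q)) \<in> hom (E (int p ^ Suc m * int p)) (E (int p ^ Suc m))"
    using prime_gt_0_nat[OF prime] by (intro reduce_hom modulus) simp
  then show ?thesis by (simp add: mult.commute)
qed

lemma compat_topgen:
  assumes G: "topological_group G" and gen: "topgen G Y" "Y \<subseteq> carrier G"
    and a: "a \<in> disc_hom G (E (int p ^ Suc (Suc m)))" and b: "b \<in> disc_hom G (E (int p ^ Suc m))"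
    and eq: "\<And>y. y \<in> Y \<Longrightarrow> (case a y of (M, q) \<Rightarrow> (\<lambda>u v. M u v mod int p ^ Suc m, q)) = b y"
    and g: "g \<in> carrier G"
  shows "(case a g of (M, q) \<Rightarrow> (\<lambda>u v. M u v mod int p ^ Suc m, q)) = b g"
  by (rule topgen_equalizer[OF G gen group_E_power disc_hom_compose[OF a reduce_power_hom] b eq g])

text \<open>Non-triviality is read off at level 0, modulo \<open>p\<close>, where an identity matrix
  for \<open>w\<close> would force \<open>x\<close> to be the unit.\<close>

theorem model_infinite_order:
  assumes G: "topological_group G"
    and h: "\<And>m. h m \<in> disc_hom G (E (int p ^ Suc m))"
    and compat: "\<And>m g. g \<in> carrier G \<Longrightarrow>
      (case h (Suc m) g of (M, q) \<Rightarrow> (\<lambda>u v. M u v mod int p ^ Suc m, q)) = h m g"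
    and H: "subgroup H G" and snd: "\<And>m g. g \<in> H \<Longrightarrow> snd (h m g) = \<one>"
    and w: "w \<in> H" "x \<in> carrier P" "x \<noteq> \<one>" "rel (h 0 w) x"
  shows "infinite_order_mod_derived G H"
proof (rule detect_infinite_order[OF G prime h _ H snd w(1)])
  show "fst (h (Suc m) g) u v mod int p ^ Suc m = fst (h m g) u v" if "g \<in> carrier G" for m g u v
    using compat[OF that, of m] by (cases "h (Suc m) g", cases "h m g") (auto dest: fun_cong)
  show "h 0 w \<noteq> \<one>\<^bsub>E (int p ^ Suc 0)\<^esub>"
    using rel_detects[of "int p ^ Suc 0" x] w(2,3,4) by auto
qed

end

text \<open>Here no families are permuted, so all of \<open>F\<close> is mapped to unipotent
  matrices and every non-trivial \<open>H\<close> is treated directly.\<close>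

theorem free_pro_p_infinite_order:
  fixes F :: "('a :: infinite) topgroup"
  assumes p: "prime p" and F: "free_object (pro_p_group p) F X"
    and H: "subgroup H F" "H \<noteq> {\<one>\<^bsub>F\<^esub>}"
  shows "infinite_order_mod_derived F H"
proof -
  have F': "free_object (\<lambda>H. pro_p_group p H \<and> (False \<longrightarrow> comm_group H)) F X"
    and proF: "pro_p_group p F" and XF: "X \<subseteq> carrier F" using F by (simp_all add: free_object_def)
  note gen = free_object_topgen[OF p F']
  have top: "topological_group F" using pro_p_groupD(1)[OF proF] .
  interpret F: topological_group F by fact
  obtain w where w: "w \<in> H" "w \<noteq> \<one>\<^bsub>F\<^esub>" using H subgroup.one_closed by blast
  have wF: "w \<in> carrier F" using w(1) subgroup.subset[OF H(1)] by blast
  obtain N where N: "N \<lhd> F" "openin (gtop F) N" "w \<notin> N" using pro_p_residually_finite[OF proF wF w(2)] .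
  interpret N: normal N F by fact
  let ?P = "F Mod N"
  let ?\<pi> = "\<lambda>g. N #>\<^bsub>F\<^esub> g"
  obtain e where e: "order ?P = p ^ e" using pro_p_order_quotient[OF proF N(1,2)] by blast
  obtain c where "word_model ?P p e c" using word_model_exists[OF N.factorgroup_is_group p e] .
  then interpret word_model ?P p e 1 c .
  have \<pi>: "?\<pi> \<in> disc_hom F ?P" using F.quotient_disc_hom[OF N(1,2)] .
  then have \<pi>P: "?\<pi> g \<in> carrier ?P" if "g \<in> carrier F" for g using that by (auto simp: disc_hom_def hom_def)
  \<comment> \<open>With \<open>k = 1\<close> a generator is represented by the only variable of the
    family labelled by its image in the quotient. Generators with equal images may share it, since
    only \<open>w\<close> has to be detected.\<close>
  define s where "s x j = (if j = (0 :: nat) then ?\<pi> x else \<one>\<^bsub>?P\<^esub>)" for x j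
  have s: "s x \<in> tuples" if "x \<in> X" for x
    unfolding tuples_def using \<pi>P[of x] XF that one_closed F.is_group
    by (auto simp: s_def simp del: one_FactGroup mult_FactGroup)
  have "\<exists>h. h \<in> disc_hom F (E (int p ^ Suc m)) \<and> (\<forall>x\<in>X. h x = elem (s x) 0)" for m
  proof -
    obtain j where j: "order (E (int p ^ Suc m)) = p ^ j" using order_E_power by blast
    have "(\<lambda>x. elem (s x) 0) \<in> X \<rightarrow> carrier (E (int p ^ Suc m))"
      using elem_closed[OF s _ modulus(1)] by auto
    from free_object_finite(1)[OF p F' group_E_power j _ this] show ?thesis by blast
  qed
  then obtain h where h: "\<And>m. h m \<in> disc_hom F (E (int p ^ Suc m))"
    "\<And>m x. x \<in> X \<Longrightarrow> h m x = elem (s x) 0" by metis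
  show ?thesis
  proof (rule model_infinite_order[OF top h(1) _ H(1) _ w(1)])
    show "(case h (Suc m) g of (M, q) \<Rightarrow> (\<lambda>u v. M u v mod int p ^ Suc m, q)) = h m g"
      if "g \<in> carrier F" for m g
      by (rule compat_topgen[OF top gen XF h(1) h(1) _ that])
         (use h(2) reduce_id[OF elem_closed[OF s _ modulus(1)]] in auto)
    show "snd (h m g) = \<one>\<^bsub>?P\<^esub>" if "g \<in> H" for m g
    proof (rule topgen_equalizer[OF top gen XF N.factorgroup_is_group])
      show "(\<lambda>g. snd (h m g)) \<in> disc_hom F ?P" using disc_hom_compose[OF h(1) snd_hom] .
      show "(\<lambda>g. \<one>\<^bsub>?P\<^esub>) \<in> disc_hom F ?P"
        using one_closed by (auto simp: disc_hom_def hom_def simp del: one_FactGroup mult_FactGroup)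
      show "g \<in> carrier F" using that subgroup.subset[OF H(1)] by blast
    qed (simp only: h(2) snd_elem)
    show "?\<pi> w \<in> carrier ?P" using \<pi>P[OF wF] .
    show "?\<pi> w \<noteq> \<one>\<^bsub>?P\<^esub>" using N(3) F.rcos_self[OF wF N.subgroup_axioms] by auto
    show "rel (h 0 w) (?\<pi> w)"
    proof (rule rel_topgen[OF top gen XF h(1) \<pi> _ wF])
      show "rel (h 0 x) (?\<pi> x)" if "x \<in> X" for x
        using rel_elem[OF s[OF that], of 0] h(2)[OF that] by (simp add: s_def)
    qed
  qed
qed

section \<open>Extensions of centralisers\<close>

lemma infinite_order_mod_derived_pullback:
  assumes f: "f \<in> cont_hom G G'" and G: "topological_group G" "topological_group G'"
    and H: "subgroup H G" and inf: "infinite_order_mod_derived G' (f ` H)"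
  shows "infinite_order_mod_derived G H"
proof -
  interpret G: topological_group G by fact
  interpret G': topological_group G' by fact
  interpret H: subgroup H G by fact
  have hom: "group_hom G G' f"
    using f G.is_group G'.is_group by (simp add: cont_hom_def group_hom_def group_hom_axioms_def)
  have cont: "continuous_map (gtop G) (gtop G') f" using f by (simp add: cont_hom_def)
  obtain k where k: "k \<in> H" "\<And>n :: nat. n > 0 \<Longrightarrow> f k [^]\<^bsub>G'\<^esub> n \<notin> gtop G' closure_of derived G' (f ` H)"
    using inf unfolding infinite_order_mod_derived_def by blast
  have kG: "k \<in> carrier G" using k(1) H.subset by blast
  have "f ` derived G H \<subseteq> derived G' (f ` H)"
    using group_hom.derived_img[OF hom H.subset] by simp
  have "k [^]\<^bsub>G\<^esub> n \<notin> gtop G closure_of derived G H" if "n > 0" for n :: nat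
  proof
    assume "k [^]\<^bsub>G\<^esub> n \<in> gtop G closure_of derived G H"
    then have "f (k [^]\<^bsub>G\<^esub> n) \<in> gtop G' closure_of (f ` derived G H)"
      using continuous_map_image_closure_subset[OF cont] by blast
    then have "f (k [^]\<^bsub>G\<^esub> n) \<in> gtop G' closure_of derived G' (f ` H)"
      using closure_of_mono[OF \<open>f ` derived G H \<subseteq> derived G' (f ` H)\<close>] by blast
    then show False using k(2)[OF that] group_hom.hom_nat_pow[OF hom kG] by simp
  qed
  then show ?thesis using k(1) unfolding infinite_order_mod_derived_def by blast
qed

text \<open>Multiplication from \<open>C \<times> B\<close> to \<open>A\<close> is a continuous
  bijection from a compact space onto a Hausdorff space, so its inverse is continuous, and so are
  both projections.\<close>

lemma direct_summand_projections:
  assumes A: "topological_group A" "comm_group A" "compact_space (gtop A)" "Hausdorff_space (gtop A)"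
    and G: "topological_group G" and C: "compact_space (gtop (subtopgroup G C))" "subgroup C G"
    and \<iota>: "\<iota> \<in> cont_hom (subtopgroup G C) A" "inj_on \<iota> C"
    and summand: "direct_summand (\<iota> ` C) A"
  obtains \<gamma> \<delta> where "\<gamma> \<in> cont_hom A G" "\<delta> \<in> cont_hom A A"
    "\<And>a. a \<in> carrier A \<Longrightarrow> \<gamma> a \<in> C" "\<And>a. a \<in> carrier A \<Longrightarrow> a = \<iota> (\<gamma> a) \<otimes>\<^bsub>A\<^esub> \<delta> a"
    "\<And>c. c \<in> C \<Longrightarrow> \<gamma> (\<iota> c) = c" "\<And>c. c \<in> C \<Longrightarrow> \<delta> (\<iota> c) = \<one>\<^bsub>A\<^esub>"
    "\<And>a. a \<in> carrier A \<Longrightarrow> \<delta> (\<delta> a) = \<delta> a"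
proof -
  interpret A: topological_group A by fact
  interpret Ac: comm_group A by fact
  interpret G: topological_group G by fact
  interpret C: subgroup C G by fact
  obtain B where B: "subgroup B A" "closedin (gtop A) B" "\<iota> ` C \<inter> B = {\<one>\<^bsub>A\<^esub>}" "\<iota> ` C <#>\<^bsub>A\<^esub> B = carrier A"
    using summand unfolding direct_summand_def closed_subgroup_def by blast
  interpret B: subgroup B A by fact
  let ?C = "subtopology (gtop G) C" and ?B = "subtopology (gtop A) B"
  have topC: "topspace ?C = C" using C.subset G.topspace_gtop by auto
  have topB: "topspace ?B = B" using B.subset A.topspace_gtop by auto
  have \<iota>_mult: "\<iota> (c \<otimes>\<^bsub>G\<^esub> d) = \<iota> c \<otimes>\<^bsub>A\<^esub> \<iota> d" if "c \<in> C" "d \<in> C" for c d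
    using \<iota>(1) that by (auto simp: cont_hom_def hom_def subtopgroup_def)
  have \<iota>A: "\<iota> c \<in> carrier A" if "c \<in> C" for c
    using \<iota>(1) that by (auto simp: cont_hom_def hom_def subtopgroup_def)
  have \<iota>_cont: "continuous_map ?C (gtop A) \<iota>" using \<iota>(1) by (simp add: cont_hom_def subtopgroup_def)
  have \<iota>_one: "\<iota> \<one>\<^bsub>G\<^esub> = \<one>\<^bsub>A\<^esub>"
    using \<iota>_mult[OF C.one_closed C.one_closed] \<iota>A[OF C.one_closed] by (simp add: A.l_cancel_one)
  have \<iota>_inv: "\<iota> (inv\<^bsub>G\<^esub> c) = inv\<^bsub>A\<^esub> \<iota> c" if "c \<in> C" for c
    using \<iota>_mult[of "inv\<^bsub>G\<^esub> c" c] that \<iota>_one \<iota>A C.mem_carrier by (metis A.inv_equality C.m_inv_closed G.l_inv)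
  have BA: "b \<in> carrier A" if "b \<in> B" for b using that B.subset by blast
  define \<mu> where "\<mu> = (\<lambda>(c, b). \<iota> c \<otimes>\<^bsub>A\<^esub> b)"
  have \<mu>_inj: "inj_on \<mu> (C \<times> B)"
  proof (rule inj_onI, clarify)
    fix c b c' b' assume cb: "c \<in> C" "b \<in> B" "c' \<in> C" "b' \<in> B" and eq: "\<mu> (c, b) = \<mu> (c', b')"
    have "\<iota> (inv\<^bsub>G\<^esub> c' \<otimes>\<^bsub>G\<^esub> c) = inv\<^bsub>A\<^esub> \<iota> c' \<otimes>\<^bsub>A\<^esub> (\<iota> c \<otimes>\<^bsub>A\<^esub> b) \<otimes>\<^bsub>A\<^esub> inv\<^bsub>A\<^esub> b"
      using cb \<iota>A BA by (simp add: \<iota>_mult \<iota>_inv A.m_assoc)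
    also have "\<dots> = inv\<^bsub>A\<^esub> \<iota> c' \<otimes>\<^bsub>A\<^esub> (\<iota> c' \<otimes>\<^bsub>A\<^esub> b') \<otimes>\<^bsub>A\<^esub> inv\<^bsub>A\<^esub> b"
      using eq by (simp add: \<mu>_def)
    also have "\<dots> = (inv\<^bsub>A\<^esub> \<iota> c' \<otimes>\<^bsub>A\<^esub> \<iota> c') \<otimes>\<^bsub>A\<^esub> b' \<otimes>\<^bsub>A\<^esub> inv\<^bsub>A\<^esub> b"
      using cb \<iota>A BA by (simp only: A.m_assoc A.inv_closed A.m_closed)
    also have "\<dots> = b' \<otimes>\<^bsub>A\<^esub> inv\<^bsub>A\<^esub> b" using cb \<iota>A BA by simp
    finally have eq': "\<iota> (inv\<^bsub>G\<^esub> c' \<otimes>\<^bsub>G\<^esub> c) = b' \<otimes>\<^bsub>A\<^esub> inv\<^bsub>A\<^esub> b" .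
    moreover have "inv\<^bsub>G\<^esub> c' \<otimes>\<^bsub>G\<^esub> c \<in> C" "b' \<otimes>\<^bsub>A\<^esub> inv\<^bsub>A\<^esub> b \<in> B" using cb by simp_all
    ultimately have one: "b' \<otimes>\<^bsub>A\<^esub> inv\<^bsub>A\<^esub> b = \<one>\<^bsub>A\<^esub>" using B(3) by (metis IntI imageI singletonD)
    then have "inv\<^bsub>G\<^esub> c' \<otimes>\<^bsub>G\<^esub> c = \<one>\<^bsub>G\<^esub>"
      using eq' \<iota>_one \<open>inv\<^bsub>G\<^esub> c' \<otimes>\<^bsub>G\<^esub> c \<in> C\<close> C.one_closed \<iota>(2) by (metis inj_onD)
    then have "c = c'" using cb C.mem_carrier by (metis G.inv_closed G.inv_equality G.inv_inv)
    moreover have "b = b'" using one cb BA by (metis A.inv_closed A.inv_equality A.inv_inv)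
    ultimately show "c = c' \<and> b = b'" by simp
  qed
  have \<mu>_img: "\<mu> ` (C \<times> B) = carrier A"
  proof -
    have "\<mu> ` (C \<times> B) = \<iota> ` C <#>\<^bsub>A\<^esub> B" by (force simp: \<mu>_def set_mult_def)
    then show ?thesis using B(4) by simp
  qed
  have \<mu>_cont: "continuous_map (prod_topology ?C ?B) (gtop A) \<mu>"
  proof -
    have "continuous_map (prod_topology ?C ?B) (gtop A) (\<lambda>x. \<iota> (fst x) \<otimes>\<^bsub>A\<^esub> snd x)"
    proof (rule A.continuous_op)
      show "continuous_map (prod_topology ?C ?B) (gtop A) (\<lambda>x. \<iota> (fst x))"
        using continuous_map_compose[OF continuous_map_fst \<iota>_cont] by (simp add: comp_def)
      show "continuous_map (prod_topology ?C ?B) (gtop A) snd"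
        using continuous_map_into_fulltopology[OF continuous_map_snd] .
    qed
    then show ?thesis by (simp add: \<mu>_def case_prod_unfold)
  qed
  have "compact_space ?B" using closedin_compact_space[OF A(3) B(2)] by (simp add: compact_space_subtopology)
  moreover have "compact_space ?C" using C(1) by (simp add: subtopgroup_def)
  ultimately have "homeomorphic_map (prod_topology ?C ?B) (gtop A) \<mu>"
    using \<mu>_cont \<mu>_inj \<mu>_img A(4) topB topC A.topspace_gtop
    by (intro continuous_imp_homeomorphic_map) (auto simp: compact_space_prod_topology)
  then obtain \<nu> where \<nu>: "continuous_map (gtop A) (prod_topology ?C ?B) \<nu>"
    "\<And>x. x \<in> C \<times> B \<Longrightarrow> \<nu> (\<mu> x) = x" "\<And>a. a \<in> carrier A \<Longrightarrow> \<mu> (\<nu> a) = a"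
  proof -
    have "topspace (prod_topology ?C ?B) = C \<times> B" by (simp only: topspace_prod_topology topB topC)
    then show thesis
      using \<open>homeomorphic_map (prod_topology ?C ?B) (gtop A) \<mu>\<close> that A.topspace_gtop
      unfolding homeomorphic_map_maps homeomorphic_maps_def by metis
  qed
  define \<gamma> \<delta> where "\<gamma> a = fst (\<nu> a)" and "\<delta> a = snd (\<nu> a)" for a
  have \<nu>_mem: "\<nu> a \<in> C \<times> B" if "a \<in> carrier A" for a
    using continuous_map_image_subset_topspace[OF \<nu>(1)] that by (auto simp: topB topC A.topspace_gtop)
  then have mem: "\<gamma> a \<in> C" "\<delta> a \<in> B" if "a \<in> carrier A" for a
    using that by (auto simp: \<gamma>_def \<delta>_def mem_Times_iff)
  have dec: "\<iota> (\<gamma> a) \<otimes>\<^bsub>A\<^esub> \<delta> a = a" if "a \<in> carrier A" for a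
    using \<nu>(3)[OF that] by (simp add: \<gamma>_def \<delta>_def \<mu>_def case_prod_unfold)
  have uniq: "\<gamma> (\<iota> c \<otimes>\<^bsub>A\<^esub> b) = c" "\<delta> (\<iota> c \<otimes>\<^bsub>A\<^esub> b) = b" if "c \<in> C" "b \<in> B" for c b
    using \<nu>(2)[of "(c, b)"] that by (simp_all add: \<gamma>_def \<delta>_def \<mu>_def)
  have mult: "a \<otimes>\<^bsub>A\<^esub> a' = \<iota> (\<gamma> a \<otimes>\<^bsub>G\<^esub> \<gamma> a') \<otimes>\<^bsub>A\<^esub> (\<delta> a \<otimes>\<^bsub>A\<^esub> \<delta> a')"
    if "a \<in> carrier A" "a' \<in> carrier A" for a a'
  proof -
    have "a \<otimes>\<^bsub>A\<^esub> a' = (\<iota> (\<gamma> a) \<otimes>\<^bsub>A\<^esub> \<delta> a) \<otimes>\<^bsub>A\<^esub> (\<iota> (\<gamma> a') \<otimes>\<^bsub>A\<^esub> \<delta> a')"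
      using dec that by simp
    also have "\<dots> = (\<iota> (\<gamma> a) \<otimes>\<^bsub>A\<^esub> \<iota> (\<gamma> a')) \<otimes>\<^bsub>A\<^esub> (\<delta> a \<otimes>\<^bsub>A\<^esub> \<delta> a')"
      using mem[OF that(1)] mem[OF that(2)] \<iota>A BA by (simp add: Ac.m_ac)
    finally show ?thesis using mem that \<iota>_mult by simp
  qed
  have "continuous_map (gtop A) ?C \<gamma>" "continuous_map (gtop A) ?B \<delta>"
    using continuous_map_compose[OF \<nu>(1) continuous_map_fst] continuous_map_compose[OF \<nu>(1) continuous_map_snd]
    by (simp_all add: \<gamma>_def[abs_def] \<delta>_def[abs_def] comp_def)
  then have cont: "continuous_map (gtop A) (gtop G) \<gamma>" "continuous_map (gtop A) (gtop A) \<delta>"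
    by (blast intro: continuous_map_into_fulltopology)+
  have hom: "\<gamma> (a \<otimes>\<^bsub>A\<^esub> a') = \<gamma> a \<otimes>\<^bsub>G\<^esub> \<gamma> a'" "\<delta> (a \<otimes>\<^bsub>A\<^esub> a') = \<delta> a \<otimes>\<^bsub>A\<^esub> \<delta> a'"
    if "a \<in> carrier A" "a' \<in> carrier A" for a a'
    unfolding mult[OF that] using that mem by (simp_all add: uniq)
  show thesis
  proof (rule that[of \<gamma> \<delta>])
    show "\<gamma> \<in> cont_hom A G"
      using cont(1) mem(1) C.mem_carrier hom(1) by (simp add: cont_hom_def hom_def)
    show "\<delta> \<in> cont_hom A A"
      using cont(2) mem(2) BA hom(2) by (simp add: cont_hom_def hom_def)
    show "\<gamma> (\<iota> c) = c" "\<delta> (\<iota> c) = \<one>\<^bsub>A\<^esub>" if "c \<in> C" for c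
      using uniq[OF that B.one_closed] \<iota>A[OF that] by simp_all
    show "\<delta> (\<delta> a) = \<delta> a" if "a \<in> carrier A" for a
      using uniq[OF C.one_closed mem(2)[OF that]] BA[OF mem(2)[OF that]] by (simp add: \<iota>_one)
  qed (use mem dec in auto)
qed

section \<open>Centralisers in abstract groups\<close>

lemma subgroup_centralizer:
  assumes "group G" and S: "S \<subseteq> carrier G"
  shows "subgroup {x \<in> carrier G. \<forall>y\<in>S. x \<otimes>\<^bsub>G\<^esub> y = y \<otimes>\<^bsub>G\<^esub> x} G"
proof -
  interpret group G by fact
  show ?thesis
  proof (rule subgroupI)
    show "{x \<in> carrier G. \<forall>y\<in>S. x \<otimes>\<^bsub>G\<^esub> y = y \<otimes>\<^bsub>G\<^esub> x} \<noteq> {}" using S by (auto intro!: exI[of _ "\<one>\<^bsub>G\<^esub>"])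
  next
    fix x assume x: "x \<in> {x \<in> carrier G. \<forall>y\<in>S. x \<otimes>\<^bsub>G\<^esub> y = y \<otimes>\<^bsub>G\<^esub> x}"
    have "inv\<^bsub>G\<^esub> x \<otimes>\<^bsub>G\<^esub> y = y \<otimes>\<^bsub>G\<^esub> inv\<^bsub>G\<^esub> x" if "y \<in> S" for y
    proof -
      have y: "y \<in> carrier G" "x \<in> carrier G" "x \<otimes>\<^bsub>G\<^esub> y = y \<otimes>\<^bsub>G\<^esub> x" using x S that by auto
      have "inv\<^bsub>G\<^esub> x \<otimes>\<^bsub>G\<^esub> (x \<otimes>\<^bsub>G\<^esub> y) \<otimes>\<^bsub>G\<^esub> inv\<^bsub>G\<^esub> x = inv\<^bsub>G\<^esub> x \<otimes>\<^bsub>G\<^esub> (y \<otimes>\<^bsub>G\<^esub> x) \<otimes>\<^bsub>G\<^esub> inv\<^bsub>G\<^esub> x"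
        using y(3) by simp
      moreover have "inv\<^bsub>G\<^esub> x \<otimes>\<^bsub>G\<^esub> (x \<otimes>\<^bsub>G\<^esub> y) = y" using y(1,2) by (simp add: m_assoc[symmetric])
      moreover have "inv\<^bsub>G\<^esub> x \<otimes>\<^bsub>G\<^esub> (y \<otimes>\<^bsub>G\<^esub> x) \<otimes>\<^bsub>G\<^esub> inv\<^bsub>G\<^esub> x = inv\<^bsub>G\<^esub> x \<otimes>\<^bsub>G\<^esub> y"
        using y(1,2) by (simp add: m_assoc)
      ultimately show ?thesis by simp
    qed
    then show "inv\<^bsub>G\<^esub> x \<in> {x \<in> carrier G. \<forall>y\<in>S. x \<otimes>\<^bsub>G\<^esub> y = y \<otimes>\<^bsub>G\<^esub> x}" using x by simp
  next
    fix x z assume x: "x \<in> {x \<in> carrier G. \<forall>y\<in>S. x \<otimes>\<^bsub>G\<^esub> y = y \<otimes>\<^bsub>G\<^esub> x}"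
      and z: "z \<in> {x \<in> carrier G. \<forall>y\<in>S. x \<otimes>\<^bsub>G\<^esub> y = y \<otimes>\<^bsub>G\<^esub> x}"
    have "x \<otimes>\<^bsub>G\<^esub> z \<otimes>\<^bsub>G\<^esub> y = y \<otimes>\<^bsub>G\<^esub> (x \<otimes>\<^bsub>G\<^esub> z)" if "y \<in> S" for y
    proof -
      have y: "y \<in> carrier G" "x \<in> carrier G" "z \<in> carrier G" "x \<otimes>\<^bsub>G\<^esub> y = y \<otimes>\<^bsub>G\<^esub> x" "z \<otimes>\<^bsub>G\<^esub> y = y \<otimes>\<^bsub>G\<^esub> z"
        using x z S that by auto
      have "x \<otimes>\<^bsub>G\<^esub> z \<otimes>\<^bsub>G\<^esub> y = x \<otimes>\<^bsub>G\<^esub> (y \<otimes>\<^bsub>G\<^esub> z)" using y by (simp add: m_assoc)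
      also have "\<dots> = (y \<otimes>\<^bsub>G\<^esub> x) \<otimes>\<^bsub>G\<^esub> z" unfolding y(4)[symmetric] using y(1-3) by (simp add: m_assoc)
      finally show ?thesis using y(1-3) by (simp add: m_assoc)
    qed
    then show "x \<otimes>\<^bsub>G\<^esub> z \<in> {x \<in> carrier G. \<forall>y\<in>S. x \<otimes>\<^bsub>G\<^esub> y = y \<otimes>\<^bsub>G\<^esub> x}" using x z by simp
  qed auto
qed

text \<open>The universal property of a free abelian pro-p group needs an abelian target, unlike the
  full matrix group. The double centraliser of \<open>S\<close> is one, and whatever commutes with
  \<open>S\<close> still commutes with all of it.\<close>

lemma double_centralizer:
  assumes "group G" "S \<subseteq> carrier G" "\<And>x y. x \<in> S \<Longrightarrow> y \<in> S \<Longrightarrow> x \<otimes>\<^bsub>G\<^esub> y = y \<otimes>\<^bsub>G\<^esub> x"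
  obtains Z where "subgroup Z G" "comm_group (G\<lparr>carrier := Z\<rparr>)" "S \<subseteq> Z"
    "\<And>x z. x \<in> carrier G \<Longrightarrow> (\<forall>y\<in>S. x \<otimes>\<^bsub>G\<^esub> y = y \<otimes>\<^bsub>G\<^esub> x) \<Longrightarrow> z \<in> Z \<Longrightarrow> x \<otimes>\<^bsub>G\<^esub> z = z \<otimes>\<^bsub>G\<^esub> x"
proof -
  define C where "C = {x \<in> carrier G. \<forall>y\<in>S. x \<otimes>\<^bsub>G\<^esub> y = y \<otimes>\<^bsub>G\<^esub> x}"
  define Z where "Z = {x \<in> carrier G. \<forall>y\<in>C. x \<otimes>\<^bsub>G\<^esub> y = y \<otimes>\<^bsub>G\<^esub> x}"
  have sub: "subgroup Z G" unfolding Z_def by (rule subgroup_centralizer[OF assms(1)]) (auto simp: C_def)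
  have "S \<subseteq> C" using assms(2,3) unfolding C_def by blast
  then have "Z \<subseteq> C" unfolding Z_def C_def by blast
  then have comm: "x \<otimes>\<^bsub>G\<^esub> z = z \<otimes>\<^bsub>G\<^esub> x" if "x \<in> Z" "z \<in> Z" for x z
    using that unfolding Z_def by blast
  show thesis
  proof (rule that[of Z])
    show "comm_group (G\<lparr>carrier := Z\<rparr>)"
      by (rule group.group_comm_groupI[OF subgroup.subgroup_is_group[OF sub assms(1)]]) (simp add: comm)
    show "S \<subseteq> Z"
    proof
      fix y assume y: "y \<in> S"
      have "y \<otimes>\<^bsub>G\<^esub> x = x \<otimes>\<^bsub>G\<^esub> y" if "x \<in> C" for x using that y unfolding C_def by auto
      then show "y \<in> Z" using y assms(2) unfolding Z_def by blast
    qed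
    show "x \<otimes>\<^bsub>G\<^esub> z = z \<otimes>\<^bsub>G\<^esub> x"
      if "x \<in> carrier G" "\<forall>y\<in>S. x \<otimes>\<^bsub>G\<^esub> y = y \<otimes>\<^bsub>G\<^esub> x" "z \<in> Z" for x z
    proof -
      have "x \<in> C" using that(1,2) unfolding C_def by blast
      then have "z \<otimes>\<^bsub>G\<^esub> x = x \<otimes>\<^bsub>G\<^esub> z" using that(3) unfolding Z_def by blast
      then show ?thesis by (rule sym)
    qed
  qed (rule sub)
qed

theorem extension_infinite_order:
  fixes G :: "('a :: infinite) topgroup"
  assumes p: "prime p" and G0: "\<And>H. subgroup H G0 \<Longrightarrow> H \<noteq> {\<one>\<^bsub>G0\<^esub>} \<Longrightarrow> infinite_order_mod_derived G0 H"
    and C: "subgroup C G0" and A: "fg_free_abelian_pro_p p A" and summand: "direct_summand (\<iota> ` C) A"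
    and G: "amalgamated_product p (subtopgroup G0 C) (\<lambda>c. c) G0 \<iota> A G \<phi> \<psi>"
    and H: "subgroup H G" "H \<noteq> {\<one>\<^bsub>G\<^esub>}"
  shows "infinite_order_mod_derived G H"
proof -
  have pro: "pro_p_group p (subtopgroup G0 C)" "pro_p_group p G0" "pro_p_group p A" "pro_p_group p G"
    and maps: "\<phi> \<in> cont_hom G0 G" "\<psi> \<in> cont_hom A G" "\<iota> \<in> cont_hom (subtopgroup G0 C) A" "inj_on \<iota> C"
      "\<And>c. c \<in> C \<Longrightarrow> \<phi> c = \<psi> (\<iota> c)"
    using G by (simp_all add: amalgamated_product_def subtopgroup_def)
  have top: "topological_group G0" "topological_group A" "topological_group G"
    using pro pro_p_groupD(1) by blast+
  interpret G: topological_group G by (rule top)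
  interpret A: topological_group A by (rule top)
  interpret C: subgroup C G0 by (rule C)
  obtain X where X: "finite X" and A': "free_object (\<lambda>H. pro_p_group p H \<and> (True \<longrightarrow> comm_group H)) A X"
    using A by (auto simp: fg_free_abelian_pro_p_def)
  have commA: "comm_group A" and XA: "X \<subseteq> carrier A" using A' by (simp_all add: free_object_def)
  interpret Ac: comm_group A by (rule commA)
  note genA = free_object_topgen[OF p A'] and genG = amalgamated_product_topgen[OF p G]
  have genG_sub: "\<phi> ` carrier G0 \<union> \<psi> ` carrier A \<subseteq> carrier G"
    using maps(1,2) by (auto simp: cont_hom_def hom_def)
  obtain \<gamma> \<delta> where \<gamma>: "\<gamma> \<in> cont_hom A G0" and \<delta>: "\<delta> \<in> cont_hom A A"
    and \<gamma>C: "\<And>a. a \<in> carrier A \<Longrightarrow> \<gamma> a \<in> C" and dec: "\<And>a. a \<in> carrier A \<Longrightarrow> a = \<iota> (\<gamma> a) \<otimes>\<^bsub>A\<^esub> \<delta> a"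
    and \<gamma>\<iota>: "\<And>c. c \<in> C \<Longrightarrow> \<gamma> (\<iota> c) = c" and \<delta>\<iota>: "\<And>c. c \<in> C \<Longrightarrow> \<delta> (\<iota> c) = \<one>\<^bsub>A\<^esub>"
    and \<delta>\<delta>: "\<And>a. a \<in> carrier A \<Longrightarrow> \<delta> (\<delta> a) = \<delta> a"
    using direct_summand_projections[OF top(2) commA pro_p_groupD(2,3)[OF pro(3)] top(1)
        pro_p_groupD(2)[OF pro(1)] C maps(3,4) summand] by blast
  have \<delta>A: "\<delta> a \<in> carrier A" if "a \<in> carrier A" for a using \<delta> that by (auto simp: cont_hom_def hom_def)
  have \<iota>A: "\<iota> c \<in> carrier A" if "c \<in> C" for c
    using maps(3) that by (auto simp: cont_hom_def hom_def subtopgroup_def)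
  \<comment> \<open>The retraction glues the identity of \<open>G0\<close> with the projection
    \<open>\<gamma>\<close> of \<open>A\<close>; they agree on \<open>C\<close> because
    \<open>\<gamma> (\<iota> c) = c\<close>.\<close>
  obtain \<rho> where \<rho>: "\<rho> \<in> cont_hom G G0" "\<And>x. x \<in> carrier G0 \<Longrightarrow> \<rho> (\<phi> x) = x"
    "\<And>a. a \<in> carrier A \<Longrightarrow> \<rho> (\<psi> a) = \<gamma> a"
  proof -
    have "(\<lambda>x. x) \<in> cont_hom G0 G0" by (auto simp: cont_hom_def hom_def)
    moreover have "\<forall>c\<in>carrier (subtopgroup G0 C). c = \<gamma> (\<iota> c)" using \<gamma>\<iota> by (simp add: subtopgroup_def)
    ultimately have "\<exists>h\<in>cont_hom G G0. (\<forall>x\<in>carrier G0. h (\<phi> x) = x) \<and> (\<forall>y\<in>carrier A. h (\<psi> y) = \<gamma> y)"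
      using G pro(2) \<gamma> unfolding amalgamated_product_def by blast
    then show thesis using that by blast
  qed
  show ?thesis
  proof (cases "\<rho> ` H = {\<one>\<^bsub>G0\<^esub>}")
    case False
    have "group_hom G G0 \<rho>" using \<rho>(1) top
      by (simp add: cont_hom_def group_hom_def group_hom_axioms_def topological_group_def)
    then have "subgroup (\<rho> ` H) G0" using group_hom.subgroup_img_is_subgroup H(1) by blast
    then show ?thesis
      using infinite_order_mod_derived_pullback[OF \<rho>(1) top(3,1) H(1) G0] False by blast
  next
    case True
    obtain w where w: "w \<in> H" "w \<noteq> \<one>\<^bsub>G\<^esub>" using H subgroup.one_closed by blast
    have wG: "w \<in> carrier G" using w(1) subgroup.subset[OF H(1)] by blast
    obtain N where N: "N \<lhd> G" "openin (gtop G) N" "w \<notin> N" using pro_p_residually_finite[OF pro(4) wG w(2)] .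
    interpret N: normal N G by fact
    define P where "P = G Mod N"
    define \<pi> where "\<pi> g = N #>\<^bsub>G\<^esub> g" for g
    have grpP: "group P" unfolding P_def by (rule N.factorgroup_is_group)
    interpret P: group P by (rule grpP)
    obtain e where e: "order P = p ^ e" using pro_p_order_quotient[OF pro(4) N(1,2)] by (auto simp: P_def)
    have \<pi>: "\<pi> \<in> disc_hom G P" using G.quotient_disc_hom[OF N(1,2)] by (simp add: \<pi>_def[abs_def] P_def)
    have \<pi>w: "\<pi> w \<noteq> \<one>\<^bsub>P\<^esub>" using N(3) G.rcos_self[OF wG N.subgroup_axioms] by (auto simp: \<pi>_def P_def)
    have \<pi>P: "\<pi> g \<in> carrier P" if "g \<in> carrier G" for g using \<pi> that by (auto simp: disc_hom_def hom_def)
    define \<pi>\<^sub>0 where "\<pi>\<^sub>0 x = \<pi> (\<phi> x)" for x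
    define \<sigma> where "\<sigma> a = \<pi> (\<psi> a)" for a
    have \<pi>\<^sub>0: "\<pi>\<^sub>0 \<in> disc_hom G0 P" and \<sigma>: "\<sigma> \<in> disc_hom A P"
      using cont_hom_disc_hom[OF maps(1) \<pi>] cont_hom_disc_hom[OF maps(2) \<pi>]
      by (simp_all add: \<pi>\<^sub>0_def[abs_def] \<sigma>_def[abs_def])
    have \<pi>\<^sub>0P: "\<pi>\<^sub>0 x \<in> carrier P" if "x \<in> carrier G0" for x using \<pi>\<^sub>0 that by (auto simp: disc_hom_def hom_def)
    have \<sigma>P: "\<sigma> a \<in> carrier P" if "a \<in> carrier A" for a using \<sigma> that by (auto simp: disc_hom_def hom_def)
    have \<sigma>_mult: "\<sigma> (a \<otimes>\<^bsub>A\<^esub> b) = \<sigma> a \<otimes>\<^bsub>P\<^esub> \<sigma> b" if "a \<in> carrier A" "b \<in> carrier A" for a b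
      using \<sigma> that by (simp add: disc_hom_def hom_def)
    have \<sigma>_comm: "\<sigma> a \<otimes>\<^bsub>P\<^esub> \<sigma> b = \<sigma> b \<otimes>\<^bsub>P\<^esub> \<sigma> a" if "a \<in> carrier A" "b \<in> carrier A" for a b
      using that \<sigma>_mult[of a b] \<sigma>_mult[of b a] Ac.m_comm by simp
    have \<pi>\<^sub>0\<iota>: "\<pi>\<^sub>0 c = \<sigma> (\<iota> c)" if "c \<in> C" for c using maps(5)[OF that] by (simp add: \<pi>\<^sub>0_def \<sigma>_def)
    define k where "k = card X"
    obtain idx where idx: "bij_betw idx X {0..<k}" using ex_bij_betw_finite_nat[OF X] unfolding k_def by blast
    have idx_less: "idx x < k" if "x \<in> X" for x using idx that by (auto simp: bij_betw_def)
    \<comment> \<open>The basis \<open>X\<close> need not be adapted to the splitting of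
      \<open>A\<close>, so the family consists of the images of the components
      \<open>\<delta> x\<close>. The map \<open>\<alpha>\<close> below is defined on all of
      \<open>A\<close> but enters \<open>\<beta>\<close> only through values of
      \<open>\<delta>\<close>, which avoids choosing a basis of the complement.\<close>
    define s where "s j = (if j < k then \<sigma> (\<delta> (inv_into X idx j)) else \<one>\<^bsub>P\<^esub>)" for j
    have s_idx: "s (idx x) = \<sigma> (\<delta> x)" if "x \<in> X" for x
      using idx that idx_less[OF that] by (simp add: s_def bij_betw_def)
    have inv_idx: "inv_into X idx j \<in> X" if "j < k" for j
      using idx that by (auto simp: bij_betw_def intro!: inv_into_into)
    have s_comm: "\<sigma> a \<otimes>\<^bsub>P\<^esub> s j = s j \<otimes>\<^bsub>P\<^esub> \<sigma> a" if "a \<in> carrier A" for a j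
    proof (cases "j < k")
      case True
      then show ?thesis using \<sigma>_comm[OF that \<delta>A, of "inv_into X idx j"] inv_idx[OF True] XA
        by (auto simp only: s_def if_True)
    qed (use \<sigma>P[OF that] in \<open>simp add: s_def\<close>)
    obtain c where "word_model P p e c" using word_model_exists[OF grpP p e] .
    then interpret word_model P p e k c .
    have s: "s \<in> tuples"
      unfolding tuples_def
    proof (intro CollectI conjI allI)
      show "range s \<subseteq> carrier P" using \<sigma>P \<delta>A inv_idx XA by (auto simp: s_def)
      show "s i \<otimes>\<^bsub>P\<^esub> s j = s j \<otimes>\<^bsub>P\<^esub> s i" for i j
      proof (cases "i < k")
        case True
        then show ?thesis using s_comm[OF \<delta>A] inv_idx XA by (auto simp: s_def[of i])
      next
        case False
        then have "s i = \<one>\<^bsub>P\<^esub>" "s j \<in> carrier P" using \<open>range s \<subseteq> carrier P\<close> by (auto simp: s_def)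
        then show ?thesis by simp
      qed
    qed (auto simp: s_def)
    let ?E = "\<lambda>m. E (int p ^ Suc m)"
    define pm where "pm q = (perm_mat short_words (conj_word q), q)" for q
    have pm_hom: "pm \<in> hom P (?E m)" for m using perm_hom[OF modulus(1)] by (simp add: pm_def[abs_def])
    have pm_red: "(case pm q of (M, q) \<Rightarrow> (\<lambda>u v. M u v mod int p ^ Suc m, q)) = pm q" if "q \<in> carrier P" for q m
      using reduce_perm[OF that modulus(1)] by (simp add: pm_def)
    have pm_elem: "pm (\<sigma> a) \<otimes>\<^bsub>?E m\<^esub> elem s j = elem s j \<otimes>\<^bsub>?E m\<^esub> pm (\<sigma> a)"
      if a: "a \<in> carrier A" and j: "j < k" for a j m
    proof -
      have "conj_tuple (\<sigma> a) s = s"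
        using s_comm[OF a] \<sigma>P[OF a] tuple_closed[OF s] by (simp add: conj_tuple_def P.m_assoc)
      then show ?thesis unfolding pm_def by (intro perm_commute_elem \<sigma>P a s j)
    qed
    have "\<exists>\<alpha>. \<alpha> \<in> disc_hom A (?E m) \<and> (\<forall>x\<in>X. \<alpha> x = elem s (idx x)) \<and>
      (\<forall>a\<in>carrier A. \<forall>b\<in>carrier A. pm (\<sigma> a) \<otimes>\<^bsub>?E m\<^esub> \<alpha> b = \<alpha> b \<otimes>\<^bsub>?E m\<^esub> pm (\<sigma> a))" for m
    proof -
      have "elem s ` {..<k} \<subseteq> carrier (?E m)" using elem_closed[OF s _ modulus(1)] by auto
      moreover have "x \<otimes>\<^bsub>?E m\<^esub> y = y \<otimes>\<^bsub>?E m\<^esub> x" if "x \<in> elem s ` {..<k}" "y \<in> elem s ` {..<k}" for x y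
        using that elem_commute[OF s] by auto
      ultimately obtain Z where Z: "subgroup Z (?E m)" "comm_group ((?E m)\<lparr>carrier := Z\<rparr>)" "elem s ` {..<k} \<subseteq> Z"
        "\<And>x z. x \<in> carrier (?E m) \<Longrightarrow> (\<forall>y\<in>elem s ` {..<k}. x \<otimes>\<^bsub>?E m\<^esub> y = y \<otimes>\<^bsub>?E m\<^esub> x) \<Longrightarrow>
           z \<in> Z \<Longrightarrow> x \<otimes>\<^bsub>?E m\<^esub> z = z \<otimes>\<^bsub>?E m\<^esub> x"
        using double_centralizer[OF group_E_power, of "elem s ` {..<k}" m] by blast
      obtain i where "order (?E m) = p ^ i" using order_E_power by blast
      then obtain j where j: "order ((?E m)\<lparr>carrier := Z\<rparr>) = p ^ j"
        using order_subgroup_p_group[OF p group_E_power _ Z(1)] by blast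
      have "(\<lambda>x. elem s (idx x)) \<in> X \<rightarrow> carrier ((?E m)\<lparr>carrier := Z\<rparr>)" using Z(3) idx_less by auto
      from free_object_finite(1)[OF p A' subgroup.subgroup_is_group[OF Z(1) group_E_power] j _ this] Z(2)
      obtain \<alpha> where \<alpha>: "\<alpha> \<in> disc_hom A ((?E m)\<lparr>carrier := Z\<rparr>)" "\<forall>x\<in>X. \<alpha> x = elem s (idx x)" by blast
      have "pm (\<sigma> a) \<otimes>\<^bsub>?E m\<^esub> \<alpha> b = \<alpha> b \<otimes>\<^bsub>?E m\<^esub> pm (\<sigma> a)" if "a \<in> carrier A" "b \<in> carrier A" for a b
      proof (rule Z(4))
        show "pm (\<sigma> a) \<in> carrier (?E m)" using hom_in_carrier[OF pm_hom] \<sigma>P[OF that(1)] by blast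
        show "\<alpha> b \<in> Z" using \<alpha>(1) that(2) by (auto simp: disc_hom_def hom_def)
      qed (use pm_elem[OF that(1)] in auto)
      then show ?thesis using \<alpha>(2) disc_hom_subgroup_mono[OF \<alpha>(1) Z(1)] by blast
    qed
    then obtain \<alpha> where \<alpha>: "\<And>m. \<alpha> m \<in> disc_hom A (?E m)" "\<And>m x. x \<in> X \<Longrightarrow> \<alpha> m x = elem s (idx x)"
      "\<And>m a b. a \<in> carrier A \<Longrightarrow> b \<in> carrier A \<Longrightarrow> pm (\<sigma> a) \<otimes>\<^bsub>?E m\<^esub> \<alpha> m b = \<alpha> m b \<otimes>\<^bsub>?E m\<^esub> pm (\<sigma> a)"
      by metis
    \<comment> \<open>The component in \<open>C\<close> permutes the families through
      \<open>P\<close>, the other one acts through \<open>\<alpha>\<close>; the two commute, so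
      \<open>\<beta>\<close> is multiplicative. On \<open>\<iota> c\<close> the second factor is
      trivial, which gives compatibility over \<open>C\<close>.\<close>
    define \<beta> where "\<beta> m a = pm (\<pi>\<^sub>0 (\<gamma> a)) \<otimes>\<^bsub>?E m\<^esub> \<alpha> m (\<delta> a)" for m a
    have \<gamma>_eq: "\<pi>\<^sub>0 (\<gamma> a) = \<sigma> (\<iota> (\<gamma> a))" if "a \<in> carrier A" for a using \<pi>\<^sub>0\<iota> \<gamma>C that by simp
    have pm\<pi>\<^sub>0: "(\<lambda>x. pm (\<pi>\<^sub>0 x)) \<in> disc_hom G0 (?E m)" for m by (rule disc_hom_compose[OF \<pi>\<^sub>0 pm_hom])
    have pmE: "pm q \<in> carrier (?E m)" if "q \<in> carrier P" for q m using hom_in_carrier[OF pm_hom that] .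
    have \<alpha>E: "\<alpha> m a \<in> carrier (?E m)" if "a \<in> carrier A" for m a
      using \<alpha>(1)[of m] that by (auto simp: disc_hom_def hom_def)
    have pm\<gamma>: "(\<lambda>a. pm (\<pi>\<^sub>0 (\<gamma> a))) \<in> disc_hom A (?E m)" for m by (rule cont_hom_disc_hom[OF \<gamma> pm\<pi>\<^sub>0])
    have \<alpha>\<delta>: "(\<lambda>a. \<alpha> m (\<delta> a)) \<in> disc_hom A (?E m)" for m by (rule cont_hom_disc_hom[OF \<delta> \<alpha>(1)])
    have \<gamma>P: "\<pi>\<^sub>0 (\<gamma> a) \<in> carrier P" if "a \<in> carrier A" for a using \<pi>\<^sub>0P \<gamma>C[OF that] C.mem_carrier by blast
    have \<beta>: "\<beta> m \<in> disc_hom A (?E m)" for m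
    proof -
      interpret Em: group "?E m" by (rule group_E_power)
      have "\<beta> m (a \<otimes>\<^bsub>A\<^esub> b) = \<beta> m a \<otimes>\<^bsub>?E m\<^esub> \<beta> m b" if ab: "a \<in> carrier A" "b \<in> carrier A" for a b
      proof -
        let ?x = "\<lambda>a. pm (\<pi>\<^sub>0 (\<gamma> a))" and ?y = "\<lambda>a. \<alpha> m (\<delta> a)"
        have mem: "?x a \<in> carrier (?E m)" "?x b \<in> carrier (?E m)" "?y a \<in> carrier (?E m)" "?y b \<in> carrier (?E m)"
          using pmE \<gamma>P \<alpha>E \<delta>A ab by blast+
        have comm: "?x b \<otimes>\<^bsub>?E m\<^esub> ?y a = ?y a \<otimes>\<^bsub>?E m\<^esub> ?x b"
          using \<alpha>(3)[OF \<iota>A[OF \<gamma>C] \<delta>A, of b a m] ab by (simp add: \<gamma>_eq)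
        have "?x (a \<otimes>\<^bsub>A\<^esub> b) = ?x a \<otimes>\<^bsub>?E m\<^esub> ?x b" "?y (a \<otimes>\<^bsub>A\<^esub> b) = ?y a \<otimes>\<^bsub>?E m\<^esub> ?y b"
          using pm\<gamma>[of m] \<alpha>\<delta>[of m] ab by (simp_all add: disc_hom_def hom_def)
        then have "\<beta> m (a \<otimes>\<^bsub>A\<^esub> b) = (?x a \<otimes>\<^bsub>?E m\<^esub> ?x b) \<otimes>\<^bsub>?E m\<^esub> (?y a \<otimes>\<^bsub>?E m\<^esub> ?y b)"
          by (simp only: \<beta>_def)
        also have "\<dots> = ?x a \<otimes>\<^bsub>?E m\<^esub> (?x b \<otimes>\<^bsub>?E m\<^esub> ?y a) \<otimes>\<^bsub>?E m\<^esub> ?y b"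
          using mem by (simp only: Em.m_assoc Em.m_closed)
        also have "\<dots> = (?x a \<otimes>\<^bsub>?E m\<^esub> ?y a) \<otimes>\<^bsub>?E m\<^esub> (?x b \<otimes>\<^bsub>?E m\<^esub> ?y b)"
          unfolding comm using mem by (simp only: Em.m_assoc Em.m_closed)
        finally show ?thesis by (simp only: \<beta>_def)
      qed
      moreover have "\<beta> m a \<in> carrier (?E m)" if "a \<in> carrier A" for a
        unfolding \<beta>_def using pmE \<gamma>P \<alpha>E \<delta>A that by blast
      moreover have "loc_const A (\<beta> m)"
        unfolding \<beta>_def[abs_def] using pm\<gamma>[of m] \<alpha>\<delta>[of m]
          loc_const_compose2[of A "\<lambda>a. pm (\<pi>\<^sub>0 (\<gamma> a))" "\<lambda>a. \<alpha> m (\<delta> a)" "\<lambda>x y. x \<otimes>\<^bsub>?E m\<^esub> y"]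
        by (simp add: disc_hom_def)
      ultimately show ?thesis by (simp add: disc_hom_def hom_def)
    qed
    have \<beta>\<iota>: "pm (\<pi>\<^sub>0 c) = \<beta> m (\<iota> c)" if "c \<in> C" for c m
    proof -
      have "group_hom A (?E m) (\<alpha> m)"
        using \<alpha>(1)[of m] group_E_power A.is_group by (simp add: disc_hom_def group_hom_def group_hom_axioms_def)
      then have "\<alpha> m \<one>\<^bsub>A\<^esub> = \<one>\<^bsub>?E m\<^esub>" by (rule group_hom.hom_one)
      then show ?thesis
        using pmE[OF \<pi>\<^sub>0P[OF C.mem_carrier[OF that]], of m] group.is_monoid[OF group_E_power[of m]]
        by (simp add: \<beta>_def \<gamma>\<iota>[OF that] \<delta>\<iota>[OF that] monoid.r_one)
    qed
    have "\<exists>h. h \<in> disc_hom G (?E m) \<and> (\<forall>x\<in>carrier G0. h (\<phi> x) = pm (\<pi>\<^sub>0 x)) \<and>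
      (\<forall>a\<in>carrier A. h (\<psi> a) = \<beta> m a)" for m
    proof -
      obtain j where j: "order (?E m) = p ^ j" using order_E_power by blast
      have "pm (\<pi>\<^sub>0 c) = \<beta> m (\<iota> c)" if "c \<in> carrier (subtopgroup G0 C)" for c
        using \<beta>\<iota> that by (simp add: subtopgroup_def)
      from amalgamated_product_finite(1)[OF p G group_E_power j pm\<pi>\<^sub>0 \<beta> this] show ?thesis by blast
    qed
    then obtain h where h: "\<And>m. h m \<in> disc_hom G (?E m)"
      "\<And>m x. x \<in> carrier G0 \<Longrightarrow> h m (\<phi> x) = pm (\<pi>\<^sub>0 x)" "\<And>m a. a \<in> carrier A \<Longrightarrow> h m (\<psi> a) = \<beta> m a"
      by metis
    have snd_\<alpha>: "snd (\<alpha> m a) = \<one>\<^bsub>P\<^esub>" if "a \<in> carrier A" for m a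
    proof (rule topgen_equalizer[OF top(2) genA XA grpP _ _ _ that])
      show "(\<lambda>a. snd (\<alpha> m a)) \<in> disc_hom A P" using disc_hom_compose[OF \<alpha>(1) snd_hom] .
      show "(\<lambda>a. \<one>\<^bsub>P\<^esub>) \<in> disc_hom A P" by (auto simp: disc_hom_def hom_def)
    qed (simp only: \<alpha>(2) snd_elem)
    have \<alpha>_red: "(case \<alpha> (Suc m) a of (M, q) \<Rightarrow> (\<lambda>u v. M u v mod int p ^ Suc m, q)) = \<alpha> m a"
      if "a \<in> carrier A" for m a
      by (rule compat_topgen[OF top(2) genA XA \<alpha>(1) \<alpha>(1) _ that])
         (simp only: \<alpha>(2) reduce_id[OF elem_closed[OF s idx_less modulus(1)]])
    \<comment> \<open>\<open>\<alpha>\<close> represents \<open>\<sigma> \<circ> \<delta>\<close>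
      rather than \<open>\<sigma>\<close>, since the variables stand for the components
      \<open>\<delta> x\<close>.\<close>
    have rel_\<alpha>: "rel (\<alpha> 0 a) (\<sigma> (\<delta> a))" if "a \<in> carrier A" for a
      by (rule rel_topgen[OF top(2) genA XA \<alpha>(1) cont_hom_disc_hom[OF \<delta> \<sigma>] _ that])
         (use rel_elem[OF s idx_less] s_idx \<alpha>(2) in simp)
    show ?thesis
    proof (rule model_infinite_order[OF top(3) h(1) _ H(1) _ w(1) \<pi>P[OF wG] \<pi>w])
      show "(case h (Suc m) g of (M, q) \<Rightarrow> (\<lambda>u v. M u v mod int p ^ Suc m, q)) = h m g"
        if "g \<in> carrier G" for m g
      proof (rule compat_topgen[OF top(3) genG genG_sub h(1) h(1) _ that])
        fix y assume "y \<in> \<phi> ` carrier G0 \<union> \<psi> ` carrier A"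
        then consider x where "x \<in> carrier G0" "y = \<phi> x" | a where "a \<in> carrier A" "y = \<psi> a" by blast
        then show "(case h (Suc m) y of (M, q) \<Rightarrow> (\<lambda>u v. M u v mod int p ^ Suc m, q)) = h m y"
        proof cases
          case 1
          then show ?thesis using pm_red \<pi>\<^sub>0P by (simp only: h(2))
        next
          case 2
          let ?r = "\<lambda>(M, q). (\<lambda>u v. M u v mod int p ^ Suc m, q)"
          have "?r (pm (\<pi>\<^sub>0 (\<gamma> a)) \<otimes>\<^bsub>?E (Suc m)\<^esub> \<alpha> (Suc m) (\<delta> a)) =
              ?r (pm (\<pi>\<^sub>0 (\<gamma> a))) \<otimes>\<^bsub>?E m\<^esub> ?r (\<alpha> (Suc m) (\<delta> a))"
            using reduce_power_hom[of m] pmE[OF \<gamma>P[OF 2(1)], of "Suc m"] \<alpha>E[OF \<delta>A[OF 2(1)], of "Suc m"]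
            by (intro hom_mult)
          then show ?thesis
            using pm_red[OF \<gamma>P[OF 2(1)], of m] \<alpha>_red[OF \<delta>A[OF 2(1)], of m]
            by (simp only: 2 h(3) \<beta>_def)
        qed
      qed
      \<comment> \<open>The variables have trivial component in \<open>P\<close>, so only the
        permutation part contributes, and it factors through \<open>\<rho>\<close>. In the present
        case this makes the matrices unipotent on \<open>H\<close>.\<close>
      have "snd (h m g) = \<pi>\<^sub>0 (\<rho> g)" if "g \<in> carrier G" for m g
      proof (rule topgen_equalizer[OF top(3) genG genG_sub grpP _ _ _ that])
        show "(\<lambda>g. snd (h m g)) \<in> disc_hom G P" using disc_hom_compose[OF h(1) snd_hom] .
        show "(\<lambda>g. \<pi>\<^sub>0 (\<rho> g)) \<in> disc_hom G P" by (rule cont_hom_disc_hom[OF \<rho>(1) \<pi>\<^sub>0])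
        fix y assume "y \<in> \<phi> ` carrier G0 \<union> \<psi> ` carrier A"
        then consider x where "x \<in> carrier G0" "y = \<phi> x" | a where "a \<in> carrier A" "y = \<psi> a" by blast
        then show "snd (h m y) = \<pi>\<^sub>0 (\<rho> y)"
        proof cases
          case 1
          then show ?thesis by (simp add: h(2) \<rho>(2) pm_def)
        next
          case 2
          have "snd (\<beta> m a) = snd (pm (\<pi>\<^sub>0 (\<gamma> a))) \<otimes>\<^bsub>P\<^esub> snd (\<alpha> m (\<delta> a))"
            unfolding \<beta>_def using pmE[OF \<gamma>P[OF 2(1)]] \<alpha>E[OF \<delta>A[OF 2(1)]] by (intro hom_mult[OF snd_hom])
          then show ?thesis using 2 \<gamma>P[OF 2(1)] snd_\<alpha>[OF \<delta>A[OF 2(1)]] by (simp add: h(3) \<rho>(3) pm_def)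
        qed
      qed
      moreover have "\<pi>\<^sub>0 \<one>\<^bsub>G0\<^esub> = \<one>\<^bsub>P\<^esub>"
        using \<pi>\<^sub>0 hom_one[of \<pi>\<^sub>0 G0 P] top(1) grpP by (simp add: disc_hom_def topological_group_def)
      ultimately show "snd (h m g) = \<one>\<^bsub>P\<^esub>" if "g \<in> H" for m g
        using that True subgroup.subset[OF H(1)] by (metis imageI singletonD subsetD)
      show "rel (h 0 w) (\<pi> w)"
      proof (rule rel_topgen[OF top(3) genG genG_sub h(1) \<pi> _ wG])
        fix y assume "y \<in> \<phi> ` carrier G0 \<union> \<psi> ` carrier A"
        then consider x where "x \<in> carrier G0" "y = \<phi> x" | a where "a \<in> carrier A" "y = \<psi> a" by blast
        then show "rel (h 0 y) (\<pi> y)"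
        proof cases
          case 1
          then show ?thesis using rel_perm[OF \<pi>\<^sub>0P[OF 1(1)]] by (simp only: h(2) pm_def \<pi>\<^sub>0_def)
        next
          case 2
          \<comment> \<open>On values of the idempotent \<open>\<delta>\<close> the maps
            \<open>\<sigma> \<circ> \<delta>\<close> and \<open>\<sigma>\<close> agree.\<close>
          have "rel (\<alpha> 0 (\<delta> a)) (\<sigma> (\<delta> a))" using rel_\<alpha>[OF \<delta>A[OF 2(1)]] \<delta>\<delta>[OF 2(1)] by simp
          then have "rel (pm (\<pi>\<^sub>0 (\<gamma> a)) \<otimes>\<^bsub>?E 0\<^esub> \<alpha> 0 (\<delta> a)) (\<pi>\<^sub>0 (\<gamma> a) \<otimes>\<^bsub>P\<^esub> \<sigma> (\<delta> a))"
            using 2(1) \<gamma>P \<sigma>P \<delta>A pmE \<alpha>E rel_perm unfolding pm_def[symmetric]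
            by (intro rel_mult modulus(2)) (simp_all only: pm_def)
          moreover have "\<sigma> a = \<pi>\<^sub>0 (\<gamma> a) \<otimes>\<^bsub>P\<^esub> \<sigma> (\<delta> a)"
            using \<sigma>_mult[OF \<iota>A[OF \<gamma>C] \<delta>A, of a a] dec[OF 2(1)] 2(1) by (simp add: \<gamma>_eq)
          ultimately show ?thesis using 2 by (simp only: h(3) \<beta>_def \<sigma>_def)
        qed
      qed
    qed
  qed
qed

section \<open>Induction along the construction and passage to the abelianisation\<close>

lemma class_G_infinite_order:
  fixes G :: "('a :: infinite) topgroup"
  assumes p: "prime p"
  shows "G \<in> class_G p n \<Longrightarrow> subgroup H G \<Longrightarrow> H \<noteq> {\<one>\<^bsub>G\<^esub>} \<Longrightarrow> infinite_order_mod_derived G H"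
proof (induction n arbitrary: G H)
  case 0
  then show ?case using free_pro_p_infinite_order[OF p] by (auto simp: fg_free_pro_p_def)
next
  case (Suc n)
  obtain G0 C A \<iota> \<phi> \<psi> where G0: "G0 \<in> class_G p n" and C: "self_centralised C G0"
    and A: "fg_free_abelian_pro_p p A" "direct_summand (\<iota> ` C) A"
    and G: "amalgamated_product p (subtopgroup G0 C) (\<lambda>c. c) G0 \<iota> A G \<phi> \<psi>"
    using Suc.prems(1) by auto
  have grp: "group G0"
    using G pro_p_groupD(1) by (auto simp: amalgamated_product_def topological_group_def)
  \<comment> \<open>A self-centralised set is a centraliser and hence a subgroup.\<close>
  have eq: "{g \<in> carrier G0. \<forall>c\<in>C. g \<otimes>\<^bsub>G0\<^esub> c = c \<otimes>\<^bsub>G0\<^esub> g} = C"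
    using C unfolding self_centralised_def centralizer_def .
  then have "C \<subseteq> carrier G0" by blast
  then have "subgroup C G0" using subgroup_centralizer[OF grp, of C] by (simp only: eq)
  then show ?case
    using extension_infinite_order[OF p Suc.IH[OF G0] _ A G Suc.prems(2,3)] by blast
qed

theorem proposition3p6:
  fixes p :: nat and K :: "('a::infinite) topgroup"
  assumes "prime p"
    and "K \<in> class_L p"
    and "carrier K \<noteq> {\<one>\<^bsub>K\<^esub>}"
  shows "infinite (carrier (K Mod commutator_subgroup K))"
proof
  let ?D = "commutator_subgroup K"
  obtain n and G :: "'a topgroup" and H where G: "G \<in> class_G p n" "closed_subgroup H G"
    "topgroup_iso K (subtopgroup G H)" and proK: "pro_p_group p K"
    using assms(2) by (auto simp: class_L_def)
  interpret K: topological_group K by (rule pro_p_groupD(1)[OF proK])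
  have H: "subgroup H G" using G(2) by (simp add: closed_subgroup_def)
  obtain f where f: "f \<in> iso K (subtopgroup G H)"
    and f_homeo: "homeomorphic_map (gtop K) (gtop (subtopgroup G H)) f"
    using G(3) by (auto simp: topgroup_iso_def)
  have f_img: "f ` carrier K = H" using f by (auto simp: iso_def bij_betw_def subtopgroup_def)
  have "topological_group G"
    using G(1) by (cases n) (auto simp: fg_free_pro_p_def free_object_def amalgamated_product_def dest: pro_p_groupD)
  have f_hom: "f \<in> cont_hom K G"
  proof -
    have "continuous_map (gtop K) (subtopology (gtop G) H) f"
      using homeomorphic_imp_continuous_map[OF f_homeo] by (simp add: subtopgroup_def)
    then have "continuous_map (gtop K) (gtop G) f" by (rule continuous_map_into_fulltopology)
    moreover have "f \<in> hom K G" using f subgroup.subset[OF H] by (auto simp: iso_def hom_def subtopgroup_def)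
    ultimately show ?thesis by (simp add: cont_hom_def)
  qed
  have "H \<noteq> {\<one>\<^bsub>G\<^esub>}"
  proof
    assume "H = {\<one>\<^bsub>G\<^esub>}"
    moreover have "f x \<in> H" if "x \<in> carrier K" for x using that f_img by blast
    ultimately have "f x = f \<one>\<^bsub>K\<^esub>" if "x \<in> carrier K" for x using that K.one_closed by auto
    moreover have "inj_on f (carrier K)" using f by (auto simp: iso_def bij_betw_def)
    ultimately have "x = \<one>\<^bsub>K\<^esub>" if "x \<in> carrier K" for x using that K.one_closed by (meson inj_onD)
    then have "carrier K = {\<one>\<^bsub>K\<^esub>}" using K.one_closed by blast
    then show False using assms(3) by simp
  qed
  then have "infinite_order_mod_derived G (f ` carrier K)"
    unfolding f_img by (rule class_G_infinite_order[OF assms(1) G(1) H])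
  then have "infinite_order_mod_derived K (carrier K)"
    by (rule infinite_order_mod_derived_pullback[OF f_hom K.topological_group_axioms \<open>topological_group G\<close> K.subgroup_self])
  then obtain k where k: "k \<in> carrier K" "\<And>n :: nat. n > 0 \<Longrightarrow> k [^]\<^bsub>K\<^esub> n \<notin> ?D"
    unfolding infinite_order_mod_derived_def commutator_subgroup_def by blast
  have one: "\<one>\<^bsub>K\<^esub> \<in> ?D"
  proof -
    have "subgroup (derived K (carrier K)) K" by (rule K.derived_is_subgroup) simp
    then have "\<one>\<^bsub>K\<^esub> \<in> derived K (carrier K)" "derived K (carrier K) \<subseteq> topspace (gtop K)"
      by (simp_all add: subgroup.one_closed subgroup.subset K.topspace_gtop)
    then show ?thesis unfolding commutator_subgroup_def using closure_of_subset by blast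
  qed
  \<comment> \<open>Two equal cosets would put \<open>k ^ j\<close> into the coset of
    \<open>k ^ i\<close>, because \<open>?D\<close> contains the unit, and then
    \<open>k ^ (j - i)\<close> into \<open>?D\<close>.\<close>
  have neq: "?D #>\<^bsub>K\<^esub> k [^]\<^bsub>K\<^esub> i \<noteq> ?D #>\<^bsub>K\<^esub> k [^]\<^bsub>K\<^esub> j" if "i < j" for i j :: nat
  proof
    assume eq: "?D #>\<^bsub>K\<^esub> k [^]\<^bsub>K\<^esub> i = ?D #>\<^bsub>K\<^esub> k [^]\<^bsub>K\<^esub> j"
    have "\<one>\<^bsub>K\<^esub> \<otimes>\<^bsub>K\<^esub> k [^]\<^bsub>K\<^esub> j \<in> ?D #>\<^bsub>K\<^esub> k [^]\<^bsub>K\<^esub> i"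
      using one unfolding eq unfolding r_coset_def by blast
    moreover have "\<one>\<^bsub>K\<^esub> \<otimes>\<^bsub>K\<^esub> k [^]\<^bsub>K\<^esub> j = k [^]\<^bsub>K\<^esub> j" using k(1) by simp
    ultimately have "k [^]\<^bsub>K\<^esub> j \<in> ?D #>\<^bsub>K\<^esub> k [^]\<^bsub>K\<^esub> i" by (simp only:)
    then obtain d where d: "d \<in> ?D" "k [^]\<^bsub>K\<^esub> j = d \<otimes>\<^bsub>K\<^esub> k [^]\<^bsub>K\<^esub> i"
      unfolding r_coset_def by (elim UN_E singletonE) (rule that)
    have dK: "d \<in> carrier K"
      using d(1) closure_of_subset_topspace[of "gtop K" "derived K (carrier K)"]
      unfolding commutator_subgroup_def K.topspace_gtop by (rule subsetD[rotated])
    have "k [^]\<^bsub>K\<^esub> (j - i) \<otimes>\<^bsub>K\<^esub> k [^]\<^bsub>K\<^esub> i = d \<otimes>\<^bsub>K\<^esub> k [^]\<^bsub>K\<^esub> i"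
      unfolding d(2)[symmetric] using k(1) that by (simp add: K.nat_pow_mult)
    then have "k [^]\<^bsub>K\<^esub> (j - i) = d" using k(1) dK by (simp only: K.right_cancel K.nat_pow_closed)
    then show False using d(1) k(2)[of "j - i"] that by simp
  qed
  then have "inj (\<lambda>i :: nat. ?D #>\<^bsub>K\<^esub> k [^]\<^bsub>K\<^esub> i)"
    by (intro injI) (metis linorder_neqE_nat)
  moreover have "range (\<lambda>i :: nat. ?D #>\<^bsub>K\<^esub> k [^]\<^bsub>K\<^esub> i) \<subseteq> carrier (K Mod ?D)"
    using k(1) by (auto simp: carrier_FactGroup)
  moreover assume "finite (carrier (K Mod ?D))"
  ultimately show False by (meson finite_subset finite_imageD infinite_UNIV_nat)
qed

end
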